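(* Let $n\to+\infty$ and $p=p_n\to+\infty$, and for each $n$ let $X^{(1)},\dots,X^{(n)}$ be i.i.d. $\mathcal{N}(\mu,\Sigma)$ in $\mathbb{R}^p$, where $\mu\in\mathbb{R}^p$ and the symmetric positive definite matrix $\Sigma=(\sigma_{ij})$ may depend on $n$. Let $B^*=B(\Sigma)$ be the finest block decomposition of $\Sigma$. Assume: (1) $p/n\to y\in\,]0,1[$; (2) there exist $\lambda_{\inf}>0$ and $\lambda_{\sup}<+\infty$ such that for all $n$ the eigenvalues of $\Sigma$ lie in $[\lambda_{\inf},\lambda_{\sup}]$; (3) there exists $m\in\mathbb{N}^*$ such that for all $n$, $|A|\le m$ for every $A\in B^*$; (4) there exists $a>0$ such that for all $n$ and all partitions $B<B^*$, $\|\Sigma_B-\Sigma\|_{\max}\ge a\,n^{-1/4}$. Fix $\delta\in\,]1/2,1[$ and let $\kappa=\frac{1}{pn^\delta}$. Let $\widehat B$ be any one of the four estimators $\widehat{B}_{tot},\widehat{B}_{\widehat{C}},\widehat{B}_\lambda,\widehat{B}_s$ defined in the context. Then $$\mathbb{P}\left(\widehat{B}=B^*\right)\longrightarrow 1.$$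
   Context: Partitions: $[1:p]=\{1,\dots,p\}$ and $\mathcal{P}_p$ is the set of partitions of $[1:p]$. For $B,B'\in\mathcal{P}_p$, $B\le B'$ ($B$ is finer than $B'$) if every element of $B'$ is a disjoint union of elements of $B$; $B<B'$ means $B\le B'$ and $B\ne B'$. Write $(i,j)\in B$ if $i,j$ belong to the same element of $B$. For a symmetric matrix $\Gamma=(\gamma_{ij})$, $\Gamma_B$ is the matrix with entries $\gamma_{ij}$ if $(i,j)\in B$ and $0$ otherwise. $B(\Gamma)$ is the unique finest partition $B$ with $\Gamma=\Gamma_B$. $\|M\|_{\max}=\max_{i,j}|m_{ij}|$. Empirical quantities: $\overline{X}=\frac1n\sum_{l=1}^nX^{(l)}$, $S=(s_{ij})=\frac1n\sum_{l=1}^n(X^{(l)}-\overline X)(X^{(l)}-\overline X)^T$ (for large $n$, $n>p$ and $S$ is almost surely positive definite), $\widehat C_{ij}=s_{ij}/\sqrt{s_{ii}s_{jj}}$. Criterion: for $\Gamma$ symmetric positive definite, $l_\Gamma=\frac1p\left(\log|\Gamma|+\mathrm{Tr}(\Gamma^{-1}S)\right)$, where $|\Gamma|$ is the determinant; $\mathrm{pen}(\Gamma)=\mathrm{pen}(B(\Gamma))=\sum_{k=1}^Kp_k^2$ if $B(\Gamma)=\{B_1,\dots,B_K\}$ with $|B_k|=p_k$; $\Phi(\Gamma)=l_\Gamma+\kappa\,\mathrm{pen}(\Gamma)$; $\Psi(B)=\Phi(S_B)$. Thresholded partitions: for $\lambda\in[0,1]$, $B_\lambda=B(\widehat C_\lambda)$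 with $\widehat C_\lambda=(\widehat C_{ij}\mathbf 1_{|\widehat C_{ij}|>\lambda})_{i,j\le p}$. Estimators: - $\widehat B_{tot}=\operatorname{argmin}_{B\in\mathcal P_p}\Psi(B)$; - $\widehat B_{\widehat C}=\operatorname{argmin}\{\Psi(B): B=B_\lambda,\ \lambda\in A_{\widehat C}\}$ with $A_{\widehat C}=\{|\widehat C_{ij}|: 1\le i<j\le p\}$; - $\widehat B_\lambda=B_{n^{-1/3}}$ (the partition obtained with threshold $n^{-1/3}$); - $\widehat B_s=\operatorname{argmin}\{\Psi(B): B=B_\lambda,\ \lambda\in A_s\}$ with $A_s=\{s/p,(s+1)/p,\dots,(p-1)/p,1\}$, where $s$ is the smallest integer such that all groups of $B_{s/p}$ have cardinality at most $m$ (the $m$ of assumption (3), assumed known). *)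

theory Defs
  imports
    "HOL-Probability.Probability"
    "HOL-Library.Disjoint_Sets"
    "Jordan_Normal_Form.Char_Poly"
    "Jordan_Normal_Form.Gauss_Jordan_Elimination"
begin

text \<open>The index set \<open>[1:p]\<close> is rendered as \<open>{..<p}\<close>, since matrices and vectors of varying
  dimension are those of \<open>Jordan_Normal_Form\<close>, which are indexed from \<open>0\<close>.\<close>

unbundle no vec_syntax

section \<open>Matrices\<close>

definition positive_definite :: "real Matrix.mat \<Rightarrow> bool" where
  "positive_definite A \<longleftrightarrow>
     (\<forall>v \<in> carrier_vec (dim_row A). v \<noteq> 0\<^sub>v (dim_row A) \<longrightarrow> scalar_prod v (A *\<^sub>v v) > 0)"

text \<open>The value at a singular matrix is irrelevant, and set to zero by convention.\<close>

definition inv_mat :: "real Matrix.mat \<Rightarrow> real Matrix.mat" where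
  "inv_mat A = (case mat_inverse A of Some A' \<Rightarrow> A' | None \<Rightarrow> 0\<^sub>m (dim_row A) (dim_col A))"

definition trace_mat :: "real Matrix.mat \<Rightarrow> real" where
  "trace_mat A = (\<Sum>i<dim_row A. A $$ (i, i))"

definition max_norm :: "real Matrix.mat \<Rightarrow> real" where
  "max_norm A = Max {\<bar>A $$ (i, j)\<bar> | i j. i < dim_row A \<and> j < dim_col A}"

section \<open>Partitions and block structures\<close>

definition strictly_refines :: "'a set \<Rightarrow> 'a set set \<Rightarrow> 'a set set \<Rightarrow> bool" where
  "strictly_refines A B B' \<longleftrightarrow> refines A B B' \<and> B \<noteq> B'"

definition same_block :: "nat set set \<Rightarrow> nat \<Rightarrow> nat \<Rightarrow> bool" where
  "same_block B i j \<longleftrightarrow> (\<exists>G\<in>B. i \<in> G \<and> j \<in> G)"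

definition restrict_blocks :: "real Matrix.mat \<Rightarrow> nat set set \<Rightarrow> real Matrix.mat" where
  "restrict_blocks \<Gamma> B = Matrix.mat (dim_row \<Gamma>) (dim_col \<Gamma>)
     (\<lambda>(i, j). if same_block B i j then \<Gamma> $$ (i, j) else 0)"

definition is_block_partition :: "real Matrix.mat \<Rightarrow> nat set set \<Rightarrow> bool" where
  "is_block_partition \<Gamma> B \<longleftrightarrow> partition_on {..<dim_row \<Gamma>} B \<and> \<Gamma> = restrict_blocks \<Gamma> B"

definition finest_blocks :: "real Matrix.mat \<Rightarrow> nat set set" where
  "finest_blocks \<Gamma> = (THE B. is_block_partition \<Gamma> B \<and>
     (\<forall>B'. is_block_partition \<Gamma> B' \<longrightarrow> refines {..<dim_row \<Gamma>} B B'))"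

lemma finest_blocks_ex1:
  assumes "\<Gamma> \<in> carrier_mat p p"
  shows "\<exists>!B. is_block_partition \<Gamma> B \<and>
     (\<forall>B'. is_block_partition \<Gamma> B' \<longrightarrow> refines {..<dim_row \<Gamma>} B B')"
proof -
  have dims: "dim_row \<Gamma> = p" "dim_col \<Gamma> = p" using assms by auto
  have iff: "is_block_partition \<Gamma> B \<longleftrightarrow> partition_on {..<p} B \<and>
      (\<forall>i<p. \<forall>j<p. \<Gamma> $$ (i, j) \<noteq> 0 \<longrightarrow> same_block B i j)" for B
  proof -
    have "\<Gamma> = restrict_blocks \<Gamma> B \<longleftrightarrow>
        (\<forall>i<p. \<forall>j<p. \<Gamma> $$ (i, j) = (if same_block B i j then \<Gamma> $$ (i, j) else 0))"
      unfolding mat_eq_iff by (simp add: restrict_blocks_def dims)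
    also have "\<dots> \<longleftrightarrow> (\<forall>i<p. \<forall>j<p. \<Gamma> $$ (i, j) \<noteq> 0 \<longrightarrow> same_block B i j)"
      by (simp only: if_split) (intro all_cong1 imp_cong refl, blast)
    finally show ?thesis by (simp add: is_block_partition_def dims)
  qed
  define \<P> where "\<P> = {B. is_block_partition \<Gamma> B}"
  have part: "partition_on {..<p} B" if "B \<in> \<P>" for B
    using that by (simp add: \<P>_def iff)
  have "\<exists>B. B \<in> \<P>"
  proof (cases "p = 0")
    case True
    then show ?thesis by (intro exI[of _ "{}"]) (simp add: \<P>_def iff partition_on_def)
  next
    case False
    then have "partition_on {..<p} {{..<p}}"
      by (simp add: partition_on_space lessThan_empty_iff)
    then have "{{..<p}} \<in> \<P>" by (simp add: \<P>_def iff same_block_def)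
    then show ?thesis ..
  qed
  then have ne: "\<P> \<noteq> {}" by auto
  let ?B = "common_refinement \<P>"
  have "same_block ?B i j" if ij: "i < p" "j < p" "\<Gamma> $$ (i, j) \<noteq> 0" for i j
  proof -
    have "\<forall>P\<in>\<P>. \<exists>G. G \<in> P \<and> i \<in> G \<and> j \<in> G"
      using ij unfolding \<P>_def iff same_block_def by blast
    then obtain f where f: "\<And>P. P \<in> \<P> \<Longrightarrow> f P \<in> P \<and> i \<in> f P \<and> j \<in> f P" by metis
    then have "f \<in> (\<Pi> P\<in>\<P>. P)" "\<Inter> (f ` \<P>) \<noteq> {}" by auto
    then have "\<Inter> (f ` \<P>) \<in> ?B" unfolding common_refinement
      by (intro DiffI UN_I[of f]) simp_all
    then show ?thesis using f unfolding same_block_def by blast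
  qed
  then have "is_block_partition \<Gamma> ?B"
    using partition_on_common_refinement[OF part ne] by (simp add: iff)
  moreover have "refines {..<p} ?B B'" if "is_block_partition \<Gamma> B'" for B'
    using refines_common_refinement[of \<P>, OF part] that by (simp add: \<P>_def)
  ultimately have B: "is_block_partition \<Gamma> ?B \<and>
      (\<forall>B'. is_block_partition \<Gamma> B' \<longrightarrow> refines {..<p} ?B B')" by simp
  show ?thesis
    unfolding dims
  proof (rule ex1I[of _ ?B])
    fix B assume "is_block_partition \<Gamma> B \<and>
      (\<forall>B'. is_block_partition \<Gamma> B' \<longrightarrow> refines {..<p} B B')"
    with B show "B = ?B" by (intro refines_asym[of "{..<p}"]) simp_all
  qed (rule B)
qed

section \<open>Gaussian samples\<close>

text \<open>A random vector of dimension \<open>p\<close> takes values in the product space of \<open>p\<close> copies of the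
  real line, whose elements are functions on \<open>{..<p}\<close>. Nondegenerate Gaussian distributions
  (\<open>\<Sigma>\<close> positive definite) have the following density with respect to the Lebesgue measure.\<close>

abbreviation lborel_vec :: "nat \<Rightarrow> (nat \<Rightarrow> real) measure" where
  "lborel_vec p \<equiv> Pi\<^sub>M {..<p} (\<lambda>_. lborel)"

definition gaussian_density ::
    "nat \<Rightarrow> real Matrix.vec \<Rightarrow> real Matrix.mat \<Rightarrow> (nat \<Rightarrow> real) \<Rightarrow> real" where
  "gaussian_density p \<mu> \<Sigma> x =
     (let v = Matrix.vec p x - \<mu> in
      exp (- scalar_prod v (inv_mat \<Sigma> *\<^sub>v v) / 2) / sqrt ((2 * pi) ^ p * Determinant.det \<Sigma>))"

text \<open>\<open>X 1, \<dots>, X n\<close> are independent with distribution \<open>\<N>(\<mu>, \<Sigma>)\<close> on \<open>M\<close>.\<close>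

definition gaussian_sample ::
    "'a measure \<Rightarrow> nat \<Rightarrow> nat \<Rightarrow> real Matrix.vec \<Rightarrow> real Matrix.mat \<Rightarrow>
     (nat \<Rightarrow> 'a \<Rightarrow> nat \<Rightarrow> real) \<Rightarrow> bool" where
  "gaussian_sample M n p \<mu> \<Sigma> X \<longleftrightarrow>
     prob_space.indep_vars M (\<lambda>_. lborel_vec p) X {1..n} \<and>
     (\<forall>l\<in>{1..n}. distributed M (lborel_vec p) (X l) (\<lambda>x. ennreal (gaussian_density p \<mu> \<Sigma> x)))"

section \<open>Empirical quantities\<close>

text \<open>A data set is a function \<open>x\<close> such that \<open>x l i\<close> is the \<open>i\<close>-th coordinate of the \<open>l\<close>-th
  observation, for \<open>l \<in> {1..n}\<close> and \<open>i < p\<close>.\<close>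

definition emp_mean :: "nat \<Rightarrow> (nat \<Rightarrow> nat \<Rightarrow> real) \<Rightarrow> nat \<Rightarrow> real" where
  "emp_mean n x i = (\<Sum>l=1..n. x l i) / real n"

definition emp_cov :: "nat \<Rightarrow> nat \<Rightarrow> (nat \<Rightarrow> nat \<Rightarrow> real) \<Rightarrow> real Matrix.mat" where
  "emp_cov n p x = Matrix.mat p p
     (\<lambda>(i, j). (\<Sum>l=1..n. (x l i - emp_mean n x i) * (x l j - emp_mean n x j)) / real n)"

definition corr_mat :: "real Matrix.mat \<Rightarrow> real Matrix.mat" where
  "corr_mat S = Matrix.mat (dim_row S) (dim_col S)
     (\<lambda>(i, j). S $$ (i, j) / sqrt (S $$ (i, i) * S $$ (j, j)))"

section \<open>Penalized criterion\<close>

text \<open>In this section and the next one, \<open>S\<close> stands for the empirical covariance matrix and its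
  dimension for \<open>p\<close>.\<close>

definition neg_loglik :: "real Matrix.mat \<Rightarrow> real Matrix.mat \<Rightarrow> real" where
  "neg_loglik S \<Gamma> =
     (ln (Determinant.det \<Gamma>) + trace_mat (inv_mat \<Gamma> * S)) / real (dim_row S)"

definition pen :: "nat set set \<Rightarrow> real" where
  "pen B = (\<Sum>G\<in>B. (real (card G))\<^sup>2)"

definition crit_mat :: "real \<Rightarrow> real Matrix.mat \<Rightarrow> real Matrix.mat \<Rightarrow> real" where
  "crit_mat \<kappa> S \<Gamma> = neg_loglik S \<Gamma> + \<kappa> * pen (finest_blocks \<Gamma>)"

definition crit :: "real \<Rightarrow> real Matrix.mat \<Rightarrow> nat set set \<Rightarrow> real" where
  "crit \<kappa> S B = crit_mat \<kappa> S (restrict_blocks S B)"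

section \<open>Estimators\<close>

text \<open>Ties between minimizers are broken by the arbitrary choice in \<open>arg_min_on\<close>. The candidate
  set of \<open>B_corr\<close> is empty, and its value arbitrary, only in dimension at most \<open>1\<close>.\<close>

definition threshold_mat :: "real \<Rightarrow> real Matrix.mat \<Rightarrow> real Matrix.mat" where
  "threshold_mat t C = map_mat (\<lambda>c. if \<bar>c\<bar> > t then c else 0) C"

definition threshold_blocks :: "real Matrix.mat \<Rightarrow> real \<Rightarrow> nat set set" where
  "threshold_blocks S t = finest_blocks (threshold_mat t (corr_mat S))"

definition B_tot :: "real \<Rightarrow> real Matrix.mat \<Rightarrow> nat set set" where
  "B_tot \<kappa> S = arg_min_on (crit \<kappa> S) {B. partition_on {..<dim_row S} B}"

definition corr_levels :: "real Matrix.mat \<Rightarrow> real set" where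
  "corr_levels S = {\<bar>corr_mat S $$ (i, j)\<bar> | i j. i < j \<and> j < dim_row S}"

definition B_corr :: "real \<Rightarrow> real Matrix.mat \<Rightarrow> nat set set" where
  "B_corr \<kappa> S = arg_min_on (crit \<kappa> S) (threshold_blocks S ` corr_levels S)"

definition B_thr :: "nat \<Rightarrow> real Matrix.mat \<Rightarrow> nat set set" where
  "B_thr n S = threshold_blocks S (real n powr (-1/3))"

definition grid_start :: "nat \<Rightarrow> real Matrix.mat \<Rightarrow> nat" where
  "grid_start m S =
     (LEAST s. \<forall>G \<in> threshold_blocks S (real s / real (dim_row S)). card G \<le> m)"

definition grid_levels :: "nat \<Rightarrow> real Matrix.mat \<Rightarrow> real set" where
  "grid_levels m S = (\<lambda>k. real k / real (dim_row S)) ` {grid_start m S..dim_row S}"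

definition B_grid :: "nat \<Rightarrow> real \<Rightarrow> real Matrix.mat \<Rightarrow> nat set set" where
  "B_grid m \<kappa> S = arg_min_on (crit \<kappa> S) (threshold_blocks S ` grid_levels m S)"

end

theory Submission
  imports
    Defs
    "Jordan_Normal_Form.Schur_Decomposition"
    "HOL-Real_Asymp.Real_Asymp"
begin

text \<open>For a partition \<open>B\<close> the matrix \<open>S\<^sub>B\<close> has an inverse with block pattern \<open>B\<close>, so the trace term of the
  criterion is constant (\<open>neg_loglik_restrict\<close>) and, up to a factor \<open>1/p\<close> and a constant, the criterion of \<open>B\<close> is
  \<open>ln det S\<^sub>B + n\<^sup>-\<^sup>\<delta> pen B\<close>. An arbitrary competitor \<open>B\<close> is compared with the true partition \<open>B\<^sup>*\<close> in two steps, through the common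
  refinement \<open>C\<close> of \<open>B\<close> and \<open>B\<^sup>*\<close>; this treats all partitions at once, without a union bound.

  From \<open>B\<close> to \<open>C\<close> only entries across blocks of \<open>B\<^sup>*\<close> are dropped. There \<open>\<Sigma>\<close> is zero and \<open>S\<close> is of order
  \<open>\<tau> = n\<^sup>-\<^sup>1\<^sup>/\<^sup>2\<^sup>+\<^sup>\<epsilon>\<close>. The matrix \<open>S\<^sub>C\<^sup>-\<^sup>1 S\<^sub>B\<close> has real eigenvalues \<open>1 + \<theta>\<^sub>k\<close> (\<open>relative_spectrum\<close>); the \<open>\<theta>\<^sub>k\<close> have sum \<open>0\<close>
  because \<open>S\<^sub>B - S\<^sub>C\<close> lives off the blocks of \<open>B\<^sup>*\<close>, and sum of squares of order \<open>\<tau>\<^sup>2\<close> times the number of dropped entries,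
  which is \<open>pen B - pen C\<close>. So the likelihood lost is a multiple of \<open>\<tau>\<^sup>2 (pen B - pen C)\<close>, up to a factor \<open>ln (1/h)\<close> if \<open>h\<close> bounds
  the \<open>1 + \<theta>\<^sub>k\<close> from below (\<open>overfit_gain_small\<close>). As \<open>\<delta> < 1\<close>, the penalty gained is larger. The logarithm is what makes the
  argument elementary: of the full matrix \<open>S\<close> one needs only that its least eigenvalue is not smaller than a power of \<open>n\<close>.

  From \<open>C\<close> to \<open>B\<^sup>*\<close>, every block of \<open>B\<^sup>*\<close> that \<open>C\<close> splits contains an entry of order \<open>n\<^sup>-\<^sup>1\<^sup>/\<^sup>4\<close> that \<open>C\<close> drops, and the same
  second-order expansion shows that \<open>C\<close> loses a likelihood of order \<open>n\<^sup>-\<^sup>1\<^sup>/\<^sup>2\<close> per split block (\<open>underfit_loss_large\<close>), whereas the penalty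
  saved is at most \<open>m\<^sup>2 n\<^sup>-\<^sup>\<delta>\<close>. As \<open>\<delta> > 1/2\<close>, this is smaller. Hence \<open>B\<^sup>*\<close> is the unique minimizer over all partitions
  (\<open>Bst_unique_minimizer\<close>). Thresholding recovers \<open>B\<^sup>*\<close> for every level between the noise, of order \<open>\<tau>\<close>, and the signal, of order
  \<open>n\<^sup>-\<^sup>1\<^sup>/\<^sup>4\<close> (\<open>threshold_window\<close>). This window contains \<open>n\<^sup>-\<^sup>1\<^sup>/\<^sup>3\<close>, a multiple of \<open>1/p\<close>, and, in the form of
  \<open>threshold_recovers\<close>, the largest correlation across blocks, so each restricted estimator has \<open>B\<^sup>*\<close> among its candidates.

  It remains to show that these conditions hold with probability tending to one (\<open>concentration_event\<close>). Linear forms of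
  the observations are normal (\<open>linear_form_normal\<close>). Chernoff bounds for their first and second moments control all entries
  of \<open>S\<close>. For the least eigenvalue, let \<open>N = n ^ K\<close>: if it were below \<open>1 / (n p N\<^sup>2)\<close>, all observations would be nearly constant along one of
  about \<open>N ^ p\<close> net directions, up to an error of order \<open>n\<^sup>2 / N\<close>; for a given direction and constant this has probability of order
  \<open>(n\<^sup>2 / N) ^ n\<close>, and the union bound succeeds for large \<open>K\<close> since \<open>p / n\<close> tends to a limit below \<open>1\<close>. Finally, almost surely no entry of \<open>S\<close> vanishes
  (\<open>emp_cov_nonzero_AE\<close>), so that the penalty of \<open>S\<^sub>B\<close> is that of \<open>B\<close>, and the estimators are measurable although ties are
  broken arbitrarily (\<open>pred_arg_min_on\<close>).\<close>

section \<open>The spectrum of a pair of symmetric matrices\<close>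

lemma trace_mult_comm:
  fixes A B :: "'a::comm_ring_1 Matrix.mat"
  assumes "A \<in> carrier_mat n n" "B \<in> carrier_mat n n"
  shows "(\<Sum>i<n. (A * B) $$ (i,i)) = (\<Sum>i<n. (B * A) $$ (i,i))"
proof -
  have "(\<Sum>i<n. (A * B) $$ (i,i)) = (\<Sum>i<n. \<Sum>k<n. A $$ (i,k) * B $$ (k,i))"
    using assms by (auto simp: scalar_prod_def lessThan_atLeast0 intro!: sum.cong)
  also have "\<dots> = (\<Sum>k<n. \<Sum>i<n. B $$ (k,i) * A $$ (i,k))"
    by (subst sum.swap) (simp add: mult.commute)
  also have "\<dots> = (\<Sum>i<n. (B * A) $$ (i,i))"
    using assms by (auto simp: scalar_prod_def lessThan_atLeast0 intro!: sum.cong)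
  finally show ?thesis .
qed

text \<open>A similar triangular matrix carries the eigenvalues on its diagonal, and determinant and traces of powers
  are read off there.\<close>

lemma complex_spectrum:
  fixes A :: "complex Matrix.mat"
  assumes A: "A \<in> carrier_mat n n"
  obtains \<theta> where "Determinant.det (1\<^sub>m n + A) = (\<Prod>i<n. 1 + \<theta> i)"
    "(\<Sum>i<n. A $$ (i,i)) = (\<Sum>i<n. \<theta> i)"
    "(\<Sum>i<n. (A * A) $$ (i,i)) = (\<Sum>i<n. (\<theta> i)\<^sup>2)"
    "\<And>i. i < n \<Longrightarrow> eigenvalue A (\<theta> i)"
proof -
  obtain es where es: "char_poly A = (\<Prod>a\<leftarrow>es. [:- a, 1:])" "length es = n"
    using char_poly_factorized[OF A] by blast
  obtain B P Q where schur: "schur_decomposition A es = (B,P,Q)" by (metis prod_cases3)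
  have wit: "similar_mat_wit A B P Q" and ut: "upper_triangular B" and dg: "diag_mat B = es"
    using schur_decomposition[OF A es(1) schur] by auto
  have c: "B \<in> carrier_mat n n" "P \<in> carrier_mat n n" "Q \<in> carrier_mat n n"
    and PQ: "P * Q = 1\<^sub>m n" and QP: "Q * P = 1\<^sub>m n" and ABPQ: "A = P * B * Q"
    using similar_mat_witD2[OF A wit] by auto
  define \<theta> where "\<theta> i = B $$ (i,i)" for i
  have tr: "(\<Sum>i<n. (P * X * Q) $$ (i,i)) = (\<Sum>i<n. X $$ (i,i))" if "X \<in> carrier_mat n n" for X
  proof -
    have "(\<Sum>i<n. (P * X * Q) $$ (i,i)) = (\<Sum>i<n. (Q * (P * X)) $$ (i,i))"
      using that c by (intro trace_mult_comm) auto
    also have "Q * (P * X) = (Q * P) * X" using that c by (simp add: assoc_mult_mat[of _ n n _ n _ n])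
    finally show ?thesis using that QP by simp
  qed
  have AA: "A * A = P * (B * B) * Q"
  proof -
    have "A * A = P * (B * ((Q * P) * (B * Q)))"
      unfolding ABPQ using c by (simp add: assoc_mult_mat[of _ n n _ n _ n])
    also have "\<dots> = P * (B * B) * Q" using c QP by (simp add: assoc_mult_mat[of _ n n _ n _ n])
    finally show ?thesis .
  qed
  have BB: "(B * B) $$ (i,i) = (\<theta> i)\<^sup>2" if "i < n" for i
  proof -
    have "(B * B) $$ (i,i) = (\<Sum>k<n. B $$ (i,k) * B $$ (k,i))"
      using c that by (auto simp: scalar_prod_def lessThan_atLeast0)
    also have "\<dots> = (\<Sum>k<n. if k = i then (\<theta> i)\<^sup>2 else 0)"
    proof (rule sum.cong, simp)
      fix k assume "k \<in> {..<n}"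
      then have "k < i \<or> i < k \<longrightarrow> B $$ (i,k) * B $$ (k,i) = 0"
        using upper_triangularD[OF ut] c that by (metis carrier_matD(1) lessThan_iff mult_zero_left mult_zero_right)
      then show "B $$ (i,k) * B $$ (k,i) = (if k = i then (\<theta> i)\<^sup>2 else 0)"
        by (auto simp: \<theta>_def power2_eq_square)
    qed
    finally show ?thesis using that by simp
  qed
  have det: "Determinant.det (1\<^sub>m n + A) = (\<Prod>i<n. 1 + \<theta> i)"
  proof -
    have "P * (1\<^sub>m n + B) * Q = (P + P * B) * Q"
      using c by (subst mult_add_distrib_mat[of P n n "1\<^sub>m n" n B]) auto
    also have "\<dots> = P * Q + P * B * Q" using c by (intro add_mult_distrib_mat[of _ n n]) auto
    finally have "1\<^sub>m n + A = P * (1\<^sub>m n + B) * Q" unfolding ABPQ PQ by simp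
    then have "Determinant.det (1\<^sub>m n + A) = Determinant.det P * Determinant.det (1\<^sub>m n + B) * Determinant.det Q"
      using c by (simp add: det_mult[of _ n])
    also have "\<dots> = Determinant.det (P * Q) * Determinant.det (1\<^sub>m n + B)"
      using c by (simp add: det_mult[of _ n])
    also have "\<dots> = Determinant.det (1\<^sub>m n + B)" using PQ by simp
    also have "\<dots> = prod_list (diag_mat (1\<^sub>m n + B))"
      by (rule det_upper_triangular[of _ n]) (use c ut in \<open>auto intro!: upper_triangularI dest: upper_triangularD\<close>)
    also have "\<dots> = (\<Prod>i<n. 1 + \<theta> i)"
      unfolding prod_list_diag_prod using c by (auto simp: \<theta>_def lessThan_atLeast0 intro!: prod.cong)
    finally show ?thesis .
  qed
  show ?thesis
  proof (rule that[of \<theta>])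
    show "eigenvalue A (\<theta> i)" if "i < n" for i
    proof -
      have "\<theta> i = es ! i" using that c by (simp add: dg[symmetric] \<theta>_def diag_mat_def)
      then have "\<theta> i \<in> set es" using that es by auto
      then have "poly (char_poly A) (\<theta> i) = 0" unfolding es(1) poly_prod_list
        by (auto simp: prod_list_zero_iff)
      then show ?thesis using eigenvalue_root_char_poly[OF A] by simp
    qed
  qed (use det tr[of B] tr[of "B * B"] c BB ABPQ AA in \<open>auto simp: \<theta>_def\<close>)
qed

text \<open>Quadratic forms are evaluated at functions, of which the first \<open>p\<close> values matter: estimates
  are then about sums over \<open>{..<p}\<close>, and no vector operations intervene.\<close>

definition qform :: "nat \<Rightarrow> real Matrix.mat \<Rightarrow> (nat \<Rightarrow> real) \<Rightarrow> real" where
  "qform p A x = (\<Sum>i<p. \<Sum>j<p. A $$ (i,j) * x i * x j)"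

definition pos_def :: "nat \<Rightarrow> real Matrix.mat \<Rightarrow> bool" where
  "pos_def p A \<longleftrightarrow> (\<forall>x. (\<exists>i<p. x i \<noteq> 0) \<longrightarrow> 0 < qform p A x)"

definition sym_mat :: "nat \<Rightarrow> real Matrix.mat \<Rightarrow> bool" where
  "sym_mat p A \<longleftrightarrow> A \<in> carrier_mat p p \<and> (\<forall>i<p. \<forall>j<p. A $$ (i,j) = A $$ (j,i))"

lemma qform_0: "(\<And>i. i < p \<Longrightarrow> x i = 0) \<Longrightarrow> qform p A x = 0"
  by (auto simp: qform_def)

lemma pos_defD: "pos_def p A \<Longrightarrow> i < p \<Longrightarrow> x i \<noteq> 0 \<Longrightarrow> 0 < qform p A x"
  by (auto simp: pos_def_def)

lemma pos_def_nonneg: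
  assumes "pos_def p A"
  shows "0 \<le> qform p A x"
proof (cases "\<exists>i<p. x i \<noteq> 0")
  case True
  then obtain i where "i < p" "x i \<noteq> 0" by blast
  then show ?thesis using pos_defD[OF assms] less_imp_le by blast
next
  case False
  then have "qform p A x = 0" by (intro qform_0) auto
  then show ?thesis by simp
qed

lemma mult_mat_vec_entry:
  "A \<in> carrier_mat p q \<Longrightarrow> v \<in> carrier_vec q \<Longrightarrow> i < p \<Longrightarrow>
   (A *\<^sub>v v) $ i = (\<Sum>j<q. A $$ (i,j) * v $ j)"
  by (auto simp: scalar_prod_def lessThan_atLeast0)

lemma mat_mult_entry:
  "A \<in> carrier_mat p q \<Longrightarrow> B \<in> carrier_mat q r \<Longrightarrow> i < p \<Longrightarrow> j < r \<Longrightarrow>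
   (A * B) $$ (i,j) = (\<Sum>k<q. A $$ (i,k) * B $$ (k,j))"
  by (auto simp: scalar_prod_def lessThan_atLeast0)

lemma pos_def_det_nonzero:
  assumes A: "A \<in> carrier_mat p p" and pd: "pos_def p A"
  shows "Determinant.det A \<noteq> 0"
proof
  assume "Determinant.det A = 0"
  then obtain v where v: "v \<in> carrier_vec p" "v \<noteq> 0\<^sub>v p" "A *\<^sub>v v = 0\<^sub>v p"
    using det_0_iff_vec_prod_zero_field[OF A] by blast
  have "qform p A (\<lambda>i. v $ i) = (\<Sum>i<p. v $ i * (A *\<^sub>v v) $ i)"
    using A v(1) by (auto simp: qform_def mult_mat_vec_entry sum_distrib_left mult_ac simp del: index_mult_mat_vec intro!: sum.cong)
  then have "qform p A (\<lambda>i. v $ i) = 0" using v by simp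
  moreover have "\<exists>i<p. v $ i \<noteq> 0" using v by (metis carrier_vecD eq_vecI index_zero_vec(1,2))
  ultimately show False using pd unfolding pos_def_def by force
qed

lemma pos_def_inverse:
  assumes A: "A \<in> carrier_mat p p" and pd: "pos_def p A"
  obtains P where "P \<in> carrier_mat p p" "A * P = 1\<^sub>m p" "P * A = 1\<^sub>m p"
proof -
  have "A \<in> Units (ring_mat TYPE(real) p ())"
    using det_non_zero_imp_unit[OF A pos_def_det_nonzero[OF A pd]] .
  then show ?thesis using that by (auto simp: Units_def ring_mat_def)
qed


text \<open>The antisymmetric cross terms of real and imaginary parts cancel, so that a Hermitian form with real
  symmetric coefficients is a sum of two real forms.\<close>

lemma hermitian_form_real:
  fixes v :: "nat \<Rightarrow> complex"
  assumes M: "sym_mat p M"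
  shows "(\<Sum>i<p. cnj (v i) * (\<Sum>j<p. complex_of_real (M $$ (i,j)) * v j)) =
    complex_of_real (qform p M (\<lambda>i. Re (v i)) + qform p M (\<lambda>i. Im (v i)))" (is "?l = ?r")
proof (rule complex_eqI)
  have l: "?l = (\<Sum>i<p. \<Sum>j<p. complex_of_real (M $$ (i,j)) * (cnj (v i) * v j))"
    by (simp add: sum_distrib_left mult_ac)
  show "Re ?l = Re ?r"
    unfolding l by (simp add: qform_def sum.distrib distrib_left mult.assoc)
  have "Im ?l = (\<Sum>i<p. \<Sum>j<p. M $$ (i,j) * (Re (v i) * Im (v j))) - (\<Sum>i<p. \<Sum>j<p. M $$ (i,j) * (Im (v i) * Re (v j)))"
    unfolding l by (simp add: sum_subtractf right_diff_distrib)
  also have "(\<Sum>i<p. \<Sum>j<p. M $$ (i,j) * (Im (v i) * Re (v j))) = (\<Sum>j<p. \<Sum>i<p. M $$ (j,i) * (Re (v j) * Im (v i)))"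
    by (subst sum.swap) (use M in \<open>auto simp: sym_mat_def mult_ac intro!: sum.cong\<close>)
  finally show "Im ?l = Im ?r" by simp
qed

text \<open>If \<open>D\<^sup>-\<^sup>1 F v = \<theta> v\<close> then \<open>v\<^sup>* F v = \<theta> (v\<^sup>* D v)\<close> with both forms real and \<open>v\<^sup>* D v > 0\<close>.
  Hence the eigenvalues of the matrix \<open>P F = D\<^sup>-\<^sup>1 F\<close>, though it is not symmetric, are real, and are enclosed
  by any bounds of the form of \<open>F\<close> relative to that of \<open>D\<close>. This replaces simultaneous diagonalization.\<close>

lemma relative_spectrum:
  assumes D: "sym_mat p D" and pd: "pos_def p D" and F: "sym_mat p F"
    and P: "P \<in> carrier_mat p p" and DP: "D * P = 1\<^sub>m p"
  obtains \<theta> :: "nat \<Rightarrow> real" where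
    "Determinant.det (D + F) = Determinant.det D * (\<Prod>i<p. 1 + \<theta> i)"
    "(\<Sum>i<p. (P * F) $$ (i,i)) = (\<Sum>i<p. \<theta> i)"
    "(\<Sum>i<p. (P * F * (P * F)) $$ (i,i)) = (\<Sum>i<p. (\<theta> i)\<^sup>2)"
    "\<And>k c. k < p \<Longrightarrow> (\<And>x. c * qform p D x \<le> qform p F x) \<Longrightarrow> c \<le> \<theta> k"
    "\<And>k c. k < p \<Longrightarrow> (\<And>x. qform p F x \<le> c * qform p D x) \<Longrightarrow> \<theta> k \<le> c"
proof -
  let ?c = "complex_of_real"
  have Dc: "D \<in> carrier_mat p p" and Fc: "F \<in> carrier_mat p p" using D F by (auto simp: sym_mat_def)
  define A where "A = map_mat ?c (P * F)"
  have A: "A \<in> carrier_mat p p" using P Fc by (auto simp: A_def)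
  obtain \<theta> where \<theta>: "Determinant.det (1\<^sub>m p + A) = (\<Prod>i<p. 1 + \<theta> i)"
    "(\<Sum>i<p. A $$ (i,i)) = (\<Sum>i<p. \<theta> i)"
    "(\<Sum>i<p. (A * A) $$ (i,i)) = (\<Sum>i<p. (\<theta> i)\<^sup>2)"
    "\<And>i. i < p \<Longrightarrow> eigenvalue A (\<theta> i)"
    using complex_spectrum[OF A] by blast
  have "\<exists>t. \<theta> k = ?c t \<and> (\<forall>c. (\<forall>x. c * qform p D x \<le> qform p F x) \<longrightarrow> c \<le> t) \<and>
      (\<forall>c. (\<forall>x. qform p F x \<le> c * qform p D x) \<longrightarrow> t \<le> c)" if k: "k < p" for k
  proof -
    obtain v where v: "v \<in> carrier_vec p" "v \<noteq> 0\<^sub>v p" "A *\<^sub>v v = \<theta> k \<cdot>\<^sub>v v"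
      using \<theta>(4)[OF k] A unfolding eigenvalue_def eigenvector_def by auto
    have DA: "map_mat ?c D * A = map_mat ?c F"
    proof -
      have "map_mat ?c D * A = map_mat ?c (D * (P * F))" unfolding A_def
        using Dc P Fc by (subst of_real_hom.mat_hom_mult[of _ p p _ p]) auto
      also have "D * (P * F) = F" using Dc P Fc DP by (simp add: assoc_mult_mat[of _ p p _ p _ p, symmetric])
      finally show ?thesis .
    qed
    have "map_mat ?c F *\<^sub>v v = map_mat ?c D *\<^sub>v (A *\<^sub>v v)"
      unfolding DA[symmetric] using Dc A v by (intro assoc_mult_mat_vec) auto
    also have "\<dots> = \<theta> k \<cdot>\<^sub>v (map_mat ?c D *\<^sub>v v)" using v Dc by (simp add: mult_mat_vec[of _ p p])
    finally have eq: "map_mat ?c F *\<^sub>v v = \<theta> k \<cdot>\<^sub>v (map_mat ?c D *\<^sub>v v)" .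
    have row: "(\<Sum>j<p. ?c (F $$ (i,j)) * v $ j) = \<theta> k * (\<Sum>j<p. ?c (D $$ (i,j)) * v $ j)" if i: "i < p" for i
    proof -
      have "(map_mat ?c F *\<^sub>v v) $ i = \<theta> k * (map_mat ?c D *\<^sub>v v) $ i"
        unfolding eq using i Dc v by simp
      then show ?thesis using i Dc Fc v by (simp add: mult_mat_vec_entry[of _ p p] del: index_mult_mat_vec)
    qed
    let ?x = "\<lambda>i. Re (v $ i)" and ?y = "\<lambda>i. Im (v $ i)"
    have "?c (qform p F ?x + qform p F ?y) = (\<Sum>i<p. cnj (v $ i) * (\<Sum>j<p. ?c (F $$ (i,j)) * v $ j))"
      using hermitian_form_real[OF F, of "\<lambda>i. v $ i"] by simp
    also have "\<dots> = \<theta> k * (\<Sum>i<p. cnj (v $ i) * (\<Sum>j<p. ?c (D $$ (i,j)) * v $ j))"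
      unfolding sum_distrib_left[of "\<theta> k"] by (intro sum.cong refl) (simp only: lessThan_iff row mult.left_commute)
    also have "\<dots> = \<theta> k * ?c (qform p D ?x + qform p D ?y)"
      using hermitian_form_real[OF D, of "\<lambda>i. v $ i"] by simp
    finally have main: "?c (qform p F ?x + qform p F ?y) = \<theta> k * ?c (qform p D ?x + qform p D ?y)" .
    have "\<exists>i<p. v $ i \<noteq> 0"
    proof (rule ccontr)
      assume "\<not> ?thesis"
      then have "v = 0\<^sub>v p" using v by (intro eq_vecI) auto
      then show False using v by simp
    qed
    then obtain i where i: "i < p" "v $ i \<noteq> 0" by blast
    note nn = pos_def_nonneg[OF pd]
    have pos: "0 < qform p D ?x + qform p D ?y"
    proof (cases "?x i = 0")
      case False
      then have "0 < qform p D ?x" using pos_defD[OF pd i(1)] by simp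
      then show ?thesis using nn[of ?y] by linarith
    next
      case True
      then have "?y i \<noteq> 0" using i by (auto simp: complex_eq_iff)
      then have "0 < qform p D ?y" using pos_defD[OF pd i(1)] by simp
      then show ?thesis using nn[of ?x] by linarith
    qed
    have "\<theta> k = ?c (qform p F ?x + qform p F ?y) / ?c (qform p D ?x + qform p D ?y)"
      unfolding main using pos by (intro nonzero_mult_div_cancel_right[symmetric]) (simp del: of_real_add)
    moreover define t where "t = (qform p F ?x + qform p F ?y) / (qform p D ?x + qform p D ?y)"
    ultimately have "\<theta> k = ?c t" by (simp only: of_real_divide)
    moreover have "c \<le> t" if le: "\<And>x. c * qform p D x \<le> qform p F x" for c
    proof -
      have "c * (qform p D ?x + qform p D ?y) \<le> qform p F ?x + qform p F ?y"
        using le[of ?x] le[of ?y] by (simp add: distrib_left)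
      then show "c \<le> t" unfolding t_def using pos by (simp add: pos_le_divide_eq)
    qed
    moreover have "t \<le> c" if le: "\<And>x. qform p F x \<le> c * qform p D x" for c
    proof -
      have "qform p F ?x + qform p F ?y \<le> c * (qform p D ?x + qform p D ?y)"
        using le[of ?x] le[of ?y] by (simp add: distrib_left)
      then show "t \<le> c" unfolding t_def using pos by (simp add: pos_divide_le_eq)
    qed
    ultimately show ?thesis by blast
  qed
  then have "\<forall>k\<in>{..<p}. \<exists>t. \<theta> k = ?c t \<and> (\<forall>c. (\<forall>x. c * qform p D x \<le> qform p F x) \<longrightarrow> c \<le> t) \<and>
      (\<forall>c. (\<forall>x. qform p F x \<le> c * qform p D x) \<longrightarrow> t \<le> c)" by simp
  from bchoice[OF this] obtain t where ball: "\<forall>k\<in>{..<p}. \<theta> k = ?c (t k) \<and>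
      (\<forall>c. (\<forall>x. c * qform p D x \<le> qform p F x) \<longrightarrow> c \<le> t k) \<and>
      (\<forall>c. (\<forall>x. qform p F x \<le> c * qform p D x) \<longrightarrow> t k \<le> c)" ..
  have t: "\<theta> k = ?c (t k)" if "k < p" for k
    using bspec[OF ball, of k] that by simp
  have bounds: "\<And>k c. k < p \<Longrightarrow> (\<And>x. c * qform p D x \<le> qform p F x) \<Longrightarrow> c \<le> t k"
        "\<And>k c. k < p \<Longrightarrow> (\<And>x. qform p F x \<le> c * qform p D x) \<Longrightarrow> t k \<le> c"
    using ball by simp_all
  have diag: "map_mat ?c M $$ (i,i) = ?c (M $$ (i,i))" if "M \<in> carrier_mat p p" "i < p" for M i
    using that by auto
  have PF: "P * F \<in> carrier_mat p p" "P * F * (P * F) \<in> carrier_mat p p" using P Fc by auto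
  have "?c (Determinant.det (1\<^sub>m p + P * F)) = Determinant.det (map_mat ?c (1\<^sub>m p + P * F))" by simp
  also have "map_mat ?c (1\<^sub>m p + P * F) = 1\<^sub>m p + A"
    unfolding A_def using P Fc by (intro eq_matI) auto
  also have "Determinant.det \<dots> = ?c (\<Prod>i<p. 1 + t i)"
    unfolding \<theta> of_real_prod by (intro prod.cong refl) (simp add: t)
  finally have det1: "Determinant.det (1\<^sub>m p + P * F) = (\<Prod>i<p. 1 + t i)" using of_real_eq_iff by blast
  have "D + F = D * (1\<^sub>m p + P * F)"
  proof -
    have "D * (1\<^sub>m p + P * F) = D + D * (P * F)"
      using Dc P Fc by (subst mult_add_distrib_mat[of D p p "1\<^sub>m p" p "P * F"]) auto
    also have "D * (P * F) = F" using Dc P Fc DP by (simp add: assoc_mult_mat[of _ p p _ p _ p, symmetric])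
    finally show ?thesis by simp
  qed
  then have det: "Determinant.det (D + F) = Determinant.det D * (\<Prod>i<p. 1 + t i)"
    using Dc P Fc by (simp add: det_mult[of _ p] det1)
  have "?c (\<Sum>i<p. (P * F) $$ (i,i)) = (\<Sum>i<p. A $$ (i,i))"
    unfolding A_def of_real_sum by (intro sum.cong refl) (simp only: diag[OF PF(1)] lessThan_iff)
  also have "\<dots> = ?c (\<Sum>i<p. t i)"
    unfolding \<theta> of_real_sum by (intro sum.cong refl) (simp add: t)
  finally have tr: "(\<Sum>i<p. (P * F) $$ (i,i)) = (\<Sum>i<p. t i)" using of_real_eq_iff by blast
  have AA: "A * A = map_mat ?c (P * F * (P * F))" unfolding A_def
    by (rule of_real_hom.mat_hom_mult[symmetric, OF PF(1) PF(1)])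
  have "?c (\<Sum>i<p. (P * F * (P * F)) $$ (i,i)) = (\<Sum>i<p. (A * A) $$ (i,i))"
    unfolding of_real_sum AA by (intro sum.cong refl) (simp only: diag[OF PF(2)] lessThan_iff)
  also have "\<dots> = ?c (\<Sum>i<p. (t i)\<^sup>2)"
    unfolding \<theta> of_real_sum by (intro sum.cong refl) (simp add: t)
  finally have tr2: "(\<Sum>i<p. (P * F * (P * F)) $$ (i,i)) = (\<Sum>i<p. (t i)\<^sup>2)" using of_real_eq_iff by blast
  show ?thesis
    by (rule that[of t, OF det tr tr2]) (fact bounds)+
qed

section \<open>Quadratic forms, extreme eigenvalues and block-supported matrices\<close>

definition sqnorm :: "nat \<Rightarrow> (nat \<Rightarrow> real) \<Rightarrow> real" where
  "sqnorm p x = (\<Sum>i<p. (x i)\<^sup>2)"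

lemma sqnorm_nonneg: "0 \<le> sqnorm p x" by (auto simp: sqnorm_def intro: sum_nonneg)

lemma sq_le_sqnorm: "i < p \<Longrightarrow> (x i)\<^sup>2 \<le> sqnorm p x"
  unfolding sqnorm_def by (rule member_le_sum) auto

lemma sqnorm_pos: "i < p \<Longrightarrow> x i \<noteq> 0 \<Longrightarrow> 0 < sqnorm p x"
  using sq_le_sqnorm[of i p x] by (smt (verit) zero_less_power2)

lemma abs_mult_le_squares: "\<bar>a * b\<bar> \<le> (a\<^sup>2 + b\<^sup>2) / 2" for a b :: real
proof -
  have "2 * (\<bar>a\<bar> * \<bar>b\<bar>) \<le> a\<^sup>2 + b\<^sup>2" using sum_squares_bound[of "\<bar>a\<bar>" "\<bar>b\<bar>"] by simp
  then show ?thesis by (simp add: abs_mult)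
qed

lemma qform_bounded: "\<bar>qform p A x\<bar> \<le> (\<Sum>i<p. \<Sum>j<p. \<bar>A $$ (i,j)\<bar>) * sqnorm p x"
proof -
  have "\<bar>qform p A x\<bar> \<le> (\<Sum>i<p. \<Sum>j<p. \<bar>A $$ (i,j) * x i * x j\<bar>)"
    unfolding qform_def by (intro order.trans[OF sum_abs] sum_mono order.trans[OF sum_abs] order.refl)
  also have "\<dots> \<le> (\<Sum>i<p. \<Sum>j<p. \<bar>A $$ (i,j)\<bar> * sqnorm p x)"
  proof (intro sum_mono)
    fix i j assume "i \<in> {..<p}" "j \<in> {..<p}"
    then have "\<bar>x i * x j\<bar> \<le> sqnorm p x"
      using abs_mult_le_squares[of "x i" "x j"] sq_le_sqnorm[of i p x] sq_le_sqnorm[of j p x] by simp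
    then show "\<bar>A $$ (i,j) * x i * x j\<bar> \<le> \<bar>A $$ (i,j)\<bar> * sqnorm p x"
      by (simp add: abs_mult mult.assoc mult_left_mono)
  qed
  also have "\<dots> = (\<Sum>i<p. \<Sum>j<p. \<bar>A $$ (i,j)\<bar>) * sqnorm p x"
    by (simp add: sum_distrib_right)
  finally show ?thesis .
qed

lemma qform_rows: "qform p A x = (\<Sum>i<p. x i * (\<Sum>j<p. A $$ (i,j) * x j))"
  by (simp add: qform_def sum_distrib_left mult_ac)

lemma qform_add:
  assumes "A \<in> carrier_mat p p" "B \<in> carrier_mat p p"
  shows "qform p (A + B) x = qform p A x + qform p B x"
  using assms by (simp add: qform_def sum.distrib distrib_right)

lemma qform_one: "qform p (1\<^sub>m p) x = sqnorm p x"
proof -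
  have "qform p (1\<^sub>m p) x = (\<Sum>i<p. \<Sum>j<p. if j = i then (x i)\<^sup>2 else 0)"
    unfolding qform_def by (intro sum.cong refl) (auto simp: power2_eq_square)
  then show ?thesis by (simp add: sqnorm_def)
qed

lemma qform_smult: "A \<in> carrier_mat p p \<Longrightarrow> qform p (c \<cdot>\<^sub>m A) x = c * qform p A x"
  by (simp add: qform_def sum_distrib_left mult_ac)

text \<open>The largest \<open>t\<close> with \<open>t |x|\<^sup>2 \<le> x\<^sup>T A x\<close> is an eigenvalue: otherwise \<open>Q = A - t\<close> would be
  invertible and positive semidefinite, and expanding \<open>0 \<le> (x - sQx)\<^sup>T Q (x - sQx)\<close> at a small
  \<open>s > 0\<close> would bound \<open>x\<^sup>T Q x\<close> from below by a multiple of \<open>|Qx|\<^sup>2\<close>, hence of \<open>|x|\<^sup>2\<close>.\<close>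

lemma eigenvalues_ge_imp_qform_ge:
  assumes A: "sym_mat p A" and ev: "\<And>k. eigenvalue A k \<Longrightarrow> l \<le> k"
  shows "l * sqnorm p x \<le> qform p A x"
proof (cases "p = 0")
  case True
  then show ?thesis by (simp add: sqnorm_def qform_def)
next
  case False
  have Ac: "A \<in> carrier_mat p p" using A by (simp add: sym_mat_def)
  define R where "R = {t. \<forall>x. t * sqnorm p x \<le> qform p A x}"
  define t0 where "t0 = Sup R"
  define e where "e = (\<lambda>i::nat. if i = 0 then 1 else 0::real)"
  have e: "0 < sqnorm p e" using False by (intro sqnorm_pos[of 0]) (auto simp: e_def)
  have "- (\<Sum>i<p. \<Sum>j<p. \<bar>A $$ (i,j)\<bar>) \<in> R"
    unfolding R_def
  proof (intro CollectI allI)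
    fix y
    show "- (\<Sum>i<p. \<Sum>j<p. \<bar>A $$ (i,j)\<bar>) * sqnorm p y \<le> qform p A y"
      using qform_bounded[of p A y] by linarith
  qed
  then have ne: "R \<noteq> {}" by blast
  have bdd: "bdd_above R"
    unfolding bdd_above_def by (rule exI[of _ "qform p A e / sqnorm p e"]) (use e in \<open>auto simp: R_def pos_le_divide_eq\<close>)
  have t0: "t0 * sqnorm p y \<le> qform p A y" for y
  proof (cases "0 < sqnorm p y")
    case True
    have "t0 \<le> qform p A y / sqnorm p y"
      unfolding t0_def using ne True by (intro cSup_least) (auto simp: R_def pos_le_divide_eq)
    then show ?thesis using True by (simp add: pos_le_divide_eq)
  next
    case False
    then have "sqnorm p y = 0" using sqnorm_nonneg[of p y] by linarith
    moreover have "y i = 0" if "i < p" for i using sqnorm_pos[OF that, of y] False by blast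
    ultimately show ?thesis using qform_0[of p y A] by simp
  qed
  define Q where "Q = A + (- t0) \<cdot>\<^sub>m 1\<^sub>m p"
  have Qc: "Q \<in> carrier_mat p p" using Ac by (simp add: Q_def)
  have Qs: "Q $$ (i,j) = Q $$ (j,i)" if "i < p" "j < p" for i j
    using A that by (auto simp: Q_def sym_mat_def)
  have qQ: "qform p Q y = qform p A y - t0 * sqnorm p y" for y
    unfolding Q_def using Ac by (subst qform_add) (auto simp: qform_smult qform_one)
  have "Determinant.det Q = 0"
  proof (rule ccontr)
    assume "Determinant.det Q \<noteq> 0"
    from det_non_zero_imp_unit[OF Qc this, of "()"] obtain P where P: "P \<in> carrier_mat p p" "P * Q = 1\<^sub>m p"
      by (auto simp: Units_def ring_mat_def)
    define C where "C = (\<Sum>i<p. \<Sum>j<p. \<bar>Q $$ (i,j)\<bar>) + 1"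
    define C' where "C' = (\<Sum>i<p. \<Sum>j<p. (P $$ (i,j))\<^sup>2)"
    have C: "0 < C" unfolding C_def by (intro add_nonneg_pos sum_nonneg) auto
    have C': "0 \<le> C'" unfolding C'_def by (intro sum_nonneg) auto
    have key: "sqnorm p x \<le> C' * C * qform p Q x" for x
    proof -
      define y where "y i = (\<Sum>j<p. Q $$ (i,j) * x j)" for i
      define s where "s = 1 / C"
      have e1: "qform p Q (\<lambda>i. x i - s * y i) =
          qform p Q x - s * (\<Sum>i<p. \<Sum>j<p. Q $$ (i,j) * x i * y j)
          - s * (\<Sum>i<p. \<Sum>j<p. Q $$ (i,j) * y i * x j) + s\<^sup>2 * qform p Q y"
        unfolding qform_def sum_distrib_left sum.distrib[symmetric] sum_subtractf[symmetric]
        by (intro sum.cong refl) (simp add: algebra_simps power2_eq_square)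
      have e2: "(\<Sum>i<p. \<Sum>j<p. Q $$ (i,j) * y i * x j) = sqnorm p y"
        unfolding sqnorm_def by (intro sum.cong refl) (simp add: y_def power2_eq_square sum_distrib_left mult_ac)
      have e3: "(\<Sum>i<p. \<Sum>j<p. Q $$ (i,j) * x i * y j) = sqnorm p y"
      proof -
        have "(\<Sum>i<p. \<Sum>j<p. Q $$ (i,j) * x i * y j) = (\<Sum>j<p. \<Sum>i<p. Q $$ (j,i) * x i * y j)"
          by (subst sum.swap) (auto simp: Qs intro!: sum.cong)
        also have "\<dots> = sqnorm p y"
          unfolding sqnorm_def by (intro sum.cong refl) (simp add: y_def power2_eq_square sum_distrib_left sum_distrib_right mult_ac)
        finally show ?thesis .
      qed
      have e4: "0 \<le> qform p Q (\<lambda>i. x i - s * y i)" using t0 qQ by simp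
      have "qform p Q y \<le> C * sqnorm p y"
        using qform_bounded[of p Q y] sqnorm_nonneg[of p y] unfolding C_def by (simp add: abs_le_iff distrib_right)
      then have "s\<^sup>2 * qform p Q y \<le> s\<^sup>2 * (C * sqnorm p y)" by (intro mult_left_mono) auto
      then have "s\<^sup>2 * qform p Q y \<le> s * sqnorm p y" using C by (simp add: power2_eq_square s_def)
      then have "s * sqnorm p y \<le> qform p Q x" using e4 unfolding e1 e2 e3 by linarith
      then have y: "sqnorm p y \<le> C * qform p Q x" using C by (simp add: field_simps s_def)
      have xPy: "x i = (\<Sum>j<p. P $$ (i,j) * y j)" if i: "i < p" for i
      proof -
        have "(\<Sum>j<p. P $$ (i,j) * y j) = (\<Sum>j<p. \<Sum>k<p. P $$ (i,j) * Q $$ (j,k) * x k)"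
          by (simp add: y_def sum_distrib_left mult_ac)
        also have "\<dots> = (\<Sum>k<p. (P * Q) $$ (i,k) * x k)"
          by (subst sum.swap, intro sum.cong refl)
             (subst mat_mult_entry[OF P(1) Qc i], auto simp: sum_distrib_right)
        also have "\<dots> = (\<Sum>k<p. if k = i then x i else 0)"
          unfolding P(2) using i by (intro sum.cong refl) auto
        finally show ?thesis using i by simp
      qed
      have "sqnorm p x \<le> (\<Sum>i<p. (\<Sum>j<p. (P $$ (i,j))\<^sup>2) * sqnorm p y)"
        unfolding sqnorm_def[of p x]
      proof (intro sum_mono)
        fix i assume "i \<in> {..<p}"
        then have "(x i)\<^sup>2 = (\<Sum>j<p. P $$ (i,j) * y j)\<^sup>2" using xPy by simp
        also have "\<dots> \<le> (\<Sum>j<p. (P $$ (i,j))\<^sup>2) * sqnorm p y"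
          unfolding sqnorm_def by (rule Cauchy_Schwarz_ineq_sum)
        finally show "(x i)\<^sup>2 \<le> (\<Sum>j<p. (P $$ (i,j))\<^sup>2) * sqnorm p y" .
      qed
      also have "\<dots> = C' * sqnorm p y" by (simp add: C'_def sum_distrib_right)
      also have "\<dots> \<le> C' * (C * qform p Q x)" using y C' by (intro mult_left_mono)
      finally show ?thesis by (simp add: mult.assoc)
    qed
    have "t0 + 1 / (C' * C + 1) \<in> R"
    proof -
      have "(1 / (C' * C + 1)) * sqnorm p x \<le> qform p Q x" for x
      proof -
        have "0 \<le> qform p Q x" using t0 qQ by simp
        then have "sqnorm p x \<le> (C' * C + 1) * qform p Q x" using key[of x] by (simp add: distrib_right)
        moreover have "0 < C' * C + 1" using C C' by (simp add: add_nonneg_pos)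
        ultimately show ?thesis by (simp add: field_simps)
      qed
      then show ?thesis unfolding R_def qQ by (simp add: distrib_right) (smt (verit))
    qed
    then have "t0 + 1 / (C' * C + 1) \<le> t0" unfolding t0_def using bdd by (intro cSup_upper)
    moreover have "0 < C' * C + 1" using C C' by (simp add: add_nonneg_pos)
    ultimately show False by simp
  qed
  then obtain v where v: "v \<in> carrier_vec p" "v \<noteq> 0\<^sub>v p" "Q *\<^sub>v v = 0\<^sub>v p"
    using det_0_iff_vec_prod_zero_field[OF Qc] by blast
  have "A *\<^sub>v v = t0 \<cdot>\<^sub>v v"
  proof (rule eq_vecI)
    fix i assume "i < dim_vec (t0 \<cdot>\<^sub>v v)"
    then have i: "i < p" using v by simp
    have "0 = (Q *\<^sub>v v) $ i" using v i by simp
    also have "\<dots> = (\<Sum>j<p. A $$ (i,j) * v $ j - (if j = i then t0 * v $ i else 0))"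
      by (subst mult_mat_vec_entry[OF Qc v(1) i]) (use i Ac in \<open>auto simp: Q_def algebra_simps intro!: sum.cong\<close>)
    also have "\<dots> = (A *\<^sub>v v) $ i - t0 * v $ i"
      by (subst mult_mat_vec_entry[OF Ac v(1) i]) (use i in \<open>simp add: sum_subtractf\<close>)
    finally show "(A *\<^sub>v v) $ i = (t0 \<cdot>\<^sub>v v) $ i" using i v by simp
  qed (use Ac v in auto)
  then have "eigenvalue A t0" using v Ac unfolding eigenvalue_def eigenvector_def by auto
  then have "l \<le> t0" by (rule ev)
  then have "l * sqnorm p x \<le> t0 * sqnorm p x" using sqnorm_nonneg by (intro mult_right_mono)
  then show ?thesis using t0[of x] by linarith
qed

lemma eigenvalues_le_imp_qform_le:
  assumes A: "sym_mat p A" and ev: "\<And>k. eigenvalue A k \<Longrightarrow> k \<le> u"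
  shows "qform p A x \<le> u * sqnorm p x"
proof -
  have Ac: "A \<in> carrier_mat p p" using A by (simp add: sym_mat_def)
  have neg: "sym_mat p (- A)" using A by (auto simp: sym_mat_def)
  have "- u * sqnorm p x \<le> qform p (- A) x"
  proof (rule eigenvalues_ge_imp_qform_ge[OF neg])
    fix k assume "eigenvalue (- A) k"
    then obtain v where v: "v \<in> carrier_vec p" "v \<noteq> 0\<^sub>v p" "(- A) *\<^sub>v v = k \<cdot>\<^sub>v v"
      using Ac unfolding eigenvalue_def eigenvector_def by auto
    have "A *\<^sub>v v = (- k) \<cdot>\<^sub>v v"
    proof (rule eq_vecI)
      fix i assume "i < dim_vec ((- k) \<cdot>\<^sub>v v)"
      then have i: "i < p" using v by simp
      have "((- A) *\<^sub>v v) $ i = - ((A *\<^sub>v v) $ i)"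
        using i Ac v(1) by (simp add: mult_mat_vec_entry[of _ p p] sum_negf del: index_mult_mat_vec)
      then show "(A *\<^sub>v v) $ i = ((- k) \<cdot>\<^sub>v v) $ i" using v i by simp
    qed (use Ac v in auto)
    then have "eigenvalue A (- k)" using v Ac unfolding eigenvalue_def eigenvector_def by auto
    then show "- u \<le> k" using ev by force
  qed
  moreover have "qform p (- A) x = - qform p A x" using Ac by (simp add: qform_def sum_negf)
  ultimately show ?thesis by simp
qed

text \<open>Column \<open>j\<close> of the inverse solves \<open>D x = e\<^sub>j\<close>, so \<open>c |x|\<^sup>2 \<le> x\<^sup>T D x = x\<^sub>j\<close>, which bounds first
  \<open>x\<^sub>j\<close> and then every coordinate.\<close>

lemma inverse_entries_bounded:
  assumes D: "D \<in> carrier_mat p p" and P: "P \<in> carrier_mat p p" "D * P = 1\<^sub>m p"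
    and c: "0 < c" and lower: "\<And>x. c * sqnorm p x \<le> qform p D x"
    and ij: "i < p" "j < p"
  shows "\<bar>P $$ (i,j)\<bar> \<le> 1 / c"
proof -
  define x where "x i = P $$ (i,j)" for i
  have "qform p D x = (\<Sum>i<p. x i * (D * P) $$ (i,j))"
    unfolding qform_rows by (intro sum.cong refl) (simp add: mat_mult_entry[OF D P(1) _ ij(2)] x_def del: index_mult_mat)
  also have "\<dots> = (\<Sum>i<p. if i = j then x j else 0)" unfolding P(2) using ij by (intro sum.cong refl) auto
  also have "\<dots> = x j" using ij by simp
  finally have le: "c * sqnorm p x \<le> x j" using lower[of x] by simp
  have "c * (x j)\<^sup>2 \<le> x j" using le mult_left_mono[OF sq_le_sqnorm[OF ij(2), of x], of c] c by linarith
  then have xj: "c * x j \<le> 1"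
    by (cases "x j > 0") (use c in \<open>auto simp: power2_eq_square mult_nonneg_nonpos intro: order.trans[of _ 0]\<close>)
  have "c * (x i)\<^sup>2 \<le> x j" using le mult_left_mono[OF sq_le_sqnorm[OF ij(1), of x], of c] c by linarith
  then have "(c * x i)\<^sup>2 \<le> c * x j" using c mult_left_mono[of "c * (x i)\<^sup>2" "x j" c]
    by (simp add: power2_eq_square mult_ac)
  then have "(c * x i)\<^sup>2 \<le> 1" using xj by linarith
  then have "\<bar>c * x i\<bar> \<le> 1" using abs_square_le_1 by blast
  then show ?thesis using c by (simp add: abs_mult x_def field_simps)
qed

text \<open>Masking column \<open>j\<close> of the inverse outside the class of \<open>j\<close> does not change its image under a
  block-supported \<open>D\<close>, so by injectivity the mask changes nothing.\<close>

lemma inverse_block_support: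
  fixes D P :: "real Matrix.mat"
  assumes D: "D \<in> carrier_mat p p" and P: "P \<in> carrier_mat p p" "D * P = 1\<^sub>m p" "P * D = 1\<^sub>m p"
    and R: "symp R" "transp R" "\<And>i. i < p \<Longrightarrow> R i i"
    and supp: "\<And>i j. i < p \<Longrightarrow> j < p \<Longrightarrow> \<not> R i j \<Longrightarrow> D $$ (i,j) = 0"
    and ij: "i < p" "j < p" "\<not> R i j"
  shows "P $$ (i,j) = 0"
proof -
  define x where "x k = (if R k j then P $$ (k,j) else 0)" for k
  have Dx: "(\<Sum>k<p. D $$ (a,k) * x k) = (if a = j then 1 else 0)" if a: "a < p" for a
  proof (cases "R a j")
    case True
    have "(\<Sum>k<p. D $$ (a,k) * x k) = (\<Sum>k<p. D $$ (a,k) * P $$ (k,j))"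
    proof (intro sum.cong refl)
      fix k assume k: "k \<in> {..<p}"
      show "D $$ (a,k) * x k = D $$ (a,k) * P $$ (k,j)"
      proof (cases "R k j")
        case False
        then have "\<not> R a k" using True sympD[OF R(1)] transpD[OF R(2)] by blast
        then show ?thesis using supp[of a k] k a by simp
      qed (simp add: x_def)
    qed
    also have "\<dots> = (D * P) $$ (a,j)" using mat_mult_entry[OF D P(1) a ij(2)] by simp
    finally show ?thesis unfolding P using a ij by auto
  next
    case False
    then have "a \<noteq> j" using R(3)[of j] ij by blast
    have "D $$ (a,k) * x k = 0" if "k < p" for k
    proof (cases "R k j")
      case True
      then have "\<not> R a k" using False transpD[OF R(2), of a k j] by blast
      then show ?thesis using supp[of a k] that a by simp
    qed (simp add: x_def)
    then have "(\<Sum>k<p. D $$ (a,k) * x k) = 0" by (intro sum.neutral) blast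
    with \<open>a \<noteq> j\<close> show ?thesis by simp
  qed
  have "P $$ (i,j) = (\<Sum>a<p. if a = j then P $$ (i,j) else 0)" using ij by simp
  also have "\<dots> = (\<Sum>a<p. P $$ (i,a) * (\<Sum>k<p. D $$ (a,k) * x k))"
  proof (intro sum.cong refl)
    fix a assume "a \<in> {..<p}"
    then have "(\<Sum>k<p. D $$ (a,k) * x k) = (if a = j then 1 else 0)" by (intro Dx) simp
    then show "(if a = j then P $$ (i,j) else 0) = P $$ (i,a) * (\<Sum>k<p. D $$ (a,k) * x k)" by simp
  qed
  also have "\<dots> = (\<Sum>k<p. \<Sum>a<p. P $$ (i,a) * D $$ (a,k) * x k)"
    by (subst sum.swap) (simp add: sum_distrib_left mult_ac)
  also have "\<dots> = (\<Sum>k<p. (P * D) $$ (i,k) * x k)"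
    by (intro sum.cong refl) (subst mat_mult_entry[OF P(1) D ij(1)], auto simp: sum_distrib_right)
  also have "\<dots> = (\<Sum>k<p. if k = i then x i else 0)"
    unfolding P using ij by (intro sum.cong refl) auto
  also have "\<dots> = 0" using ij by (simp add: x_def)
  finally show ?thesis .
qed

definition frobenius_sq :: "nat \<Rightarrow> real Matrix.mat \<Rightarrow> real" where
  "frobenius_sq p F = (\<Sum>i<p. \<Sum>j<p. (F $$ (i,j))\<^sup>2)"

text \<open>Each nonzero \<open>P\<close>-factor links indices of one class, of at most \<open>m\<close> elements. Bounding
  \<open>F\<^sub>j\<^sub>k F\<^sub>l\<^sub>i\<close> by half the sum of squares, each square is counted at most \<open>m\<^sup>2\<close> times, whatever the dimension.\<close>

lemma trace_square_bound:
  assumes P: "P \<in> carrier_mat p p" and F: "F \<in> carrier_mat p p"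
    and R: "symp R" and m: "\<And>j. j < p \<Longrightarrow> card {i. i < p \<and> R i j} \<le> m"
    and c: "0 \<le> c" and Pb: "\<And>i j. i < p \<Longrightarrow> j < p \<Longrightarrow> \<bar>P $$ (i,j)\<bar> \<le> (if R i j then c else 0)"
  shows "(\<Sum>i<p. (P * F * (P * F)) $$ (i,i)) \<le> c\<^sup>2 * (real m)\<^sup>2 * frobenius_sq p F"
proof -
  define r where "r i j = (if R i j then 1 else 0::real)" for i j
  have rsym: "r i j = r j i" for i j using R by (auto simp: r_def symp_def)
  have rsum: "(\<Sum>i<p. r i j) \<le> real m" if "j < p" for j
  proof -
    have "(\<Sum>i<p. r i j) = real (card {i. i < p \<and> R i j})"
      unfolding r_def by (simp add: sum.If_cases Collect_conj_eq Int_commute lessThan_def)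
    then show ?thesis using m[OF that] by simp
  qed
  have rnn: "0 \<le> r i j" "0 \<le> (\<Sum>i<p. r i j)" for i j by (auto simp: r_def intro: sum_nonneg)
  have entry: "(P * F) $$ (i,k) = (\<Sum>j<p. P $$ (i,j) * F $$ (j,k))" if "i < p" "k < p" for i k
    using mat_mult_entry[OF P F that] .
  have S1: "(\<Sum>i<p. \<Sum>k<p. \<Sum>j<p. \<Sum>l<p. r i j * r k l * (F $$ (j,k))\<^sup>2) \<le> (real m)\<^sup>2 * frobenius_sq p F"
  proof -
    have "(\<Sum>i<p. \<Sum>k<p. \<Sum>j<p. \<Sum>l<p. r i j * r k l * (F $$ (j,k))\<^sup>2)
      = (\<Sum>k<p. \<Sum>i<p. \<Sum>j<p. r i j * (F $$ (j,k))\<^sup>2 * (\<Sum>l<p. r l k))"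
      by (subst sum.swap) (simp add: sum_distrib_left sum_distrib_right mult_ac rsym)
    also have "\<dots> = (\<Sum>k<p. \<Sum>j<p. (F $$ (j,k))\<^sup>2 * ((\<Sum>i<p. r i j) * (\<Sum>l<p. r l k)))"
      by (rule sum.cong[OF refl], subst sum.swap, rule sum.cong[OF refl])
         (simp add: sum_distrib_left sum_distrib_right mult_ac)
    also have "\<dots> \<le> (\<Sum>k<p. \<Sum>j<p. (F $$ (j,k))\<^sup>2 * (real m * real m))"
      by (intro sum_mono mult_left_mono mult_mono rsum rnn) auto
    also have "\<dots> = (real m)\<^sup>2 * frobenius_sq p F"
      unfolding frobenius_sq_def by (subst sum.swap) (simp add: sum_distrib_left sum_distrib_right power2_eq_square mult_ac)
    finally show ?thesis .
  qed
  have S2: "(\<Sum>i<p. \<Sum>k<p. \<Sum>j<p. \<Sum>l<p. r i j * r k l * (F $$ (l,i))\<^sup>2) \<le> (real m)\<^sup>2 * frobenius_sq p F"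
  proof -
    have "(\<Sum>i<p. \<Sum>k<p. \<Sum>j<p. \<Sum>l<p. r i j * r k l * (F $$ (l,i))\<^sup>2)
       = (\<Sum>k<p. \<Sum>i<p. \<Sum>l<p. \<Sum>j<p. r k l * r i j * (F $$ (l,i))\<^sup>2)"
      by (subst sum.swap, rule sum.cong[OF refl], rule sum.cong[OF refl], subst sum.swap) (simp add: mult_ac)
    also have "\<dots> \<le> (real m)\<^sup>2 * frobenius_sq p F" using S1 by simp
    finally show ?thesis .
  qed
  have "(\<Sum>i<p. (P * F * (P * F)) $$ (i,i)) = (\<Sum>i<p. \<Sum>k<p. (P * F) $$ (i,k) * (P * F) $$ (k,i))"
    by (intro sum.cong refl mat_mult_entry) (use P F in auto)
  also have "\<dots> = (\<Sum>i<p. \<Sum>k<p. \<Sum>j<p. \<Sum>l<p. (P $$ (i,j) * P $$ (k,l)) * (F $$ (j,k) * F $$ (l,i)))"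
  proof (rule sum.cong[OF refl], rule sum.cong[OF refl])
    fix i k assume "i \<in> {..<p}" "k \<in> {..<p}"
    then have ik: "i < p" "k < p" by auto
    show "(P * F) $$ (i,k) * (P * F) $$ (k,i) = (\<Sum>j<p. \<Sum>l<p. (P $$ (i,j) * P $$ (k,l)) * (F $$ (j,k) * F $$ (l,i)))"
      unfolding entry[OF ik] entry[OF ik(2,1)] sum_product by (intro sum.cong refl) (simp add: mult_ac)
  qed
  also have "\<dots> \<le> (\<Sum>i<p. \<Sum>k<p. \<Sum>j<p. \<Sum>l<p. (c\<^sup>2 / 2) * (r i j * r k l * (F $$ (j,k))\<^sup>2) + (c\<^sup>2 / 2) * (r i j * r k l * (F $$ (l,i))\<^sup>2))"
  proof (intro sum_mono)
    fix i k j l assume "i \<in> {..<p}" "k \<in> {..<p}" "j \<in> {..<p}" "l \<in> {..<p}"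
    then have 1: "\<bar>P $$ (i,j)\<bar> \<le> c * r i j" "\<bar>P $$ (k,l)\<bar> \<le> c * r k l"
      using Pb[of i j] Pb[of k l] by (auto simp: r_def split: if_splits)
    have "(P $$ (i,j) * P $$ (k,l)) * (F $$ (j,k) * F $$ (l,i)) \<le> (\<bar>P $$ (i,j)\<bar> * \<bar>P $$ (k,l)\<bar>) * \<bar>F $$ (j,k) * F $$ (l,i)\<bar>"
      by (metis abs_ge_self abs_mult)
    also have "\<dots> \<le> ((c * r i j) * (c * r k l)) * (((F $$ (j,k))\<^sup>2 + (F $$ (l,i))\<^sup>2) / 2)"
      using 1 c rnn abs_mult_le_squares by (intro mult_mono) auto
    also have "\<dots> = (c\<^sup>2 / 2) * (r i j * r k l * (F $$ (j,k))\<^sup>2) + (c\<^sup>2 / 2) * (r i j * r k l * (F $$ (l,i))\<^sup>2)"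
      by (simp add: power2_eq_square field_simps)
    finally show "(P $$ (i,j) * P $$ (k,l)) * (F $$ (j,k) * F $$ (l,i)) \<le> \<dots>" .
  qed
  also have "\<dots> = (c\<^sup>2 / 2) * (\<Sum>i<p. \<Sum>k<p. \<Sum>j<p. \<Sum>l<p. r i j * r k l * (F $$ (j,k))\<^sup>2)
      + (c\<^sup>2 / 2) * (\<Sum>i<p. \<Sum>k<p. \<Sum>j<p. \<Sum>l<p. r i j * r k l * (F $$ (l,i))\<^sup>2)"
    by (simp add: sum.distrib sum_distrib_left)
  also have "\<dots> \<le> (c\<^sup>2 / 2) * ((real m)\<^sup>2 * frobenius_sq p F) + (c\<^sup>2 / 2) * ((real m)\<^sup>2 * frobenius_sq p F)"
    using S1 S2 by (intro add_mono mult_left_mono) auto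
  also have "\<dots> = c\<^sup>2 * (real m)\<^sup>2 * frobenius_sq p F" by (simp add: mult_ac)
  finally show ?thesis .
qed

text \<open>Schur's test: the operator norm is at most the largest row sum.\<close>

lemma block_qform_bound:
  assumes R: "symp R" and m: "\<And>j. j < p \<Longrightarrow> card {i. i < p \<and> R i j} \<le> m"
    and c: "0 \<le> c" and Mb: "\<And>i j. i < p \<Longrightarrow> j < p \<Longrightarrow> \<bar>M $$ (i,j)\<bar> \<le> (if R i j then c else 0)"
  shows "\<bar>qform p M x\<bar> \<le> c * real m * sqnorm p x"
proof -
  define r where "r i j = (if R i j then 1 else 0::real)" for i j
  have rsym: "r i j = r j i" for i j using R by (auto simp: r_def symp_def)
  have rsum: "(\<Sum>i<p. r i j) \<le> real m" if "j < p" for j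
  proof -
    have "(\<Sum>i<p. r i j) = real (card {i. i < p \<and> R i j})"
      unfolding r_def by (simp add: sum.If_cases Collect_conj_eq Int_commute lessThan_def)
    then show ?thesis using m[OF that] by simp
  qed
  have S1: "(\<Sum>i<p. \<Sum>j<p. r i j * (x j)\<^sup>2) \<le> real m * sqnorm p x"
  proof -
    have "(\<Sum>i<p. \<Sum>j<p. r i j * (x j)\<^sup>2) = (\<Sum>j<p. (\<Sum>i<p. r i j) * (x j)\<^sup>2)"
      by (subst sum.swap) (simp add: sum_distrib_right)
    also have "\<dots> \<le> (\<Sum>j<p. real m * (x j)\<^sup>2)" using rsum by (intro sum_mono mult_right_mono) auto
    finally show ?thesis by (simp add: sqnorm_def sum_distrib_left)
  qed
  have S2: "(\<Sum>i<p. \<Sum>j<p. r i j * (x i)\<^sup>2) \<le> real m * sqnorm p x"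
    using S1 by (subst sum.swap) (simp add: rsym)
  have "\<bar>qform p M x\<bar> \<le> (\<Sum>i<p. \<Sum>j<p. \<bar>M $$ (i,j) * x i * x j\<bar>)"
    unfolding qform_def by (intro order.trans[OF sum_abs] sum_mono order.trans[OF sum_abs] order.refl)
  also have "\<dots> \<le> (\<Sum>i<p. \<Sum>j<p. (c/2) * (r i j * (x i)\<^sup>2) + (c/2) * (r i j * (x j)\<^sup>2))"
  proof (intro sum_mono)
    fix i j assume "i \<in> {..<p}" "j \<in> {..<p}"
    then have 1: "\<bar>M $$ (i,j)\<bar> \<le> c * r i j" using Mb[of i j] by (auto simp: r_def split: if_splits)
    have "\<bar>M $$ (i,j) * x i * x j\<bar> = \<bar>M $$ (i,j)\<bar> * \<bar>x i * x j\<bar>" by (simp add: abs_mult mult.assoc)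
    also have "\<dots> \<le> (c * r i j) * (((x i)\<^sup>2 + (x j)\<^sup>2) / 2)"
      using 1 c abs_mult_le_squares[of "x i" "x j"] by (intro mult_mono) (auto simp: r_def)
    also have "\<dots> = (c/2) * (r i j * (x i)\<^sup>2) + (c/2) * (r i j * (x j)\<^sup>2)" by (simp add: field_simps)
    finally show "\<bar>M $$ (i,j) * x i * x j\<bar> \<le> \<dots>" .
  qed
  also have "\<dots> = (c/2) * (\<Sum>i<p. \<Sum>j<p. r i j * (x i)\<^sup>2) + (c/2) * (\<Sum>i<p. \<Sum>j<p. r i j * (x j)\<^sup>2)"
    by (simp add: sum.distrib sum_distrib_left)
  also have "\<dots> \<le> (c/2) * (real m * sqnorm p x) + (c/2) * (real m * sqnorm p x)"
    using S1 S2 c by (intro add_mono mult_left_mono) auto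
  finally show ?thesis by simp
qed

text \<open>The direction \<open>e\<^sub>i + s e\<^sub>j\<close>. For \<open>s = 0\<close> it is \<open>e\<^sub>i\<close>, and for \<open>s = 1, -1\<close> it serves polarization.\<close>

definition pair_dir :: "nat \<Rightarrow> nat \<Rightarrow> real \<Rightarrow> nat \<Rightarrow> real" where
  "pair_dir i j s k = (if k = i then 1 else 0) + (if k = j then s else 0)"

lemma sum_pair_dir:
  assumes "i < p" "j < p"
  shows "(\<Sum>k<p. pair_dir i j s k * f k) = f i + s * f j"
proof -
  have "(\<Sum>k<p. pair_dir i j s k * f k) = (\<Sum>k<p. if k = i then f i else 0) + (\<Sum>k<p. if k = j then s * f j else 0)"
    unfolding sum.distrib[symmetric] by (intro sum.cong refl) (auto simp: pair_dir_def distrib_right)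
  then show ?thesis using assms by simp
qed

lemma qform_pair_dir:
  assumes A: "sym_mat p A" and ij: "i < p" "j < p"
  shows "qform p A (pair_dir i j s) = A $$ (i,i) + 2 * s * A $$ (i,j) + s\<^sup>2 * A $$ (j,j)"
proof -
  have "(\<Sum>b<p. A $$ (a,b) * pair_dir i j s b) = A $$ (a,i) + s * A $$ (a,j)" for a
    using sum_pair_dir[OF ij, of s "\<lambda>b. A $$ (a,b)"] by (simp add: mult.commute)
  then have "qform p A (pair_dir i j s) = (A $$ (i,i) + s * A $$ (i,j)) + s * (A $$ (j,i) + s * A $$ (j,j))"
    unfolding qform_rows by (simp only: sum_pair_dir[OF ij])
  then show ?thesis using A ij by (simp add: sym_mat_def algebra_simps power2_eq_square)
qed

lemma sqnorm_pair_dir: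
  assumes ij: "i < p" "j < p" and "i \<noteq> j \<or> s = 0"
  shows "sqnorm p (pair_dir i j s) = 1 + s\<^sup>2"
proof -
  have "sqnorm p (pair_dir i j s) = (\<Sum>k<p. pair_dir i j s k * pair_dir i j s k)"
    by (simp add: sqnorm_def power2_eq_square)
  also have "\<dots> = pair_dir i j s i + s * pair_dir i j s j" by (rule sum_pair_dir[OF ij])
  also have "\<dots> = 1 + s\<^sup>2" using assms(3) by (auto simp: pair_dir_def power2_eq_square)
  finally show ?thesis .
qed

section \<open>Partitions, block patterns and the likelihood of a partition\<close>

lemma same_block_sym: "same_block B i j \<longleftrightarrow> same_block B j i"
  by (auto simp: same_block_def)

lemma same_block_refl: "partition_on {..<p} B \<Longrightarrow> i < p \<Longrightarrow> same_block B i i"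
  by (auto simp: same_block_def partition_on_def)

lemma same_block_less: "partition_on {..<p} B \<Longrightarrow> same_block B i j \<Longrightarrow> i < p \<and> j < p"
  unfolding same_block_def partition_on_def by blast

lemma same_block_trans:
  "partition_on A B \<Longrightarrow> same_block B i j \<Longrightarrow> same_block B j k \<Longrightarrow> same_block B i k"
  unfolding same_block_def partition_on_def disjoint_def by blast

lemma symp_same_block: "symp (same_block B)"
  by (auto simp: symp_def same_block_sym)

lemma transp_same_block: "partition_on A B \<Longrightarrow> transp (same_block B)"
  by (rule transpI) (rule same_block_trans)

lemma same_block_quotient:
  assumes "equiv A r"
  shows "same_block (A // r) i j \<longleftrightarrow> (i, j) \<in> r"
proof
  assume "same_block (A // r) i j"
  then show "(i, j) \<in> r" using in_quotient_imp_in_rel[OF assms] unfolding same_block_def by blast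
next
  assume ij: "(i, j) \<in> r"
  then have "i \<in> A" using assms by (auto simp: equiv_def refl_on_def)
  then have ii: "(i, i) \<in> r" using assms by (auto simp: equiv_def refl_on_def)
  then have "r `` {i} \<in> A // r" "i \<in> r `` {i}" "j \<in> r `` {i}"
    using ij ii \<open>i \<in> A\<close> by (auto intro: quotientI)
  then show "same_block (A // r) i j" unfolding same_block_def by blast
qed

text \<open>Partitions are compared and built through the relation of lying in the same block: refinement is
  inclusion of relations, common refinement is intersection.\<close>

lemma partition_from_relation:
  assumes "\<And>i. i < p \<Longrightarrow> R i i" "\<And>i j. R i j \<Longrightarrow> R j i"
    "\<And>i j k. R i j \<Longrightarrow> R j k \<Longrightarrow> R i k" "\<And>i j. R i j \<Longrightarrow> i < p \<and> j < p"
  obtains B where "partition_on {..<p} B" "\<And>i j. same_block B i j \<longleftrightarrow> R i j"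
proof -
  have eq: "equiv {..<p} {(i,j). R i j}"
  proof (rule equivI)
    show "{(i,j). R i j} \<subseteq> {..<p} \<times> {..<p}" using assms(4) by blast
    show "refl_on {..<p} {(i,j). R i j}" using assms(1) by (auto simp: refl_on_def)
    show "sym {(i,j). R i j}" using assms(2) by (auto simp: sym_def)
    show "trans {(i,j). R i j}" unfolding trans_def using assms(3) by simp
  qed
  show ?thesis
    by (rule that[of "{..<p} // {(i,j). R i j}"])
       (simp_all add: partition_on_quotient[OF eq] same_block_quotient[OF eq])
qed

lemma partition_eqI:
  assumes B: "partition_on A B" and C: "partition_on A C"
    and iff: "\<And>i j. same_block B i j \<longleftrightarrow> same_block C i j"
  shows "B = C"
proof -
  have "B = A // {(x,y). same_block B x y}"
    unfolding same_block_def by (rule partition_on_eq_quotient[OF B, symmetric])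
  also have "\<dots> = A // {(x,y). same_block C x y}" by (simp only: iff)
  also have "\<dots> = C" unfolding same_block_def by (rule partition_on_eq_quotient[OF C])
  finally show ?thesis .
qed

lemma refines_iff_same_block:
  assumes B: "partition_on A B" and C: "partition_on A C"
  shows "refines A B C \<longleftrightarrow> (\<forall>i j. same_block B i j \<longrightarrow> same_block C i j)"
proof
  assume "refines A B C"
  then show "\<forall>i j. same_block B i j \<longrightarrow> same_block C i j"
    unfolding refines_def same_block_def by blast
next
  assume imp: "\<forall>i j. same_block B i j \<longrightarrow> same_block C i j"
  have "\<exists>Y\<in>C. G \<subseteq> Y" if G: "G \<in> B" for G
  proof -
    have "G \<noteq> {}" using G partition_onD3[OF B] by blast
    then obtain i where i: "i \<in> G" by blast
    then have "i \<in> A" using G B by (auto simp: partition_on_def)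
    then obtain Y where Y: "Y \<in> C" "i \<in> Y" using C by (auto simp: partition_on_def)
    have "j \<in> Y" if "j \<in> G" for j
    proof -
      have "same_block C i j" using imp i that G unfolding same_block_def by blast
      then obtain Z where "Z \<in> C" "i \<in> Z" "j \<in> Z" unfolding same_block_def by blast
      then show ?thesis using Y C unfolding partition_on_def disjoint_def by blast
    qed
    then show ?thesis using Y by blast
  qed
  then show "refines A B C" using B C unfolding refines_def by blast
qed

lemma card_class_le:
  assumes B: "partition_on {..<p} B" and m: "\<And>G. G \<in> B \<Longrightarrow> card G \<le> m" and j: "j < p"
  shows "card {i. i < p \<and> same_block B i j} \<le> m"
proof -
  obtain G where G: "G \<in> B" "j \<in> G" using B j by (auto simp: partition_on_def)
  have "{i. i < p \<and> same_block B i j} = G"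
    using G B unfolding same_block_def partition_on_def disjoint_def by blast
  then show ?thesis using m[OF G(1)] by simp
qed

lemma pen_eq_card_pairs:
  assumes B: "partition_on {..<p} B"
  shows "pen B = real (card {(i,j). same_block B i j})"
proof -
  have fin: "finite B" "\<And>G. G \<in> B \<Longrightarrow> finite G"
    using B finite_elements[OF _ B] by (auto simp: partition_on_def intro: finite_subset[of _ "{..<p}"])
  have "{(i,j). same_block B i j} = (\<Union>G\<in>B. G \<times> G)" by (auto simp: same_block_def)
  moreover have "card (\<Union>G\<in>B. G \<times> G) = (\<Sum>G\<in>B. card (G \<times> G))"
  proof (rule card_UN_disjoint)
    show "\<forall>G\<in>B. \<forall>H\<in>B. G \<noteq> H \<longrightarrow> G \<times> G \<inter> H \<times> H = {}"
      using disjointD[OF partition_onD2[OF B]] by blast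
  qed (use fin in auto)
  ultimately show ?thesis by (simp add: pen_def card_cartesian_product power2_eq_square)
qed

lemma finite_block_pairs:
  assumes "partition_on {..<p} B" shows "finite {(i,j). same_block B i j}"
  by (rule finite_subset[of _ "{..<p} \<times> {..<p}"]) (use same_block_less[OF assms] in auto)

lemma finest_blocks_props:
  assumes \<Gamma>: "\<Gamma> \<in> carrier_mat p p"
  shows finest_blocks_partition: "partition_on {..<p} (finest_blocks \<Gamma>)"
    and finest_blocks_support: "\<And>i j. i < p \<Longrightarrow> j < p \<Longrightarrow> \<Gamma> $$ (i,j) \<noteq> 0 \<Longrightarrow> same_block (finest_blocks \<Gamma>) i j"
    and finest_blocks_least: "\<And>B i j. partition_on {..<p} B \<Longrightarrow>
      (\<And>i j. i < p \<Longrightarrow> j < p \<Longrightarrow> \<Gamma> $$ (i,j) \<noteq> 0 \<Longrightarrow> same_block B i j) \<Longrightarrow>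
      same_block (finest_blocks \<Gamma>) i j \<Longrightarrow> same_block B i j"
proof -
  have iff: "is_block_partition \<Gamma> B \<longleftrightarrow> partition_on {..<p} B \<and>
      (\<forall>i<p. \<forall>j<p. \<Gamma> $$ (i, j) \<noteq> 0 \<longrightarrow> same_block B i j)" for B
  proof -
    have "\<Gamma> = restrict_blocks \<Gamma> B \<longleftrightarrow>
        (\<forall>i<p. \<forall>j<p. \<Gamma> $$ (i, j) = (if same_block B i j then \<Gamma> $$ (i, j) else 0))"
      unfolding mat_eq_iff using \<Gamma> by (auto simp: restrict_blocks_def)
    also have "\<dots> \<longleftrightarrow> (\<forall>i<p. \<forall>j<p. \<Gamma> $$ (i, j) \<noteq> 0 \<longrightarrow> same_block B i j)"
      by (simp only: if_split) (intro all_cong1 imp_cong refl, blast)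
    finally show ?thesis using \<Gamma> by (auto simp: is_block_partition_def)
  qed
  have dim: "dim_row \<Gamma> = p" using \<Gamma> by auto
  have F: "is_block_partition \<Gamma> (finest_blocks \<Gamma>) \<and>
     (\<forall>B'. is_block_partition \<Gamma> B' \<longrightarrow> refines {..<dim_row \<Gamma>} (finest_blocks \<Gamma>) B')"
    unfolding finest_blocks_def by (rule theI'[OF finest_blocks_ex1[OF \<Gamma>]])
  show part: "partition_on {..<p} (finest_blocks \<Gamma>)" using F unfolding iff by blast
  show "\<And>i j. i < p \<Longrightarrow> j < p \<Longrightarrow> \<Gamma> $$ (i,j) \<noteq> 0 \<Longrightarrow> same_block (finest_blocks \<Gamma>) i j"
    using F unfolding iff by blast
  fix B i j assume B: "partition_on {..<p} B" "\<And>i j. i < p \<Longrightarrow> j < p \<Longrightarrow> \<Gamma> $$ (i,j) \<noteq> 0 \<Longrightarrow> same_block B i j"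
    and sb: "same_block (finest_blocks \<Gamma>) i j"
  have "is_block_partition \<Gamma> B" unfolding iff using B by blast
  then have "refines {..<p} (finest_blocks \<Gamma>) B" using F dim by simp
  then show "same_block B i j" using sb refines_iff_same_block[OF part B(1)] by blast
qed

text \<open>It suffices to exclude partitions strictly between the finest one and \<open>B\<close>.\<close>

lemma finest_blocks_eqI:
  assumes \<Gamma>: "\<Gamma> \<in> carrier_mat p p" and B: "partition_on {..<p} B"
    "\<And>i j. i < p \<Longrightarrow> j < p \<Longrightarrow> \<Gamma> $$ (i,j) \<noteq> 0 \<Longrightarrow> same_block B i j"
    and least: "\<And>C. partition_on {..<p} C \<Longrightarrow> (\<And>i j. i < p \<Longrightarrow> j < p \<Longrightarrow> \<Gamma> $$ (i,j) \<noteq> 0 \<Longrightarrow> same_block C i j) \<Longrightarrow>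
      (\<And>i j. same_block C i j \<Longrightarrow> same_block B i j) \<Longrightarrow> C = B"
  shows "finest_blocks \<Gamma> = B"
  by (rule least[OF finest_blocks_partition[OF \<Gamma>] finest_blocks_support[OF \<Gamma>] finest_blocks_least[OF \<Gamma> B]])

lemma restrict_blocks_carrier [simp]: "\<Gamma> \<in> carrier_mat p p \<Longrightarrow> restrict_blocks \<Gamma> B \<in> carrier_mat p p"
  by (auto simp: restrict_blocks_def)

lemma restrict_blocks_entry:
  "\<Gamma> \<in> carrier_mat p p \<Longrightarrow> i < p \<Longrightarrow> j < p \<Longrightarrow>
   restrict_blocks \<Gamma> B $$ (i,j) = (if same_block B i j then \<Gamma> $$ (i,j) else 0)"
  by (auto simp: restrict_blocks_def)

lemma restrict_blocks_sym: "sym_mat p \<Gamma> \<Longrightarrow> sym_mat p (restrict_blocks \<Gamma> B)"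
  by (auto simp: sym_mat_def restrict_blocks_entry same_block_sym[of B])

text \<open>The restricted form at \<open>x\<close> is the sum over the blocks of the full form at \<open>x\<close> cut down to the block.\<close>

lemma restrict_blocks_qform_ge:
  assumes A: "A \<in> carrier_mat p p" and B: "partition_on {..<p} B"
    and l: "\<And>x. l * sqnorm p x \<le> qform p A x"
  shows "l * sqnorm p x \<le> qform p (restrict_blocks A B) x"
proof -
  have fin: "finite B" "\<And>G. G \<in> B \<Longrightarrow> finite G"
    using B finite_elements[OF _ B] by (auto simp: partition_on_def intro: finite_subset[of _ "{..<p}"])
  have disj: "\<forall>G\<in>B. \<forall>H\<in>B. G \<noteq> H \<longrightarrow> G \<inter> H = {}" using B by (auto simp: partition_on_def disjoint_def)
  have split: "(\<Sum>i<p. f i) = (\<Sum>G\<in>B. \<Sum>i\<in>G. f i)" for f :: "nat \<Rightarrow> real"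
  proof -
    have "{..<p} = \<Union>B" using B by (simp add: partition_on_def)
    then show ?thesis using sum.Union_disjoint[of B f] fin disj by simp
  qed
  have Gsub: "G \<subseteq> {..<p}" if "G \<in> B" for G using that B by (auto simp: partition_on_def)
  have restr: "(\<Sum>i<p. if i \<in> G then f i else 0) = (\<Sum>i\<in>G. f i)" if "G \<in> B" for G and f :: "nat \<Rightarrow> real"
    using Gsub[OF that] by (simp add: sum.If_cases Int_absorb1)
  define y where "y G i = (if i \<in> G then x i else 0)" for G i
  have "qform p (restrict_blocks A B) x = (\<Sum>G\<in>B. \<Sum>i\<in>G. \<Sum>j<p. restrict_blocks A B $$ (i,j) * x i * x j)"
    unfolding qform_def by (rule split)
  also have "\<dots> = (\<Sum>G\<in>B. qform p A (y G))"
  proof (rule sum.cong[OF refl])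
    fix G assume G: "G \<in> B"
    have "(\<Sum>i\<in>G. \<Sum>j<p. restrict_blocks A B $$ (i,j) * x i * x j) = (\<Sum>i\<in>G. \<Sum>j<p. if j \<in> G then A $$ (i,j) * x i * x j else 0)"
    proof (intro sum.cong refl)
      fix i j assume ij: "i \<in> G" "j \<in> {..<p}"
      have "same_block B i j \<longleftrightarrow> j \<in> G" using ij G disj unfolding same_block_def by blast
      then show "restrict_blocks A B $$ (i,j) * x i * x j = (if j \<in> G then A $$ (i,j) * x i * x j else 0)"
        using ij Gsub[OF G] A by (auto simp: restrict_blocks_entry subset_iff)
    qed
    also have "\<dots> = (\<Sum>i<p. if i \<in> G then (\<Sum>j<p. if j \<in> G then A $$ (i,j) * x i * x j else 0) else 0)"
      by (rule restr[OF G, symmetric])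
    also have "\<dots> = qform p A (y G)" unfolding qform_def y_def by (intro sum.cong refl) (auto intro!: sum.cong)
    finally show "(\<Sum>i\<in>G. \<Sum>j<p. restrict_blocks A B $$ (i,j) * x i * x j) = qform p A (y G)" .
  qed
  also have "\<dots> \<ge> (\<Sum>G\<in>B. l * sqnorm p (y G))" by (intro sum_mono l)
  also have "(\<Sum>G\<in>B. l * sqnorm p (y G)) = l * sqnorm p x"
  proof -
    have "sqnorm p (y G) = (\<Sum>i\<in>G. (x i)\<^sup>2)" if "G \<in> B" for G
      unfolding sqnorm_def restr[OF that, symmetric] by (intro sum.cong refl) (auto simp: y_def)
    then show ?thesis by (simp add: sqnorm_def split sum_distrib_left)
  qed
  finally show ?thesis .
qed

text \<open>The inverse of \<open>S\<^sub>B\<close> has the block pattern of \<open>B\<close>, so the trace does not see the difference between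
  \<open>S\<close> and \<open>S\<^sub>B\<close> and is constant: comparing partitions is comparing the determinants of \<open>S\<^sub>B\<close>. For a singular
  matrix the conventional inverse \<open>0\<close> makes the trace vanish.\<close>

lemma neg_loglik_restrict:
  assumes S: "S \<in> carrier_mat p p" and B: "partition_on {..<p} B"
  shows "neg_loglik S (restrict_blocks S B) =
    (ln (Determinant.det (restrict_blocks S B)) +
      (if Determinant.det (restrict_blocks S B) = 0 then 0 else real p)) / real p"
proof -
  let ?D = "restrict_blocks S B"
  have D: "?D \<in> carrier_mat p p" using S by simp
  have "trace_mat (inv_mat ?D * S) = (if Determinant.det ?D = 0 then 0 else real p)"
  proof (cases "mat_inverse ?D")
    case None
    from mat_inverse(1)[OF D this, of "()"] have "Determinant.det ?D = 0"
      using det_non_zero_imp_unit[OF D, of "()"] by blast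
    moreover have "inv_mat ?D = 0\<^sub>m p p" unfolding inv_mat_def None using carrier_matD[OF D] by simp
    then have "inv_mat ?D * S = 0\<^sub>m p p" using left_mult_zero_mat[OF S] by simp
    ultimately show ?thesis by (simp add: trace_mat_def)
  next
    case (Some P)
    from mat_inverse(2)[OF D this] have P: "P \<in> carrier_mat p p" "?D * P = 1\<^sub>m p" "P * ?D = 1\<^sub>m p" by auto
    have "Determinant.det ?D * Determinant.det P = 1" using det_mult[OF D P(1)] P(2) by simp
    then have nz: "Determinant.det ?D \<noteq> 0" by auto
    have P0: "P $$ (i,j) = 0" if "i < p" "j < p" "\<not> same_block B i j" for i j
      by (rule inverse_block_support[OF D P, of "same_block B"])
         (use that B S in \<open>auto simp: symp_same_block transp_same_block[OF B] same_block_refl restrict_blocks_entry\<close>)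
    have "trace_mat (P * S) = (\<Sum>i<p. \<Sum>k<p. P $$ (i,k) * S $$ (k,i))"
      unfolding trace_mat_def using P S by (auto intro!: sum.cong simp: mat_mult_entry simp del: index_mult_mat(1))
    also have "\<dots> = (\<Sum>i<p. \<Sum>k<p. P $$ (i,k) * ?D $$ (k,i))"
    proof (intro sum.cong refl)
      fix i k assume "i \<in> {..<p}" "k \<in> {..<p}"
      then show "P $$ (i,k) * S $$ (k,i) = P $$ (i,k) * ?D $$ (k,i)"
        using P0[of i k] S by (auto simp: restrict_blocks_entry same_block_sym[of B k i])
    qed
    also have "\<dots> = (\<Sum>i<p. (P * ?D) $$ (i,i))"
      by (intro sum.cong refl) (simp add: mat_mult_entry[OF P(1) D] del: index_mult_mat)
    also have "\<dots> = real p" unfolding P by simp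
    finally show ?thesis using nz by (simp add: inv_mat_def Some)
  qed
  then show ?thesis using S by (simp add: neg_loglik_def)
qed

section \<open>Log-determinants under perturbation\<close>

text \<open>Near \<open>0\<close> the constant \<open>2\<close> is enough; below \<open>-1/2\<close> the square is at least \<open>1/4\<close> and pays for the
  logarithm. The lower bound \<open>h\<close> of the argument is charged only logarithmically.\<close>

lemma minus_ln_one_plus_le:
  fixes t h :: real
  assumes h: "0 < h" "h \<le> 1/2" and t: "h \<le> 1 + t"
  shows "- ln (1 + t) \<le> - t + (2 + 4 * ln (1/h)) * t\<^sup>2"
proof -
  have lnh: "0 \<le> ln (1/h)" using h by (intro ln_ge_zero) (simp add: field_simps)
  have more: "2 * t\<^sup>2 \<le> (2 + 4 * ln (1/h)) * t\<^sup>2" using lnh by (intro mult_right_mono) auto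
  consider "0 \<le> t" | "t < 0" "-1/2 \<le> t" | "t < -1/2" by linarith
  then show ?thesis
  proof cases
    case 1
    have "1 - 1/(1+t) \<le> ln (1 + t)"
      using ln_le_minus_one[of "1/(1+t)"] 1 by (simp add: ln_div)
    moreover have "t - t\<^sup>2 \<le> 1 - 1/(1+t)"
    proof -
      have "1 - 1/(1+t) - (t - t\<^sup>2) = t^3 / (1+t)" using 1 by (simp add: field_simps power2_eq_square power3_eq_cube)
      then show ?thesis using 1 by (smt (verit) divide_nonneg_nonneg zero_le_power)
    qed
    ultimately show ?thesis using more zero_le_power2[of t] by linarith
  next
    case 2
    have "t - 2 * t\<^sup>2 \<le> ln (1 + t)" using ln_one_minus_pos_lower_bound[of "-t"] 2 by simp
    then show ?thesis using more by linarith
  next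
    case 3
    have "(1/2)\<^sup>2 \<le> (-t)\<^sup>2" using 3 by (intro power_mono) auto
    then have "1 \<le> 4 * t\<^sup>2" by (simp add: power2_eq_square)
    then have "ln (1/h) * 1 \<le> ln (1/h) * (4 * t\<^sup>2)" using lnh by (intro mult_left_mono)
    moreover have "- ln (1 + t) \<le> ln (1/h)" using h t by (simp add: ln_div)
    moreover have "0 \<le> 2 * t\<^sup>2" by simp
    moreover have "(2 + 4 * ln (1/h)) * t\<^sup>2 = 2 * t\<^sup>2 + ln (1/h) * (4 * t\<^sup>2)" by (simp add: distrib_right)
    ultimately show ?thesis using 3 by linarith
  qed
qed

lemma ln_one_plus_le:
  fixes t \<Lambda> :: real
  assumes \<Lambda>: "0 < \<Lambda>" and t: "0 < 1 + t" "1 + t \<le> \<Lambda>" "1 \<le> \<Lambda>"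
  shows "ln (1 + t) \<le> t - t\<^sup>2 / (2 * \<Lambda>)"
proof -
  define g where "g s = s - s\<^sup>2 / (2 * \<Lambda>) - ln (1 + s)" for s :: real
  define g' where "g' s = s * (1 / (1 + s) - 1 / \<Lambda>)" for s :: real
  have deriv: "(g has_real_derivative g' s) (at s)" if "0 < 1 + s" for s
  proof -
    have "(g has_real_derivative 1 - s / \<Lambda> - 1 / (1 + s)) (at s)"
      unfolding g_def using that \<Lambda> by (auto intro!: derivative_eq_intros)
    moreover have "1 - 1 / (1 + s) = s * (1 / (1 + s))" using that by (simp add: field_simps)
    then have "1 - s / \<Lambda> - 1 / (1 + s) = g' s" by (simp add: g'_def right_diff_distrib)
    ultimately show ?thesis by simp
  qed
  have g0: "g 0 = 0" by (simp add: g_def)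
  have br: "0 \<le> 1 / (1 + s) - 1 / \<Lambda>" if "0 < 1 + s" "1 + s \<le> \<Lambda>" for s
    using frac_le[of 1 1 "1 + s" \<Lambda>] that by simp
  have "0 \<le> g t"
  proof (cases "0 \<le> t")
    case True
    have "g 0 \<le> g t"
    proof (rule DERIV_nonneg_imp_nondecreasing[OF True])
      fix s assume s: "0 \<le> s" "s \<le> t"
      then have "0 \<le> g' s" unfolding g'_def using br[of s] t by (intro mult_nonneg_nonneg) auto
      then show "\<exists>y. (g has_real_derivative y) (at s) \<and> 0 \<le> y" using deriv[of s] s by auto
    qed
    then show ?thesis using g0 by simp
  next
    case False
    have "g 0 \<le> g t"
    proof (rule DERIV_nonpos_imp_nonincreasing[of t 0])
      show "t \<le> 0" using False by simp
      fix s assume s: "t \<le> s" "s \<le> 0"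
      then have "g' s \<le> 0" unfolding g'_def using br[of s] t by (intro mult_nonpos_nonneg) auto
      then show "\<exists>y. (g has_real_derivative y) (at s) \<and> y \<le> 0" using deriv[of s] s t by auto
    qed
    then show ?thesis using g0 by simp
  qed
  then show ?thesis by (simp add: g_def)
qed

lemma qform_ge_imp_pos_def:
  assumes "0 < h" "\<And>x. h * sqnorm p x \<le> qform p D x"
  shows "pos_def p D"
  unfolding pos_def_def
proof (intro allI impI)
  fix x :: "nat \<Rightarrow> real" assume "\<exists>i<p. x i \<noteq> 0"
  then have "0 < sqnorm p x" using sqnorm_pos by blast
  then have "0 < h * sqnorm p x" using assms(1) by simp
  also have "\<dots> \<le> qform p D x" by fact
  finally show "0 < qform p D x" .
qed

lemma qform_ge_imp_det_pos:
  assumes D: "sym_mat p D" and h: "0 < h" "\<And>x. h * sqnorm p x \<le> qform p D x"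
  shows "0 < Determinant.det D"
proof -
  have Dc: "D \<in> carrier_mat p p" using D by (simp add: sym_mat_def)
  define F where "F = D + (-1) \<cdot>\<^sub>m 1\<^sub>m p"
  have Fs: "sym_mat p F" using D by (auto simp: sym_mat_def F_def)
  have one: "sym_mat p (1\<^sub>m p)" by (auto simp: sym_mat_def)
  have qF: "qform p F x = qform p D x - sqnorm p x" for x
    unfolding F_def using Dc by (subst qform_add) (auto simp: qform_smult qform_one)
  have pd1: "pos_def p (1\<^sub>m p)"
    by (rule qform_ge_imp_pos_def[of 1]) (auto simp: qform_one)
  obtain \<theta> where \<theta>: "Determinant.det (1\<^sub>m p + F) = Determinant.det (1\<^sub>m p :: real Matrix.mat) * (\<Prod>i<p. 1 + \<theta> i)"
    "\<And>k c. k < p \<Longrightarrow> (\<And>x. c * qform p (1\<^sub>m p) x \<le> qform p F x) \<Longrightarrow> c \<le> \<theta> k"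
    by (rule relative_spectrum[OF one pd1 Fs, of "1\<^sub>m p"]) auto
  have "h - 1 \<le> \<theta> k" if "k < p" for k
    by (rule \<theta>(2)[OF that]) (use h(2) in \<open>auto simp: qF qform_one left_diff_distrib\<close>)
  then have "0 < (\<Prod>i<p. 1 + \<theta> i)" using h(1) by (intro prod_pos) force
  moreover have "1\<^sub>m p + F = D" unfolding F_def using Dc by (intro eq_matI) auto
  ultimately show ?thesis using \<theta>(1) by simp
qed

lemma ln_mult_prod:
  fixes a :: real and f :: "nat \<Rightarrow> real"
  assumes "0 < a" "\<And>i. i < n \<Longrightarrow> 0 < f i"
  shows "ln (a * (\<Prod>i<n. f i)) = ln a + (\<Sum>i<n. ln (f i))"
proof -
  have "ln (a * (\<Prod>i<n. f i)) = ln a + ln (\<Prod>i<n. f i)"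
    using assms by (intro ln_mult_pos prod_pos) auto
  also have "ln (\<Prod>i<n. f i) = (\<Sum>i<n. ln (f i))"
  proof (rule ln_prod)
    show "f i \<noteq> 0" if "i \<in> {..<n}" for i using assms(2)[of i] that by simp
  qed simp
  finally show ?thesis .
qed

text \<open>If \<open>D\<close> is supported on the classes of \<open>R\<close> and \<open>F\<close> off these classes, then \<open>D\<^sup>-\<^sup>1 F\<close> has zero
  diagonal. The first-order term of the log-determinant vanishes, and the change from \<open>D\<close> to \<open>D + F\<close> is of second order in
  the eigenvalues \<open>\<theta>\<close> of \<open>D\<^sup>-\<^sup>1 F\<close>.\<close>

lemma ln_det_perturbation:
  assumes D: "sym_mat p D" and F: "sym_mat p F" and b: "0 < b" "\<And>x. b * sqnorm p x \<le> qform p D x"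
    and T: "0 < h" "\<And>x. h * qform p D x \<le> qform p (D + F) x"
    and R: "symp R" "transp R" "\<And>i. i < p \<Longrightarrow> R i i"
    and Dsupp: "\<And>i j. i < p \<Longrightarrow> j < p \<Longrightarrow> \<not> R i j \<Longrightarrow> D $$ (i,j) = 0"
    and Fsupp: "\<And>i j. i < p \<Longrightarrow> j < p \<Longrightarrow> R i j \<Longrightarrow> F $$ (i,j) = 0"
  obtains P \<theta> where "P \<in> carrier_mat p p" "D * P = 1\<^sub>m p" "P * D = 1\<^sub>m p"
    "\<And>i j. i < p \<Longrightarrow> j < p \<Longrightarrow> \<bar>P $$ (i,j)\<bar> \<le> (if R i j then 1 / b else 0)"
    "ln (Determinant.det D) - ln (Determinant.det (D + F)) = - (\<Sum>i<p. ln (1 + \<theta> i))"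
    "(\<Sum>i<p. \<theta> i) = 0" "(\<Sum>i<p. (P * F * (P * F)) $$ (i,i)) = (\<Sum>i<p. (\<theta> i)\<^sup>2)"
    "\<And>k. k < p \<Longrightarrow> h \<le> 1 + \<theta> k"
    "\<And>k c. k < p \<Longrightarrow> (\<And>x. qform p F x \<le> c * qform p D x) \<Longrightarrow> \<theta> k \<le> c"
proof -
  have Dc: "D \<in> carrier_mat p p" and Fc: "F \<in> carrier_mat p p" using D F by (auto simp: sym_mat_def)
  have pd: "pos_def p D" by (rule qform_ge_imp_pos_def[OF b])
  obtain P where P: "P \<in> carrier_mat p p" "D * P = 1\<^sub>m p" "P * D = 1\<^sub>m p" using pos_def_inverse[OF Dc pd] by blast
  obtain \<theta> where \<theta>: "Determinant.det (D + F) = Determinant.det D * (\<Prod>i<p. 1 + \<theta> i)"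
    "(\<Sum>i<p. (P * F) $$ (i,i)) = (\<Sum>i<p. \<theta> i)"
    "(\<Sum>i<p. (P * F * (P * F)) $$ (i,i)) = (\<Sum>i<p. (\<theta> i)\<^sup>2)"
    "\<And>k c. k < p \<Longrightarrow> (\<And>x. c * qform p D x \<le> qform p F x) \<Longrightarrow> c \<le> \<theta> k"
    "\<And>k c. k < p \<Longrightarrow> (\<And>x. qform p F x \<le> c * qform p D x) \<Longrightarrow> \<theta> k \<le> c"
    by (rule relative_spectrum[OF D pd F P(1,2)]) auto
  have P0: "P $$ (i,j) = 0" if "i < p" "j < p" "\<not> R i j" for i j
    by (rule inverse_block_support[OF Dc P R(1-3) Dsupp]) (use that in auto)
  have lb: "h - 1 \<le> \<theta> k" if "k < p" for k
    by (rule \<theta>(4)[OF that]) (use T(2) qform_add[OF Dc Fc] in \<open>auto simp: algebra_simps\<close>)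
  have detD: "0 < Determinant.det D" by (rule qform_ge_imp_det_pos[OF D b])
  have pos: "0 < 1 + \<theta> k" if "k < p" for k using lb[OF that] T(1) by simp
  have "ln (Determinant.det (D + F)) = ln (Determinant.det D) + (\<Sum>i<p. ln (1 + \<theta> i))"
    unfolding \<theta>(1) using detD pos by (rule ln_mult_prod)
  then have ln: "ln (Determinant.det D) - ln (Determinant.det (D + F)) = - (\<Sum>i<p. ln (1 + \<theta> i))"
    by simp
  have tr0: "(\<Sum>i<p. \<theta> i) = 0"
  proof -
    have "(P * F) $$ (i,i) = 0" if i: "i < p" for i
      unfolding mat_mult_entry[OF P(1) Fc i i]
    proof (rule sum.neutral, rule ballI)
      fix k assume k: "k \<in> {..<p}"
      show "P $$ (i,k) * F $$ (k,i) = 0"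
        using P0[of i k] Fsupp[of k i] sympD[OF R(1), of i k] i k by (cases "R i k") auto
    qed
    then show ?thesis unfolding \<theta>(2)[symmetric] by (intro sum.neutral) simp
  qed
  have Pb: "\<bar>P $$ (i,j)\<bar> \<le> (if R i j then 1 / b else 0)" if "i < p" "j < p" for i j
    using P0[OF that] inverse_entries_bounded[OF Dc P(1,2) b that] by auto
  have lb': "h \<le> 1 + \<theta> k" if "k < p" for k using lb[OF that] by linarith
  show ?thesis
    by (rule that[OF P Pb ln tr0 \<theta>(3) lb' \<theta>(5)])
qed

text \<open>Only \<open>D\<close> has to be well conditioned; of \<open>D + F\<close> just a lower bound relative to \<open>D\<close> is
  needed, and it enters through its logarithm.\<close>

lemma ln_det_decrease_le:
  assumes D: "sym_mat p D" and F: "sym_mat p F" and b: "0 < b" "\<And>x. b * sqnorm p x \<le> qform p D x"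
    and T: "0 < h" "h \<le> 1/2" "\<And>x. h * qform p D x \<le> qform p (D + F) x"
    and R: "symp R" "transp R" "\<And>i. i < p \<Longrightarrow> R i i" "\<And>j. j < p \<Longrightarrow> card {i. i < p \<and> R i j} \<le> m"
    and Dsupp: "\<And>i j. i < p \<Longrightarrow> j < p \<Longrightarrow> \<not> R i j \<Longrightarrow> D $$ (i,j) = 0"
    and Fsupp: "\<And>i j. i < p \<Longrightarrow> j < p \<Longrightarrow> R i j \<Longrightarrow> F $$ (i,j) = 0"
  shows "ln (Determinant.det D) - ln (Determinant.det (D + F)) \<le> (2 + 4 * ln (1/h)) * ((real m)\<^sup>2 * frobenius_sq p F / b\<^sup>2)"
proof -
  obtain P \<theta> where P: "P \<in> carrier_mat p p"
    and Pb: "\<And>i j. i < p \<Longrightarrow> j < p \<Longrightarrow> \<bar>P $$ (i,j)\<bar> \<le> (if R i j then 1 / b else 0)"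
    and ln: "ln (Determinant.det D) - ln (Determinant.det (D + F)) = - (\<Sum>i<p. ln (1 + \<theta> i))"
    and tr: "(\<Sum>i<p. \<theta> i) = 0" "(\<Sum>i<p. (P * F * (P * F)) $$ (i,i)) = (\<Sum>i<p. (\<theta> i)\<^sup>2)"
    and lb: "\<And>k. k < p \<Longrightarrow> h \<le> 1 + \<theta> k"
    by (rule ln_det_perturbation[OF D F b T(1,3) R(1-3) Dsupp Fsupp]) (assumption | blast)+
  have Fc: "F \<in> carrier_mat p p" using F by (auto simp: sym_mat_def)
  have lnh: "0 \<le> ln (1/h)" using T by (intro ln_ge_zero) (simp add: field_simps)
  have "ln (Determinant.det D) - ln (Determinant.det (D + F)) = (\<Sum>i<p. - ln (1 + \<theta> i))"
    unfolding ln by (simp add: sum_negf)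
  also have "\<dots> \<le> (\<Sum>i<p. - \<theta> i + (2 + 4 * ln (1/h)) * (\<theta> i)\<^sup>2)"
    by (intro sum_mono minus_ln_one_plus_le T(1,2)) (use lb in auto)
  also have "\<dots> = (2 + 4 * ln (1/h)) * (\<Sum>i<p. (P * F * (P * F)) $$ (i,i))"
    by (simp only: sum.distrib sum_negf sum_distrib_left[symmetric] tr minus_zero add_0)
  also have "\<dots> \<le> (2 + 4 * ln (1/h)) * ((1/b)\<^sup>2 * (real m)\<^sup>2 * frobenius_sq p F)"
    using lnh b by (intro mult_left_mono trace_square_bound[OF P Fc R(1,4) _ Pb]) auto
  finally show ?thesis by (simp add: power_divide mult_ac)
qed

text \<open>The sum of the \<open>\<theta>\<^sup>2\<close> is the value at \<open>F\<close> of the form \<open>tr(D\<^sup>-\<^sup>1 X D\<^sup>-\<^sup>1 X)\<close>, which is nonnegative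
  on symmetric \<open>X\<close>. Evaluating the form at \<open>F - s D F D\<close> for the optimal \<open>s\<close> bounds it at \<open>F\<close> from below by a multiple of the
  Frobenius norm of \<open>F\<close>.\<close>

lemma ln_det_decrease_ge:
  assumes D: "sym_mat p D" and F: "sym_mat p F" and b: "0 < b" "\<And>x. b * sqnorm p x \<le> qform p D x"
    and T: "0 < h" "\<And>x. h * qform p D x \<le> qform p (D + F) x"
      "1 \<le> \<Lambda>" "\<And>x. qform p (D + F) x \<le> \<Lambda> * qform p D x"
    and R: "symp R" "transp R" "\<And>i. i < p \<Longrightarrow> R i i" "\<And>j. j < p \<Longrightarrow> card {i. i < p \<and> R i j} \<le> m" "1 \<le> m"
    and Dsupp: "\<And>i j. i < p \<Longrightarrow> j < p \<Longrightarrow> \<not> R i j \<Longrightarrow> D $$ (i,j) = 0"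
    and Fsupp: "\<And>i j. i < p \<Longrightarrow> j < p \<Longrightarrow> R i j \<Longrightarrow> F $$ (i,j) = 0"
    and c: "0 < c" "\<And>i j. i < p \<Longrightarrow> j < p \<Longrightarrow> \<bar>D $$ (i,j)\<bar> \<le> c"
  shows "frobenius_sq p F / (2 * \<Lambda> * (c\<^sup>2 * (real m)\<^sup>2)) \<le> ln (Determinant.det D) - ln (Determinant.det (D + F))"
proof -
  have Dc: "D \<in> carrier_mat p p" and Fc: "F \<in> carrier_mat p p" using D F by (auto simp: sym_mat_def)
  have pd: "pos_def p D" by (rule qform_ge_imp_pos_def[OF b])
  obtain P \<theta> where P: "P \<in> carrier_mat p p" "D * P = 1\<^sub>m p" "P * D = 1\<^sub>m p"
    and ln: "ln (Determinant.det D) - ln (Determinant.det (D + F)) = - (\<Sum>i<p. ln (1 + \<theta> i))"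
    and sums: "(\<Sum>i<p. \<theta> i) = 0" "(\<Sum>i<p. (P * F * (P * F)) $$ (i,i)) = (\<Sum>i<p. (\<theta> i)\<^sup>2)"
    and lb: "\<And>k. k < p \<Longrightarrow> h \<le> 1 + \<theta> k"
    and ub0: "\<And>k c. k < p \<Longrightarrow> (\<And>x. qform p F x \<le> c * qform p D x) \<Longrightarrow> \<theta> k \<le> c"
    by (rule ln_det_perturbation[OF D F b T(1,2) R(1-3) Dsupp Fsupp]) (assumption | blast)+
  have ub: "\<theta> k \<le> \<Lambda> - 1" if "k < p" for k
    by (rule ub0[OF that]) (use T(4) qform_add[OF Dc Fc] in \<open>auto simp: algebra_simps\<close>)
  have pos: "0 < 1 + \<theta> k" if "k < p" for k using lb[OF that] T(1) by linarith
  have "(\<Sum>i<p. ln (1 + \<theta> i)) \<le> (\<Sum>i<p. \<theta> i - (\<theta> i)\<^sup>2 / (2 * \<Lambda>))"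
    using ub pos T(3) by (intro sum_mono ln_one_plus_le) (auto simp: le_diff_eq add.commute)
  moreover have "\<dots> = - (\<Sum>i<p. (\<theta> i)\<^sup>2) / (2 * \<Lambda>)"
    by (simp add: sum_subtractf sum_divide_distrib[symmetric] sums(1))
  moreover have "frobenius_sq p F / (c\<^sup>2 * (real m)\<^sup>2) \<le> (\<Sum>i<p. (\<theta> i)\<^sup>2)"
  proof -
    define K where "K = c\<^sup>2 * (real m)\<^sup>2"
    have K: "0 < K" using c R(5) by (simp add: K_def)
    \<comment> \<open>the maximizer of \<open>2 s - s\<^sup>2 K\<close>\<close>
    define s where "s = 1 / K"
    define M where "M = D * F * D"
    define G where "G = F + (- s) \<cdot>\<^sub>m M"
    have DFD: "M \<in> carrier_mat p p" using Dc Fc by (simp add: M_def)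
    have DFDsym: "M $$ (i,j) = M $$ (j,i)" if "i < p" "j < p" for i j
    proof -
      have t: "transpose_mat D = D" "transpose_mat F = F"
        using D F by (auto simp: sym_mat_def intro!: eq_matI)
      have "transpose_mat M = D * (F * D)"
        unfolding M_def using Dc Fc by (simp add: transpose_mult[of _ p p _ p] t)
      also have "\<dots> = M" unfolding M_def using Dc Fc by (simp add: assoc_mult_mat[of _ p p _ p _ p])
      finally have "transpose_mat M $$ (j,i) = M $$ (j,i)" by simp
      then show ?thesis using that DFD by (simp only: index_transpose_mat carrier_matD)
    qed
    have Gs: "sym_mat p G" using F DFD DFDsym unfolding sym_mat_def G_def by auto
    obtain \<phi> where \<phi>: "(\<Sum>i<p. (P * G * (P * G)) $$ (i,i)) = (\<Sum>i<p. (\<phi> i :: real)\<^sup>2)"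
      by (rule relative_spectrum[OF D pd Gs P(1,2)]) auto
    then have nn: "0 \<le> (\<Sum>i<p. (P * G * (P * G)) $$ (i,i))" by (simp add: sum_nonneg)
    define X where "X = P * F"
    define Y where "Y = F * D"
    have XY: "X \<in> carrier_mat p p" "Y \<in> carrier_mat p p" using P Fc Dc by (auto simp: X_def Y_def)
    have PG: "P * G = X + (- s) \<cdot>\<^sub>m Y"
    proof -
      have "P * G = P * F + P * ((- s) \<cdot>\<^sub>m M)"
        unfolding G_def using P Fc DFD by (intro mult_add_distrib_mat) auto
      also have "P * ((- s) \<cdot>\<^sub>m M) = (- s) \<cdot>\<^sub>m (P * M)"
        using P(1) DFD by (rule mult_smult_distrib)
      also have "P * M = (P * D) * (F * D)"
        unfolding M_def using P(1) Dc Fc by (simp add: assoc_mult_mat[of _ p p _ p _ p])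
      also have "\<dots> = Y" unfolding P(3) Y_def using Fc Dc by simp
      finally show ?thesis by (simp add: X_def)
    qed
    have tr: "(\<Sum>i<p. ((X + (- s) \<cdot>\<^sub>m Y) * (X + (- s) \<cdot>\<^sub>m Y)) $$ (i,i)) =
        (\<Sum>i<p. (X * X) $$ (i,i)) - 2 * s * (\<Sum>i<p. (Y * X) $$ (i,i)) + s\<^sup>2 * (\<Sum>i<p. (Y * Y) $$ (i,i))"
    proof -
      have Z: "X + (- s) \<cdot>\<^sub>m Y \<in> carrier_mat p p" using XY by simp
      have "(\<Sum>i<p. ((X + (- s) \<cdot>\<^sub>m Y) * (X + (- s) \<cdot>\<^sub>m Y)) $$ (i,i)) =
        (\<Sum>i<p. \<Sum>k<p. (X $$ (i,k) - s * Y $$ (i,k)) * (X $$ (k,i) - s * Y $$ (k,i)))"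
        by (intro sum.cong refl) (use XY in \<open>simp add: mat_mult_entry[OF Z Z] del: index_mult_mat\<close>)
      also have "\<dots> = (\<Sum>i<p. \<Sum>k<p. X $$ (i,k) * X $$ (k,i)) - s * (\<Sum>i<p. \<Sum>k<p. X $$ (i,k) * Y $$ (k,i))
         - s * (\<Sum>i<p. \<Sum>k<p. Y $$ (i,k) * X $$ (k,i)) + s\<^sup>2 * (\<Sum>i<p. \<Sum>k<p. Y $$ (i,k) * Y $$ (k,i))"
        unfolding sum_distrib_left sum.distrib[symmetric] sum_subtractf[symmetric]
        by (intro sum.cong refl) (simp add: algebra_simps power2_eq_square)
      also have "(\<Sum>i<p. \<Sum>k<p. X $$ (i,k) * Y $$ (k,i)) = (\<Sum>i<p. \<Sum>k<p. Y $$ (i,k) * X $$ (k,i))"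
        by (subst sum.swap) (simp add: mult.commute)
      finally show ?thesis using XY by (simp add: mat_mult_entry[OF XY(1,1)] mat_mult_entry[OF XY(2,2)] mat_mult_entry[OF XY(2,1)] del: index_mult_mat)
    qed
    have YX: "(\<Sum>i<p. (Y * X) $$ (i,i)) = frobenius_sq p F"
    proof -
      have "Y * X = F * (D * P) * F" unfolding X_def Y_def using Fc Dc P(1) by (simp add: assoc_mult_mat[of _ p p _ p _ p])
      also have "\<dots> = F * F" unfolding P(2) using Fc by simp
      finally have "(\<Sum>i<p. (Y * X) $$ (i,i)) = (\<Sum>i<p. \<Sum>k<p. F $$ (i,k) * F $$ (k,i))"
        by (simp add: mat_mult_entry[OF Fc Fc] del: index_mult_mat)
      also have "\<dots> = frobenius_sq p F" unfolding frobenius_sq_def using F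
        by (intro sum.cong refl) (auto simp: sym_mat_def power2_eq_square)
      finally show ?thesis .
    qed
    have YY: "(\<Sum>i<p. (Y * Y) $$ (i,i)) \<le> K * frobenius_sq p F"
    proof -
      have "(\<Sum>i<p. (Y * Y) $$ (i,i)) = (\<Sum>i<p. (F * M) $$ (i,i))"
        unfolding Y_def M_def using Fc Dc by (simp add: assoc_mult_mat[of _ p p _ p _ p] del: index_mult_mat)
      also have "\<dots> = (\<Sum>i<p. (M * F) $$ (i,i))" by (rule trace_mult_comm[OF Fc DFD])
      also have "M * F = D * F * (D * F)" unfolding M_def using Fc Dc by (simp add: assoc_mult_mat[of _ p p _ p _ p])
      also have "(\<Sum>i<p. (D * F * (D * F)) $$ (i,i)) \<le> c\<^sup>2 * (real m)\<^sup>2 * frobenius_sq p F"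
        by (rule trace_square_bound[OF Dc Fc R(1,4)]) (use c Dsupp in auto)
      finally show ?thesis by (simp add: K_def)
    qed
    have "0 \<le> (\<Sum>i<p. (\<theta> i)\<^sup>2) - 2 * s * frobenius_sq p F + s\<^sup>2 * (\<Sum>i<p. (Y * Y) $$ (i,i))"
      using nn unfolding PG tr YX sums(2)[symmetric, folded X_def] .
    also have "s\<^sup>2 * (\<Sum>i<p. (Y * Y) $$ (i,i)) \<le> s\<^sup>2 * (K * frobenius_sq p F)" using YY by (intro mult_left_mono) auto
    also have "s\<^sup>2 * (K * frobenius_sq p F) = s * frobenius_sq p F" using K by (simp add: s_def power2_eq_square)
    finally have "s * frobenius_sq p F \<le> (\<Sum>i<p. (\<theta> i)\<^sup>2)" by linarith
    then show ?thesis by (simp add: s_def K_def)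
  qed
  then have "frobenius_sq p F / (c\<^sup>2 * (real m)\<^sup>2) / (2 * \<Lambda>) \<le> (\<Sum>i<p. (\<theta> i)\<^sup>2) / (2 * \<Lambda>)"
    using T(3) by (intro divide_right_mono) auto
  ultimately show ?thesis unfolding ln by (simp add: mult_ac)
qed

section \<open>Minimizing the criterion on a concentrated sample\<close>

lemma max_norm_ge_imp_entry:
  assumes M: "M \<in> carrier_mat p p" and p: "0 < p" and t: "t \<le> max_norm M"
  obtains i j where "i < p" "j < p" "t \<le> \<bar>M $$ (i,j)\<bar>"
proof -
  let ?A = "{\<bar>M $$ (i, j)\<bar> | i j. i < dim_row M \<and> j < dim_col M}"
  have eq: "?A = (\<lambda>(i,j). \<bar>M $$ (i,j)\<bar>) ` ({..<p} \<times> {..<p})" using M by auto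
  have "Max ?A \<in> ?A" by (rule Max_in) (use p in \<open>auto simp: eq\<close>)
  then show ?thesis using t that M unfolding max_norm_def by auto
qed

lemma sum_if_mem:
  fixes c :: real
  assumes "finite A"
  shows "(\<Sum>x\<in>A. if x \<in> K then c else 0) = real (card (A \<inter> K)) * c"
proof -
  have "(\<Sum>x\<in>A. if x \<in> K then c else 0) = (\<Sum>x\<in>A \<inter> K. c)"
    by (rule sum.inter_restrict[OF assms, symmetric])
  then show ?thesis by simp
qed

text \<open>Here \<open>\<tau>\<close> bounds the error of the entries of \<open>S\<close>, and any strict refinement of the true partition drops an
  entry of \<open>\<Sigma>\<close> of modulus at least \<open>\<theta>\<close>. The lower bound \<open>\<eta>\<close> of the eigenvalues of \<open>S\<close> may be very small:
  later estimates depend on \<open>ln \<eta>\<close> only.\<close>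

locale concentrated_sample =
  fixes p m :: nat and \<Sigma> S :: "real Matrix.mat" and Bst :: "nat set set" and l u \<tau> \<eta> \<theta> :: real
  assumes p_pos: "0 < p" and m_pos: "1 \<le> m"
    and \<Sigma>_sym: "sym_mat p \<Sigma>" and S_sym: "sym_mat p S"
    and Bst: "Bst = finest_blocks \<Sigma>"
    and block_card: "\<And>G. G \<in> Bst \<Longrightarrow> card G \<le> m"
    and l_pos: "0 < l" and \<Sigma>_lower: "\<And>x. l * sqnorm p x \<le> qform p \<Sigma> x"
    and \<Sigma>_entries: "\<And>i j. i < p \<Longrightarrow> j < p \<Longrightarrow> \<bar>\<Sigma> $$ (i,j)\<bar> \<le> u"
    and close: "\<And>i j. i < p \<Longrightarrow> j < p \<Longrightarrow> \<bar>S $$ (i,j) - \<Sigma> $$ (i,j)\<bar> \<le> \<tau>"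
    and \<eta>_pos: "0 < \<eta>" and S_lower: "\<And>x. \<eta> * sqnorm p x \<le> qform p S x"
    and S_nonzero: "\<And>i j. i < p \<Longrightarrow> j < p \<Longrightarrow> i \<noteq> j \<Longrightarrow> S $$ (i,j) \<noteq> 0"
    and \<tau>_small: "real m * \<tau> \<le> l / 2" "\<tau> \<le> \<theta> / 2" "\<tau> \<le> u"
    and \<eta>_small: "\<eta> \<le> u" and l_le_u: "l \<le> u"
    and separation: "\<And>B. strictly_refines {..<p} B Bst \<Longrightarrow> \<theta> \<le> max_norm (restrict_blocks \<Sigma> B - \<Sigma>)"
    and \<theta>_pos: "0 < \<theta>"
begin

lemma \<Sigma>c: "\<Sigma> \<in> carrier_mat p p" and Sc: "S \<in> carrier_mat p p"
  using \<Sigma>_sym S_sym by (auto simp: sym_mat_def)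

lemma Bst_part: "partition_on {..<p} Bst"
  unfolding Bst by (rule finest_blocks_partition[OF \<Sigma>c])

lemma \<Sigma>_cross: "i < p \<Longrightarrow> j < p \<Longrightarrow> \<not> same_block Bst i j \<Longrightarrow> \<Sigma> $$ (i,j) = 0"
  using finest_blocks_support[OF \<Sigma>c] unfolding Bst by blast

lemma u_pos: "0 < u" using l_pos l_le_u by simp

lemma \<tau>_nonneg: "0 \<le> \<tau>" using close[OF p_pos p_pos] by linarith

lemma Bst_class: "j < p \<Longrightarrow> card {i. i < p \<and> same_block Bst i j} \<le> m"
  by (rule card_class_le[OF Bst_part block_card])

lemma S_diag_pos: assumes "i < p" shows "\<eta> \<le> S $$ (i,i)"
  using S_lower[of "pair_dir i i 0"] qform_pair_dir[OF S_sym assms assms, of 0] sqnorm_pair_dir[OF assms assms, of 0] by simp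

lemma S_nonzero': "i < p \<Longrightarrow> j < p \<Longrightarrow> S $$ (i,j) \<noteq> 0"
  using S_nonzero S_diag_pos \<eta>_pos by (cases "i = j") force+

text \<open>Since no entry of \<open>S\<close> vanishes, the penalty of \<open>S\<^sub>B\<close> is that of \<open>B\<close> itself; otherwise distinct
  partitions could have the same criterion.\<close>

lemma finest_blocks_restrict_S:
  assumes B: "partition_on {..<p} B"
  shows "finest_blocks (restrict_blocks S B) = B"
proof (rule finest_blocks_eqI[OF _ B])
  show "restrict_blocks S B \<in> carrier_mat p p" using Sc by simp
  show "same_block B i j" if "i < p" "j < p" "restrict_blocks S B $$ (i,j) \<noteq> 0" for i j
    using that Sc by (auto simp: restrict_blocks_entry split: if_splits)
  fix C assume C: "partition_on {..<p} C"
    "\<And>i j. i < p \<Longrightarrow> j < p \<Longrightarrow> restrict_blocks S B $$ (i, j) \<noteq> 0 \<Longrightarrow> same_block C i j"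
    "\<And>i j. same_block C i j \<Longrightarrow> same_block B i j"
  have "same_block C i j" if "same_block B i j" for i j
    using C(2)[of i j] same_block_less[OF B that] that Sc S_nonzero' by (simp add: restrict_blocks_entry)
  then show "C = B" using C(3) by (intro partition_eqI[OF C(1) B]) blast
qed

lemma restrict_S_sym: "sym_mat p (restrict_blocks S B)"
  by (rule restrict_blocks_sym[OF S_sym])

lemma restrict_S_lower: "partition_on {..<p} B \<Longrightarrow> \<eta> * sqnorm p x \<le> qform p (restrict_blocks S B) x"
  by (rule restrict_blocks_qform_ge[OF Sc _ S_lower])

lemma det_restrict_S_pos: "partition_on {..<p} B \<Longrightarrow> 0 < Determinant.det (restrict_blocks S B)"
  by (rule qform_ge_imp_det_pos[OF restrict_S_sym \<eta>_pos restrict_S_lower])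

lemma crit_eq:
  assumes "partition_on {..<p} B"
  shows "crit \<kappa> S B = ln (Determinant.det (restrict_blocks S B)) / real p + 1 + \<kappa> * pen B"
  unfolding crit_def crit_mat_def finest_blocks_restrict_S[OF assms] neg_loglik_restrict[OF Sc assms]
  using det_restrict_S_pos[OF assms] p_pos by (simp add: add_divide_distrib)

lemma S_entries: assumes "i < p" "j < p" shows "\<bar>S $$ (i,j)\<bar> \<le> 2 * u"
  using close[OF assms] \<Sigma>_entries[OF assms] \<tau>_small(3) by linarith

context
  fixes C
  assumes C: "partition_on {..<p} C" and ref: "\<And>i j. same_block C i j \<Longrightarrow> same_block Bst i j"
begin

lemma refined_entries:
  "i < p \<Longrightarrow> j < p \<Longrightarrow> \<bar>restrict_blocks S C $$ (i,j)\<bar> \<le> (if same_block Bst i j then 2 * u else 0)"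
  using ref[of i j] S_entries[of i j] u_pos Sc by (auto simp: restrict_blocks_entry)

lemma refined_upper: "qform p (restrict_blocks S C) x \<le> 2 * u * real m * sqnorm p x"
  using block_qform_bound[OF symp_same_block Bst_class _ refined_entries, of x] u_pos by simp

lemma refined_lower: "l / 2 * sqnorm p x \<le> qform p (restrict_blocks S C) x"
proof -
  define E where "E = restrict_blocks S C - restrict_blocks \<Sigma> C"
  have "\<bar>E $$ (i,j)\<bar> \<le> (if same_block Bst i j then \<tau> else 0)" if "i < p" "j < p" for i j
    using that ref[of i j] close[OF that] \<tau>_nonneg Sc \<Sigma>c
    by (auto simp: E_def restrict_blocks_entry index_minus_mat(1) carrier_matD[OF restrict_blocks_carrier[OF \<Sigma>c]])
  then have E: "\<bar>qform p E x\<bar> \<le> \<tau> * real m * sqnorm p x"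
    by (intro block_qform_bound[OF symp_same_block Bst_class]) (use \<tau>_nonneg in auto)
  have "restrict_blocks S C = restrict_blocks \<Sigma> C + E"
    unfolding E_def using Sc \<Sigma>c by (intro eq_matI) (auto simp: restrict_blocks_def)
  then have "qform p (restrict_blocks S C) x = qform p (restrict_blocks \<Sigma> C) x + qform p E x"
    using qform_add[OF restrict_blocks_carrier[OF \<Sigma>c], of E C x] Sc \<Sigma>c
    by (simp add: E_def minus_carrier_mat)
  moreover have "l * sqnorm p x \<le> qform p (restrict_blocks \<Sigma> C) x"
    by (rule restrict_blocks_qform_ge[OF \<Sigma>c C \<Sigma>_lower])
  moreover have "\<tau> * real m * sqnorm p x \<le> l / 2 * sqnorm p x"
    using \<tau>_small(1) sqnorm_nonneg by (intro mult_right_mono) (simp_all add: mult.commute)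
  ultimately show ?thesis using E by linarith
qed

end

text \<open>The entries discarded in passing from \<open>B\<close> to its common refinement \<open>C\<close> with the true partition
  estimate zeros of \<open>\<Sigma>\<close>, so each is at most \<open>\<tau>\<close>, and \<open>pen B - pen C\<close> counts them. The matrix \<open>S\<^sub>C\<close> is well
  conditioned because its blocks are small.\<close>

lemma overfit_gain_small:
  assumes B: "partition_on {..<p} B" and C: "partition_on {..<p} C"
    and meet: "\<And>i j. same_block C i j \<longleftrightarrow> same_block B i j \<and> same_block Bst i j"
  shows "ln (Determinant.det (restrict_blocks S C)) - ln (Determinant.det (restrict_blocks S B))
    \<le> (2 + 4 * ln (4 * u * real m / \<eta>)) * (4 * (real m)\<^sup>2 * \<tau>\<^sup>2 / l\<^sup>2) * (pen B - pen C)"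
proof -
  define D where "D = restrict_blocks S C"
  define F where "F = restrict_blocks S B - restrict_blocks S C"
  define h where "h = \<eta> / (4 * u * real m)"
  have Dc: "D \<in> carrier_mat p p" and Fc: "F \<in> carrier_mat p p"
    using Sc by (auto simp: D_def F_def minus_carrier_mat)
  have Fe: "F $$ (i,j) = (if same_block B i j \<and> \<not> same_block C i j then S $$ (i,j) else 0)" if "i < p" "j < p" for i j
    using that Sc meet by (auto simp: F_def restrict_blocks_entry index_minus_mat(1) carrier_matD[OF restrict_blocks_carrier[OF Sc]])
  have F: "sym_mat p F" using Fc S_sym unfolding sym_mat_def
    by (auto simp: Fe same_block_sym[of B] same_block_sym[of C])
  have DF: "D + F = restrict_blocks S B" unfolding D_def F_def using Sc by (intro eq_matI) (auto simp: restrict_blocks_def)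
  have um: "0 < u * real m" using u_pos m_pos by simp
  have "u * 1 \<le> u * real m" using u_pos m_pos by (intro mult_left_mono) auto
  then have "\<eta> \<le> 2 * (u * real m)" using um \<eta>_small by linarith
  then have h: "0 < h" "h \<le> 1/2" using \<eta>_pos um by (simp_all add: h_def pos_divide_le_eq)
  have T: "h * qform p D x \<le> qform p (D + F) x" for x
  proof -
    have "h * qform p D x \<le> h * (2 * u * real m * sqnorm p x)"
      unfolding D_def using refined_upper[OF C] meet h by (intro mult_left_mono) auto
    also have "\<dots> = \<eta> / 2 * sqnorm p x" using u_pos m_pos by (simp add: h_def field_simps)
    also have "\<dots> \<le> \<eta> * sqnorm p x" using \<eta>_pos sqnorm_nonneg by (intro mult_right_mono) auto
    also have "\<dots> \<le> qform p (D + F) x" unfolding DF by (rule restrict_S_lower[OF B])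
    finally show ?thesis .
  qed
  have "ln (Determinant.det D) - ln (Determinant.det (D + F)) \<le> (2 + 4 * ln (1/h)) * ((real m)\<^sup>2 * frobenius_sq p F / (l/2)\<^sup>2)"
  proof (rule ln_det_decrease_le[OF _ F _ _ h T symp_same_block transp_same_block[OF Bst_part] same_block_refl[OF Bst_part] Bst_class])
    show "sym_mat p D" unfolding D_def by (rule restrict_S_sym)
    show "0 < l / 2" using l_pos by simp
    show "l / 2 * sqnorm p x \<le> qform p D x" for x unfolding D_def using meet by (intro refined_lower[OF C]) auto
    show "D $$ (i,j) = 0" if "i < p" "j < p" "\<not> same_block Bst i j" for i j
      using that meet Sc by (simp add: D_def restrict_blocks_entry)
    show "F $$ (i,j) = 0" if "i < p" "j < p" "same_block Bst i j" for i j
      using that meet by (simp add: Fe)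
  qed auto
  also have "1 / h = 4 * u * real m / \<eta>" by (simp add: h_def)
  also have "(2 + 4 * ln (4 * u * real m / \<eta>)) * ((real m)\<^sup>2 * frobenius_sq p F / (l/2)\<^sup>2)
     \<le> (2 + 4 * ln (4 * u * real m / \<eta>)) * ((real m)\<^sup>2 * (\<tau>\<^sup>2 * (pen B - pen C)) / (l/2)\<^sup>2)"
  proof (intro mult_left_mono divide_right_mono)
    let ?K = "{(i,j). same_block B i j} - {(i,j). same_block C i j}"
    have sub: "{(i,j). same_block C i j} \<subseteq> {(i,j). same_block B i j}" using meet by auto
    have "frobenius_sq p F \<le> (\<Sum>i<p. \<Sum>j<p. if (i,j) \<in> ?K then \<tau>\<^sup>2 else 0)"
      unfolding frobenius_sq_def
    proof (intro sum_mono)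
      fix i j assume "i \<in> {..<p}" "j \<in> {..<p}"
      then have ij: "i < p" "j < p" by auto
      show "(F $$ (i,j))\<^sup>2 \<le> (if (i,j) \<in> ?K then \<tau>\<^sup>2 else 0)"
      proof (cases "(i,j) \<in> ?K")
        case True
        then have "\<Sigma> $$ (i,j) = 0" using meet by (intro \<Sigma>_cross ij) auto
        then have "\<bar>S $$ (i,j)\<bar> \<le> \<bar>\<tau>\<bar>" using close[OF ij] \<tau>_nonneg by simp
        then have "(S $$ (i,j))\<^sup>2 \<le> \<tau>\<^sup>2" by (rule abs_le_square_iff[THEN iffD1])
        then show ?thesis using True by (simp add: Fe[OF ij])
      qed (use Fe[OF ij] in auto)
    qed
    also have "\<dots> = (\<Sum>ij\<in>{..<p} \<times> {..<p}. if ij \<in> ?K then \<tau>\<^sup>2 else 0)"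
      by (simp add: sum.cartesian_product case_prod_beta)
    also have "\<dots> = real (card ?K) * \<tau>\<^sup>2"
    proof -
      have "({..<p} \<times> {..<p}) \<inter> ?K = ?K" using same_block_less[OF B] by auto
      then show ?thesis using sum_if_mem[of "{..<p} \<times> {..<p}" ?K "\<tau>\<^sup>2"] by (simp only: finite_SigmaI finite_lessThan simp_thms)
    qed
    also have "real (card ?K) = pen B - pen C"
      unfolding pen_eq_card_pairs[OF B] pen_eq_card_pairs[OF C]
      using card_mono[OF finite_block_pairs[OF B] sub]
      by (simp add: card_Diff_subset[OF finite_block_pairs[OF C] sub] of_nat_diff)
    finally show "frobenius_sq p F \<le> \<tau>\<^sup>2 * (pen B - pen C)" by (simp add: mult.commute)
    have "0 \<le> ln (1/h)" using h by (intro ln_ge_zero) (simp add: field_simps)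
    then show "0 \<le> 2 + 4 * ln (4 * u * real m / \<eta>)" by (simp add: h_def)
  qed auto
  finally show ?thesis unfolding DF unfolding D_def by (simp add: power_divide mult_ac)
qed

text \<open>The separation hypothesis, applied to the partition that splits one block of the true partition only,
  yields an entry of size at least \<open>\<theta>\<close> inside every split block. Such a block accounts for at most \<open>m\<^sup>2\<close> of the pairs
  counted by \<open>pen Bst - pen C\<close>.\<close>

lemma underfit_loss_large:
  assumes C: "partition_on {..<p} C" and ref: "\<And>i j. same_block C i j \<Longrightarrow> same_block Bst i j"
  shows "\<theta>\<^sup>2 * l * (pen Bst - pen C) / (128 * u^3 * (real m)^5)
    \<le> ln (Determinant.det (restrict_blocks S C)) - ln (Determinant.det (restrict_blocks S Bst))"
proof -
  define D where "D = restrict_blocks S C"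
  define F where "F = restrict_blocks S Bst - restrict_blocks S C"
  define \<Lambda> where "\<Lambda> = 4 * u * real m / l"
  have Dc: "D \<in> carrier_mat p p" and Fc: "F \<in> carrier_mat p p"
    using Sc by (auto simp: D_def F_def minus_carrier_mat)
  have Fe: "F $$ (i,j) = (if same_block Bst i j \<and> \<not> same_block C i j then S $$ (i,j) else 0)" if "i < p" "j < p" for i j
    using that Sc ref by (auto simp: F_def restrict_blocks_entry index_minus_mat(1) carrier_matD[OF restrict_blocks_carrier[OF Sc]])
  have F: "sym_mat p F" using Fc S_sym unfolding sym_mat_def
    by (auto simp: Fe same_block_sym[of Bst] same_block_sym[of C])
  have DF: "D + F = restrict_blocks S Bst" unfolding D_def F_def using Sc by (intro eq_matI) (auto simp: restrict_blocks_def)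
  have um: "0 < u * real m" using u_pos m_pos by simp
  have "u * 1 \<le> u * real m" using u_pos m_pos by (intro mult_left_mono) auto
  then have lum: "l \<le> u * real m" using l_le_u by simp
  have \<Lambda>: "1 \<le> \<Lambda>" using lum l_pos um by (simp add: \<Lambda>_def pos_le_divide_eq)
  define h where "h = l / (4 * u * real m)"
  have h: "0 < h" using l_pos um by (simp add: h_def)
  have K: "frobenius_sq p F / (2 * \<Lambda> * ((2 * u)\<^sup>2 * (real m)\<^sup>2)) \<le> ln (Determinant.det D) - ln (Determinant.det (D + F))"
  proof (rule ln_det_decrease_ge[OF _ F _ _ h _ \<Lambda> _ symp_same_block[of C] transp_same_block[OF C] same_block_refl[OF C] _ m_pos])
    show "sym_mat p D" unfolding D_def by (rule restrict_S_sym)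
    show "0 < l / 2" using l_pos by simp
    show low: "l / 2 * sqnorm p x \<le> qform p D x" for x unfolding D_def by (rule refined_lower[OF C ref])
    have low': "l / 2 * sqnorm p x \<le> qform p (D + F) x" for x unfolding DF by (rule refined_lower[OF Bst_part])
    have up: "qform p D x \<le> 2 * u * real m * sqnorm p x" for x unfolding D_def by (rule refined_upper[OF C ref])
    have up': "qform p (D + F) x \<le> 2 * u * real m * sqnorm p x" for x unfolding DF by (rule refined_upper[OF Bst_part])
    show "h * qform p D x \<le> qform p (D + F) x" for x
    proof -
      have "h * qform p D x \<le> h * (2 * u * real m * sqnorm p x)" using up h by (intro mult_left_mono) auto
      also have "\<dots> = l / 2 * sqnorm p x" using u_pos m_pos by (simp add: h_def field_simps)
      finally show ?thesis using low'[of x] by simp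
    qed
    show "qform p (D + F) x \<le> \<Lambda> * qform p D x" for x
    proof -
      have "qform p (D + F) x \<le> \<Lambda> * (l / 2 * sqnorm p x)"
        using up'[of x] l_pos by (simp add: \<Lambda>_def field_simps)
      also have "\<dots> \<le> \<Lambda> * qform p D x" using low \<Lambda> by (intro mult_left_mono) auto
      finally show ?thesis .
    qed
    show "card {i. i < p \<and> same_block C i j} \<le> m" if j: "j < p" for j
    proof -
      have "card {i. i < p \<and> same_block C i j} \<le> card {i. i < p \<and> same_block Bst i j}"
        using ref by (intro card_mono) auto
      then show ?thesis using Bst_class[OF j] by simp
    qed
    show "D $$ (i,j) = 0" if "i < p" "j < p" "\<not> same_block C i j" for i j
      using that Sc by (simp add: D_def restrict_blocks_entry)
    show "F $$ (i,j) = 0" if "i < p" "j < p" "same_block C i j" for i j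
      using that by (simp add: Fe)
    show "0 < 2 * u" using u_pos by simp
    show "\<bar>D $$ (i,j)\<bar> \<le> 2 * u" if "i < p" "j < p" for i j
      using refined_entries[OF C ref that] u_pos unfolding D_def by (auto split: if_splits)
  qed
  let ?K = "{(i,j). same_block Bst i j} - {(i,j). same_block C i j}"
  define Kb where "Kb = {(k,r) \<in> ?K. \<theta> \<le> \<bar>\<Sigma> $$ (k,r)\<bar>}"
  have finK: "finite ?K" using finite_block_pairs[OF Bst_part] by simp
  have sub: "{(i,j). same_block C i j} \<subseteq> {(i,j). same_block Bst i j}" using ref by auto
  have big: "\<exists>k r. (k,r) \<in> Kb \<and> same_block Bst k i" if ij: "(i,j) \<in> ?K" for i j
  proof -
    have bij: "same_block Bst i j" and cij: "\<not> same_block C i j" using ij by auto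
    \<comment> \<open>the refinement of the true partition that splits the block of \<open>i\<close> as \<open>C\<close> does, and no other block\<close>
    obtain B where B: "partition_on {..<p} B"
      and Bs: "\<And>a b. same_block B a b \<longleftrightarrow> same_block Bst a b \<and> (same_block Bst a i \<longrightarrow> same_block C a b)"
    proof (rule partition_from_relation[of p "\<lambda>a b. same_block Bst a b \<and> (same_block Bst a i \<longrightarrow> same_block C a b)"])
      show "a < p \<Longrightarrow> same_block Bst a a \<and> (same_block Bst a i \<longrightarrow> same_block C a a)" for a
        using same_block_refl[OF Bst_part] same_block_refl[OF C] by blast
      show "same_block Bst b a \<and> (same_block Bst b i \<longrightarrow> same_block C b a)"
        if "same_block Bst a b \<and> (same_block Bst a i \<longrightarrow> same_block C a b)" for a b
        using that same_block_sym[of Bst a b] same_block_sym[of C a b] same_block_trans[OF Bst_part, of a b i] by blast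
      show "same_block Bst a c \<and> (same_block Bst a i \<longrightarrow> same_block C a c)"
        if "same_block Bst a b \<and> (same_block Bst a i \<longrightarrow> same_block C a b)"
          "same_block Bst b c \<and> (same_block Bst b i \<longrightarrow> same_block C b c)" for a b c
        using that same_block_sym[of Bst a b] same_block_trans[OF Bst_part, of a b c]
          same_block_trans[OF Bst_part, of b a i] same_block_trans[OF C, of a b c] by blast
      show "same_block Bst a b \<and> (same_block Bst a i \<longrightarrow> same_block C a b) \<Longrightarrow> a < p \<and> b < p" for a b
        using same_block_less[OF Bst_part] by blast
    qed (rule that, blast+)
    have ii: "same_block Bst i i" using same_block_less[OF Bst_part bij] same_block_refl[OF Bst_part] by blast
    have "strictly_refines {..<p} B Bst"
      unfolding strictly_refines_def refines_iff_same_block[OF B Bst_part]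
      using Bs bij cij ii by metis
    then have "\<theta> \<le> max_norm (restrict_blocks \<Sigma> B - \<Sigma>)" by (rule separation)
    then obtain k r where kr: "k < p" "r < p" "\<theta> \<le> \<bar>(restrict_blocks \<Sigma> B - \<Sigma>) $$ (k,r)\<bar>"
      using max_norm_ge_imp_entry[of "restrict_blocks \<Sigma> B - \<Sigma>" p \<theta>] p_pos \<Sigma>c by (auto simp: minus_carrier_mat)
    have e: "(restrict_blocks \<Sigma> B - \<Sigma>) $$ (k,r) = (if same_block B k r then 0 else - \<Sigma> $$ (k,r))"
      using kr(1,2) \<Sigma>c by (simp add: restrict_blocks_entry)
    have nB: "\<not> same_block B k r" and tk: "\<theta> \<le> \<bar>\<Sigma> $$ (k,r)\<bar>"
      using kr(3) \<theta>_pos unfolding e by (auto split: if_splits)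
    have "same_block Bst k r" using \<Sigma>_cross[OF kr(1,2)] tk \<theta>_pos by force
    then show ?thesis using nB Bs tk unfolding Kb_def by blast
  qed
  have finKb: "finite Kb" by (rule finite_subset[OF _ finK]) (auto simp: Kb_def)
  have "?K \<subseteq> (\<Union>(k,r)\<in>Kb. {i. i < p \<and> same_block Bst i k} \<times> {j. j < p \<and> same_block Bst j k})"
  proof
    fix ij assume ij: "ij \<in> ?K"
    obtain i j where [simp]: "ij = (i,j)" by (cases ij)
    obtain k r where kr: "(k,r) \<in> Kb" "same_block Bst k i" using big[of i j] ij by auto
    have bij: "same_block Bst i j" using ij by auto
    then have "i < p" "j < p" using same_block_less[OF Bst_part] by auto
    moreover have "same_block Bst i k" "same_block Bst j k"
      using kr(2) bij same_block_sym same_block_trans[OF Bst_part] by blast+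
    ultimately show "ij \<in> (\<Union>(k,r)\<in>Kb. {i. i < p \<and> same_block Bst i k} \<times> {j. j < p \<and> same_block Bst j k})"
      using kr(1) by auto
  qed
  then have "card ?K \<le> card (\<Union>(k,r)\<in>Kb. {i. i < p \<and> same_block Bst i k} \<times> {j. j < p \<and> same_block Bst j k})"
    using finKb by (intro card_mono) auto
  also have "\<dots> \<le> (\<Sum>(k,r)\<in>Kb. card ({i. i < p \<and> same_block Bst i k} \<times> {j. j < p \<and> same_block Bst j k}))"
    unfolding case_prod_beta by (rule card_UN_le[OF finKb])
  also have "\<dots> \<le> (\<Sum>(k,r)\<in>Kb. m * m)"
  proof (rule sum_mono, clarify)
    fix k r assume "(k,r) \<in> Kb"
    then have "k < p" using same_block_less[OF Bst_part, of k r] by (auto simp: Kb_def)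
    then show "card ({i. i < p \<and> same_block Bst i k} \<times> {j. j < p \<and> same_block Bst j k}) \<le> m * m"
      unfolding card_cartesian_product using Bst_class by (intro mult_mono) auto
  qed
  also have "\<dots> = card Kb * (m * m)" by (simp add: case_prod_beta)
  finally have cK: "real (card ?K) \<le> real (card Kb) * (real m)\<^sup>2"
    unfolding power2_eq_square of_nat_mult[symmetric] of_nat_le_iff .
  have penK: "pen Bst - pen C = real (card ?K)"
    unfolding pen_eq_card_pairs[OF Bst_part] pen_eq_card_pairs[OF C]
    using card_mono[OF finite_block_pairs[OF Bst_part] sub]
    by (simp add: card_Diff_subset[OF finite_block_pairs[OF C] sub] of_nat_diff)
  have "real (card Kb) * (\<theta>/2)\<^sup>2 = (\<Sum>ij\<in>{..<p} \<times> {..<p}. if ij \<in> Kb then (\<theta>/2)\<^sup>2 else 0)"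
  proof -
    have "({..<p} \<times> {..<p}) \<inter> Kb = Kb" using same_block_less[OF Bst_part] by (auto simp: Kb_def)
    then show ?thesis using sum_if_mem[of "{..<p} \<times> {..<p}" Kb "(\<theta>/2)\<^sup>2"] by simp
  qed
  also have "\<dots> = (\<Sum>i<p. \<Sum>j<p. if (i,j) \<in> Kb then (\<theta>/2)\<^sup>2 else 0)"
    by (simp add: sum.cartesian_product case_prod_beta)
  also have "\<dots> \<le> frobenius_sq p F"
    unfolding frobenius_sq_def
  proof (intro sum_mono)
    fix i j assume "i \<in> {..<p}" "j \<in> {..<p}"
    then have ij: "i < p" "j < p" by auto
    show "(if (i,j) \<in> Kb then (\<theta>/2)\<^sup>2 else 0) \<le> (F $$ (i,j))\<^sup>2"
    proof (cases "(i,j) \<in> Kb")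
      case True
      then have "\<bar>\<theta>/2\<bar> \<le> \<bar>S $$ (i,j)\<bar>" using close[OF ij] \<tau>_small(2) \<theta>_pos by (auto simp: Kb_def)
      then have "(\<theta>/2)\<^sup>2 \<le> (S $$ (i,j))\<^sup>2" by (rule abs_le_square_iff[THEN iffD1])
      then show ?thesis using True by (auto simp: Fe[OF ij] Kb_def)
    qed auto
  qed
  finally have fr: "real (card Kb) * (\<theta>/2)\<^sup>2 \<le> frobenius_sq p F" .
  have "(pen Bst - pen C) * (\<theta>/2)\<^sup>2 \<le> real (card Kb) * (real m)\<^sup>2 * (\<theta>/2)\<^sup>2"
    unfolding penK using cK by (intro mult_right_mono) auto
  also have "\<dots> \<le> (real m)\<^sup>2 * frobenius_sq p F" using fr mult_left_mono[OF fr, of "(real m)\<^sup>2"] by (simp add: mult_ac)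
  finally have "(pen Bst - pen C) * (\<theta>/2)\<^sup>2 / (real m)\<^sup>2 \<le> frobenius_sq p F"
    using m_pos by (simp add: pos_divide_le_eq mult.commute)
  then have "(pen Bst - pen C) * (\<theta>/2)\<^sup>2 / (real m)\<^sup>2 / (2 * \<Lambda> * ((2 * u)\<^sup>2 * (real m)\<^sup>2)) \<le> frobenius_sq p F / (2 * \<Lambda> * ((2 * u)\<^sup>2 * (real m)\<^sup>2))"
    using \<Lambda> by (intro divide_right_mono) auto
  also have "(pen Bst - pen C) * (\<theta>/2)\<^sup>2 / (real m)\<^sup>2 / (2 * \<Lambda> * ((2 * u)\<^sup>2 * (real m)\<^sup>2)) = \<theta>\<^sup>2 * l * (pen Bst - pen C) / (128 * u^3 * (real m)^5)"
    unfolding \<Lambda>_def by (simp add: power2_eq_square power3_eq_cube eval_nat_numeral mult_ac)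
  finally show ?thesis using K unfolding DF unfolding D_def by linarith
qed

text \<open>Every competitor is compared with the true partition through their common refinement: reaching it
  discards only noise and gains penalty, and from there to the true partition the gain of likelihood outweighs the penalty.\<close>

lemma Bst_unique_minimizer:
  assumes \<kappa>: "\<kappa> = \<omega> / real p"
    and over: "(2 + 4 * ln (4 * u * real m / \<eta>)) * (4 * (real m)\<^sup>2 * \<tau>\<^sup>2 / l\<^sup>2) < \<omega>"
    and under: "\<omega> < \<theta>\<^sup>2 * l / (128 * u^3 * (real m)^5)"
    and B: "partition_on {..<p} B" "B \<noteq> Bst"
  shows "crit \<kappa> S Bst < crit \<kappa> S B"
proof -
  obtain C where C: "partition_on {..<p} C"
    and meet: "\<And>i j. same_block C i j \<longleftrightarrow> same_block B i j \<and> same_block Bst i j"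
  proof (rule partition_from_relation[of p "\<lambda>i j. same_block B i j \<and> same_block Bst i j"])
    show "i < p \<Longrightarrow> same_block B i i \<and> same_block Bst i i" for i
      using same_block_refl[OF B(1)] same_block_refl[OF Bst_part] by blast
    show "same_block B i j \<and> same_block Bst i j \<Longrightarrow> same_block B j i \<and> same_block Bst j i" for i j
      using same_block_sym by blast
    show "same_block B i j \<and> same_block Bst i j \<Longrightarrow> same_block B j k \<and> same_block Bst j k \<Longrightarrow>
      same_block B i k \<and> same_block Bst i k" for i j k
      using same_block_trans[OF B(1)] same_block_trans[OF Bst_part] by blast
    show "same_block B i j \<and> same_block Bst i j \<Longrightarrow> i < p \<and> j < p" for i j
      using same_block_less[OF B(1)] by blast
  qed (rule that, blast+)
  define f where "f B = ln (Determinant.det (restrict_blocks S B)) + \<omega> * pen B" for B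
  have crit: "crit \<kappa> S B = f B / real p + 1" if "partition_on {..<p} B" for B
    unfolding crit_eq[OF that] f_def \<kappa> by (simp add: add_divide_distrib)
  have strict: "pen C < pen A" if A: "partition_on {..<p} A" "A \<noteq> C" "\<And>i j. same_block C i j \<Longrightarrow> same_block A i j" for A
  proof -
    have "{(i,j). same_block C i j} \<subset> {(i,j). same_block A i j}"
      using A partition_eqI[OF A(1) C] by blast
    from psubset_card_mono[OF finite_block_pairs[OF A(1)] this] show ?thesis
      by (simp add: pen_eq_card_pairs[OF A(1)] pen_eq_card_pairs[OF C])
  qed
  have 1: "f C \<le> f B" "B \<noteq> C \<Longrightarrow> f C < f B"
  proof -
    note g = overfit_gain_small[OF B(1) C meet]
    show less: "f C < f B" if "B \<noteq> C"
    proof -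
      have "0 < pen B - pen C" using strict[OF B(1) that] meet by simp
      then have "(2 + 4 * ln (4 * u * real m / \<eta>)) * (4 * (real m)\<^sup>2 * \<tau>\<^sup>2 / l\<^sup>2) * (pen B - pen C) < \<omega> * (pen B - pen C)"
        using over by (intro mult_strict_right_mono)
      then show ?thesis using g unfolding f_def by (simp add: algebra_simps)
    qed
    then show "f C \<le> f B" by (cases "B = C") auto
  qed
  have 2: "f Bst \<le> f C" "Bst \<noteq> C \<Longrightarrow> f Bst < f C"
  proof -
    have ref: "\<And>i j. same_block C i j \<Longrightarrow> same_block Bst i j" using meet by blast
    note g = underfit_loss_large[OF C ref]
    show less: "f Bst < f C" if "Bst \<noteq> C"
    proof -
      have "0 < pen Bst - pen C" using strict[OF Bst_part that ref] by simp
      then have "\<omega> * (pen Bst - pen C) < \<theta>\<^sup>2 * l / (128 * u^3 * (real m)^5) * (pen Bst - pen C)"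
        using under by (intro mult_strict_right_mono)
      then show ?thesis using g unfolding f_def by (simp add: algebra_simps)
    qed
    then show "f Bst \<le> f C" by (cases "Bst = C") auto
  qed
  have "f Bst < f B" using 1 2 B(2) by (cases "B = C") auto
  then show ?thesis using crit[OF B(1)] crit[OF Bst_part] p_pos by (simp add: divide_strict_right_mono)
qed

end

section \<open>The four estimators on a concentrated sample\<close>

lemma arg_min_on_eqI:
  assumes x: "x \<in> A" and least: "\<And>y. y \<in> A \<Longrightarrow> y \<noteq> x \<Longrightarrow> f x < (f y :: real)"
  shows "arg_min_on f A = x"
  unfolding arg_min_on_def arg_min_def is_arg_min_def
proof (rule some_equality)
  show "x \<in> A \<and> (\<nexists>y. y \<in> A \<and> f y < f x)" using x least by (metis less_asym less_irrefl)
  show "y = x" if "y \<in> A \<and> (\<nexists>z. z \<in> A \<and> f z < f y)" for y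
    using that x least by blast
qed

lemma threshold_mat_entry:
  assumes "S \<in> carrier_mat p p" "i < p" "j < p"
  shows "threshold_mat t (corr_mat S) $$ (i,j) =
    (if \<bar>corr_mat S $$ (i,j)\<bar> > t then corr_mat S $$ (i,j) else 0)"
  using assms by (auto simp: threshold_mat_def corr_mat_def)

lemma threshold_mat_carrier:
  "S \<in> carrier_mat p p \<Longrightarrow> threshold_mat t (corr_mat S) \<in> carrier_mat p p"
  by (auto simp: threshold_mat_def corr_mat_def)

lemma threshold_blocks_partition:
  assumes "S \<in> carrier_mat p p" shows "partition_on {..<p} (threshold_blocks S t)"
  unfolding threshold_blocks_def by (rule finest_blocks_partition[OF threshold_mat_carrier[OF assms]])

context concentrated_sample
begin

lemma corr_entry:
  assumes "i < p" "j < p"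
  shows "corr_mat S $$ (i,j) = S $$ (i,j) / sqrt (S $$ (i,i) * S $$ (j,j))"
  using Sc assms by (auto simp: corr_mat_def)

lemma S_diag_ge: assumes i: "i < p" shows "l / 2 \<le> S $$ (i,i)"
proof -
  have "l \<le> \<Sigma> $$ (i,i)"
    using \<Sigma>_lower[of "pair_dir i i 0"] qform_pair_dir[OF \<Sigma>_sym i i, of 0] sqnorm_pair_dir[OF i i, of 0] by simp
  moreover have "1 * \<tau> \<le> real m * \<tau>" using m_pos \<tau>_nonneg by (intro mult_right_mono) auto
  ultimately show ?thesis using close[OF i i] \<tau>_small(1) by linarith
qed

lemma sqrt_diag_bounds:
  assumes i: "i < p" and j: "j < p"
  shows "l / 2 \<le> sqrt (S $$ (i,i) * S $$ (j,j))" "sqrt (S $$ (i,i) * S $$ (j,j)) \<le> 2 * u"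
proof -
  have "(l/2) * (l/2) \<le> S $$ (i,i) * S $$ (j,j)"
    using S_diag_ge[OF i] S_diag_ge[OF j] l_pos by (intro mult_mono) auto
  then have "sqrt ((l/2)\<^sup>2) \<le> sqrt (S $$ (i,i) * S $$ (j,j))" by (simp add: power2_eq_square)
  then show "l / 2 \<le> sqrt (S $$ (i,i) * S $$ (j,j))" using l_pos by simp
  have "S $$ (i,i) * S $$ (j,j) \<le> (2*u) * (2*u)"
    using S_entries[OF i i] S_entries[OF j j] S_diag_ge[OF i] S_diag_ge[OF j] l_pos u_pos by (intro mult_mono) auto
  then show "sqrt (S $$ (i,i) * S $$ (j,j)) \<le> 2 * u"
    using u_pos by (intro real_le_lsqrt) (simp_all add: power2_eq_square)
qed

lemma corr_cross_small:
  assumes i: "i < p" and j: "j < p" and "\<not> same_block Bst i j"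
  shows "\<bar>corr_mat S $$ (i,j)\<bar> \<le> 2 * \<tau> / l"
proof -
  have "\<bar>S $$ (i,j)\<bar> \<le> \<tau>" using close[OF i j] \<Sigma>_cross[OF assms] by simp
  then have "\<bar>S $$ (i,j)\<bar> / sqrt (S $$ (i,i) * S $$ (j,j)) \<le> \<tau> / (l/2)"
    using sqrt_diag_bounds(1)[OF i j] l_pos \<tau>_nonneg by (intro frac_le) auto
  then show ?thesis using sqrt_diag_bounds(1)[OF i j] l_pos by (simp add: corr_entry[OF i j] mult.commute)
qed

lemma corr_signal_large:
  assumes i: "i < p" and j: "j < p" and "\<theta> \<le> \<bar>\<Sigma> $$ (i,j)\<bar>"
  shows "\<theta> / (4 * u) \<le> \<bar>corr_mat S $$ (i,j)\<bar>"
proof -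
  have "\<theta> / 2 \<le> \<bar>S $$ (i,j)\<bar>" using close[OF i j] assms(3) \<tau>_small(2) by linarith
  then have "(\<theta> / 2) / (2 * u) \<le> \<bar>S $$ (i,j)\<bar> / sqrt (S $$ (i,i) * S $$ (j,j))"
    using sqrt_diag_bounds[OF i j] l_pos \<theta>_pos S_diag_ge[OF i] S_diag_ge[OF j]
    by (intro frac_le) (auto intro: mult_pos_pos)
  then show ?thesis using sqrt_diag_bounds(1)[OF i j] l_pos by (simp add: corr_entry[OF i j])
qed

text \<open>A threshold above the noise gives a refinement of the true partition. If it were strict, it would lose
  an entry that the threshold keeps.\<close>

lemma threshold_recovers:
  assumes noise: "\<And>i j. i < p \<Longrightarrow> j < p \<Longrightarrow> \<not> same_block Bst i j \<Longrightarrow> \<bar>corr_mat S $$ (i,j)\<bar> \<le> t"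
    and signal: "t < \<theta> / (4 * u)"
  shows "threshold_blocks S t = Bst"
  unfolding threshold_blocks_def
proof (rule finest_blocks_eqI[OF threshold_mat_carrier[OF Sc] Bst_part])
  show "same_block Bst i j" if "i < p" "j < p" "threshold_mat t (corr_mat S) $$ (i,j) \<noteq> 0" for i j
    using that noise[of i j] by (auto simp: threshold_mat_entry[OF Sc] split: if_splits)
  fix C assume C: "partition_on {..<p} C"
    "\<And>i j. i < p \<Longrightarrow> j < p \<Longrightarrow> threshold_mat t (corr_mat S) $$ (i,j) \<noteq> 0 \<Longrightarrow> same_block C i j"
    "\<And>i j. same_block C i j \<Longrightarrow> same_block Bst i j"
  show "C = Bst"
  proof (rule ccontr)
    assume "C \<noteq> Bst"
    then have "strictly_refines {..<p} C Bst"
      unfolding strictly_refines_def refines_iff_same_block[OF C(1) Bst_part] using C(3) by blast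
    then have "\<theta> \<le> max_norm (restrict_blocks \<Sigma> C - \<Sigma>)" by (rule separation)
    then obtain k r where kr: "k < p" "r < p" "\<theta> \<le> \<bar>(restrict_blocks \<Sigma> C - \<Sigma>) $$ (k,r)\<bar>"
      using max_norm_ge_imp_entry[of "restrict_blocks \<Sigma> C - \<Sigma>" p \<theta>] p_pos \<Sigma>c by (auto simp: minus_carrier_mat)
    have e: "(restrict_blocks \<Sigma> C - \<Sigma>) $$ (k,r) = (if same_block C k r then 0 else - \<Sigma> $$ (k,r))"
      using kr(1,2) \<Sigma>c by (simp add: restrict_blocks_entry)
    have nC: "\<not> same_block C k r" and tk: "\<theta> \<le> \<bar>\<Sigma> $$ (k,r)\<bar>"
      using kr(3) \<theta>_pos unfolding e by (auto split: if_splits)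
    have big: "\<theta> / (4 * u) \<le> \<bar>corr_mat S $$ (k,r)\<bar>" by (rule corr_signal_large[OF kr(1,2) tk])
    moreover have "0 < \<theta> / (4 * u)" using \<theta>_pos u_pos by simp
    ultimately have "threshold_mat t (corr_mat S) $$ (k,r) \<noteq> 0"
      using signal by (auto simp: threshold_mat_entry[OF Sc kr(1,2)])
    then show False using C(2)[OF kr(1,2)] nC by blast
  qed
qed

lemma threshold_window:
  assumes "2 * \<tau> / l \<le> t" "t < \<theta> / (4 * u)"
  shows "threshold_blocks S t = Bst"
  using corr_cross_small assms(1) by (intro threshold_recovers[OF _ assms(2)]) (meson order.trans)

lemma B_thr_recovers:
  assumes "2 * \<tau> / l \<le> real n powr (-1/3)" "real n powr (-1/3) < \<theta> / (4 * u)"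
  shows "B_thr n S = Bst"
  unfolding B_thr_def by (rule threshold_window[OF assms])

lemma arg_min_candidates:
  assumes uniq: "\<And>B. partition_on {..<p} B \<Longrightarrow> B \<noteq> Bst \<Longrightarrow> crit \<kappa> S Bst < crit \<kappa> S B"
    and "Bst \<in> A" "\<And>B. B \<in> A \<Longrightarrow> partition_on {..<p} B"
  shows "arg_min_on (crit \<kappa> S) A = Bst"
  using assms by (intro arg_min_on_eqI) auto

lemma B_tot_recovers:
  assumes uniq: "\<And>B. partition_on {..<p} B \<Longrightarrow> B \<noteq> Bst \<Longrightarrow> crit \<kappa> S Bst < crit \<kappa> S B"
  shows "B_tot \<kappa> S = Bst"
  unfolding B_tot_def using Sc Bst_part by (intro arg_min_candidates[OF uniq]) auto

text \<open>The largest correlation across blocks is a candidate level, and it lies in the window between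
  noise and signal. There is a pair across blocks since \<open>p\<close> exceeds the block size.\<close>

lemma B_corr_recovers:
  assumes uniq: "\<And>B. partition_on {..<p} B \<Longrightarrow> B \<noteq> Bst \<Longrightarrow> crit \<kappa> S Bst < crit \<kappa> S B"
    and m: "m < p" and window: "2 * \<tau> / l < \<theta> / (4 * u)"
  shows "B_corr \<kappa> S = Bst"
proof -
  define X where "X = {(i,j). i < j \<and> j < p \<and> \<not> same_block Bst i j}"
  have fin: "finite X" by (rule finite_subset[of _ "{..<p} \<times> {..<p}"]) (auto simp: X_def)
  have "X \<noteq> {}"
  proof
    assume "X = {}"
    then have all: "same_block Bst i 0" if "i < p" for i
      using that same_block_refl[OF Bst_part] same_block_sym[of Bst i 0] p_pos by (cases "i = 0") (auto simp: X_def)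
    have "card {i. i < p \<and> same_block Bst i 0} = p" using all by (simp add: Collect_conj_eq cong: conj_cong)
    then show False using Bst_class[OF p_pos] m by simp
  qed
  define t where "t = Max ((\<lambda>(i,j). \<bar>corr_mat S $$ (i,j)\<bar>) ` X)"
  have "t \<in> (\<lambda>(i,j). \<bar>corr_mat S $$ (i,j)\<bar>) ` X"
    unfolding t_def using fin \<open>X \<noteq> {}\<close> by (intro Max_in) auto
  then obtain i j where ij: "i < j" "j < p" "\<not> same_block Bst i j" "t = \<bar>corr_mat S $$ (i,j)\<bar>"
    by (auto simp: X_def)
  have level: "t \<in> corr_levels S" using ij Sc unfolding corr_levels_def by auto
  have "t \<le> 2 * \<tau> / l" unfolding ij(4) using ij by (intro corr_cross_small) auto
  then have sig: "t < \<theta> / (4 * u)" using window by simp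
  have "threshold_blocks S t = Bst"
  proof (rule threshold_recovers[OF _ sig])
    fix a b assume ab: "a < p" "b < p" "\<not> same_block Bst a b"
    have sym: "\<bar>corr_mat S $$ (a,b)\<bar> = \<bar>corr_mat S $$ (b,a)\<bar>"
      using S_sym ab by (simp add: corr_entry sym_mat_def mult.commute)
    have "(min a b, max a b) \<in> X"
      using ab same_block_refl[OF Bst_part] same_block_sym[of Bst a b] by (cases "a = b") (auto simp: X_def min_def max_def)
    then have "\<bar>corr_mat S $$ (min a b, max a b)\<bar> \<le> t"
      unfolding t_def using fin by (intro Max_ge) force+
    then show "\<bar>corr_mat S $$ (a,b)\<bar> \<le> t" using sym by (auto simp: min_def max_def split: if_splits)
  qed
  then have "Bst \<in> threshold_blocks S ` corr_levels S" using level by blast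
  then show ?thesis unfolding B_corr_def
    using threshold_blocks_partition[OF Sc] by (intro arg_min_candidates uniq) auto
qed

text \<open>The mesh \<open>1/p\<close> is finer than the window between noise and signal, so a grid level lies in it. The
  blocks found there have at most \<open>m\<close> elements, hence the grid starts no later.\<close>

lemma B_grid_recovers:
  assumes uniq: "\<And>B. partition_on {..<p} B \<Longrightarrow> B \<noteq> Bst \<Longrightarrow> crit \<kappa> S Bst < crit \<kappa> S B"
    and window: "2 * \<tau> / l + 1 / real p < \<theta> / (4 * u)" "\<theta> / (4 * u) \<le> 1"
  shows "B_grid m \<kappa> S = Bst"
proof -
  \<comment> \<open>the first grid level above the noise\<close>
  define k where "k = nat \<lceil>2 * \<tau> / l * real p\<rceil>"
  have nn: "0 \<le> 2 * \<tau> / l * real p" using \<tau>_nonneg l_pos by simp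
  then have k: "2 * \<tau> / l * real p \<le> real k" "real k < 2 * \<tau> / l * real p + 1"
    unfolding k_def by linarith+
  have k1: "2 * \<tau> / l \<le> real k / real p" using k(1) p_pos by (simp add: pos_le_divide_eq)
  have "real k / real p < (2 * \<tau> / l * real p + 1) / real p" using k(2) p_pos by (intro divide_strict_right_mono) auto
  also have "\<dots> = 2 * \<tau> / l + 1 / real p" using p_pos by (simp add: add_divide_distrib)
  finally have k2: "real k / real p < \<theta> / (4 * u)" using window by simp
  then have "real k / real p \<le> 1" using window by simp
  then have kp: "k \<le> p" using p_pos by simp
  have rec: "threshold_blocks S (real k / real p) = Bst" by (rule threshold_window[OF k1 k2])
  have "grid_start m S \<le> k"
    unfolding grid_start_def using rec block_card Sc by (intro Least_le) auto
  then have "Bst \<in> threshold_blocks S ` grid_levels m S"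
    using rec kp Sc unfolding grid_levels_def by (intro image_eqI[of _ _ "real k / real p"]) auto
  then show ?thesis unfolding B_grid_def
    using threshold_blocks_partition[OF Sc] by (intro arg_min_candidates uniq) auto
qed

end

section \<open>Measurability of the estimators\<close>

lemma measurable_det:
  assumes A: "\<And>\<omega>. A \<omega> \<in> carrier_mat p p"
    and [measurable]: "\<And>i j. i < p \<Longrightarrow> j < p \<Longrightarrow> (\<lambda>\<omega>. A \<omega> $$ (i,j)) \<in> borel_measurable M"
  shows "(\<lambda>\<omega>. Determinant.det (A \<omega>) :: real) \<in> borel_measurable M"
proof -
  have "(\<lambda>\<omega>. \<Prod>i = 0..<p. A \<omega> $$ (i, q i)) \<in> borel_measurable M" if q: "q permutes {0..<p}" for q
    using permutes_in_image[OF q] by (intro borel_measurable_prod assms(2)) auto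
  then show ?thesis
    unfolding det_def'[OF A] by (intro borel_measurable_sum borel_measurable_times) auto
qed

lemma finest_blocks_eq_iff:
  assumes \<Gamma>: "\<Gamma> \<in> carrier_mat p p"
  shows "finest_blocks \<Gamma> = B \<longleftrightarrow> partition_on {..<p} B \<and>
    (\<forall>i\<in>{..<p}. \<forall>j\<in>{..<p}. \<Gamma> $$ (i,j) \<noteq> 0 \<longrightarrow> same_block B i j) \<and>
    (\<forall>C\<in>{C. partition_on {..<p} C}. (\<forall>i\<in>{..<p}. \<forall>j\<in>{..<p}. \<Gamma> $$ (i,j) \<noteq> 0 \<longrightarrow> same_block C i j) \<longrightarrow> refines {..<p} B C)"
    (is "?l \<longleftrightarrow> ?r")
proof
  assume ?l
  then have B: "finest_blocks \<Gamma> = B" .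
  note P = finest_blocks_partition[OF \<Gamma>, unfolded B]
  show ?r
  proof (intro conjI ballI impI P)
    show "same_block B i j" if "i \<in> {..<p}" "j \<in> {..<p}" "\<Gamma> $$ (i,j) \<noteq> 0" for i j
      using finest_blocks_support[OF \<Gamma>, unfolded B, of i j] that by simp
    fix C assume C: "C \<in> {C. partition_on {..<p} C}" "\<forall>i\<in>{..<p}. \<forall>j\<in>{..<p}. \<Gamma> $$ (i,j) \<noteq> 0 \<longrightarrow> same_block C i j"
    then have part: "partition_on {..<p} C" by simp
    show "refines {..<p} B C"
      unfolding refines_iff_same_block[OF P part]
      using finest_blocks_least[OF \<Gamma> part, unfolded B] C(2) by simp
  qed
next
  assume r: ?r
  show ?l
  proof (rule finest_blocks_eqI[OF \<Gamma>])
    show B: "partition_on {..<p} B" using r by blast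
    show "same_block B i j" if "i < p" "j < p" "\<Gamma> $$ (i,j) \<noteq> 0" for i j using r that by simp
    fix C assume C: "partition_on {..<p} C" "\<And>i j. i < p \<Longrightarrow> j < p \<Longrightarrow> \<Gamma> $$ (i,j) \<noteq> 0 \<Longrightarrow> same_block C i j"
      "\<And>i j. same_block C i j \<Longrightarrow> same_block B i j"
    then have "refines {..<p} B C" using r by simp
    moreover have "refines {..<p} C B" unfolding refines_iff_same_block[OF C(1) B] using C(3) by blast
    ultimately show "C = B" using refines_asym by blast
  qed
qed

lemma finite_partitions: "finite {C. partition_on {..<p::nat} C}"
  by (rule finitely_many_partition_on) simp

lemma pred_finest_blocks:
  assumes A: "\<And>\<omega>. A \<omega> \<in> carrier_mat p p"
    and [measurable]: "\<And>i j. i \<in> {..<p} \<Longrightarrow> j \<in> {..<p} \<Longrightarrow> Measurable.pred M (\<lambda>\<omega>. A \<omega> $$ (i,j) \<noteq> 0)"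
  shows "Measurable.pred M (\<lambda>\<omega>. finest_blocks (A \<omega>) = B)"
  unfolding finest_blocks_eq_iff[OF A]
  by (intro pred_intros_logic pred_intros_finite finite_partitions finite_lessThan assms(2)) auto

lemma measurable_finest_blocks_comp:
  assumes A: "\<And>\<omega>. A \<omega> \<in> carrier_mat p p"
    and "\<And>i j. i \<in> {..<p} \<Longrightarrow> j \<in> {..<p} \<Longrightarrow> Measurable.pred M (\<lambda>\<omega>. A \<omega> $$ (i,j) \<noteq> 0)"
  shows "(\<lambda>\<omega>. f (finest_blocks (A \<omega>)) :: real) \<in> borel_measurable M"
proof -
  have "f (finest_blocks (A \<omega>)) = (\<Sum>C\<in>{C. partition_on {..<p} C}. if finest_blocks (A \<omega>) = C then f C else 0)" for \<omega>
    using finest_blocks_partition[OF A[of \<omega>]] finite_partitions by simp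
  moreover have "(\<lambda>\<omega>. if finest_blocks (A \<omega>) = C then f C else 0) \<in> borel_measurable M" for C
    by (intro measurable_If pred_finest_blocks[OF assms, unfolded pred_def]) (simp_all add: assms[unfolded pred_def])
  ultimately show ?thesis by (simp only: borel_measurable_sum)
qed

text \<open>A minimizer picked by \<open>arg_min_on\<close> is a function of the set of minimizers, which takes
  finitely many values. So the arbitrary choice does not harm measurability.\<close>

lemma pred_arg_min_on:
  fixes f :: "'w \<Rightarrow> 'b \<Rightarrow> real"
  assumes fin: "finite P" and sub: "\<And>\<omega>. A \<omega> \<subseteq> P"
    and A[measurable]: "\<And>x. x \<in> P \<Longrightarrow> Measurable.pred M (\<lambda>\<omega>. x \<in> A \<omega>)"
    and f[measurable]: "\<And>x. x \<in> P \<Longrightarrow> (\<lambda>\<omega>. f \<omega> x) \<in> borel_measurable M"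
  shows "Measurable.pred M (\<lambda>\<omega>. arg_min_on (f \<omega>) (A \<omega>) = b)"
proof -
  define T where "T \<omega> = {x\<in>P. x \<in> A \<omega> \<and> (\<forall>y\<in>P. y \<in> A \<omega> \<longrightarrow> \<not> f \<omega> y < f \<omega> x)}" for \<omega>
  have eq: "arg_min_on (f \<omega>) (A \<omega>) = (SOME x. x \<in> T \<omega>)" for \<omega>
    unfolding arg_min_on_def arg_min_def is_arg_min_def T_def
    by (rule arg_cong[where f = Eps], rule ext) (use sub[of \<omega>] in auto)
  have mem: "Measurable.pred M (\<lambda>\<omega>. x \<in> T \<omega>)" if [measurable]: "x \<in> P" for x
  proof -
    have "Measurable.pred M (\<lambda>\<omega>. f \<omega> y < f \<omega> x)" if "y \<in> P" for y
      using f[OF that] f[OF \<open>x \<in> P\<close>] by measurable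
    then show ?thesis
      unfolding T_def mem_Collect_eq
      by (intro pred_intros_logic pred_intros_finite fin A) (use \<open>x \<in> P\<close> in auto)
  qed
  have "(SOME x. x \<in> T \<omega>) = b \<longleftrightarrow> (\<exists>U\<in>{U\<in>Pow P. (SOME x. x \<in> U) = b}. \<forall>x\<in>P. x \<in> T \<omega> \<longleftrightarrow> x \<in> U)" (is "?l = ?r") for \<omega>
  proof
    assume ?l
    then show ?r by (intro bexI[of _ "T \<omega>"]) (auto simp: T_def)
  next
    assume ?r
    then obtain U where U: "U \<subseteq> P" "(SOME x. x \<in> U) = b" "\<forall>x\<in>P. x \<in> T \<omega> \<longleftrightarrow> x \<in> U" by blast
    then have "T \<omega> = U" by (auto simp: T_def)
    then show ?l using U by simp
  qed
  then show ?thesis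
    unfolding eq by (simp only:) (intro pred_intros_logic pred_intros_finite mem fin, auto simp: fin)
qed

context
  fixes M :: "'a measure" and p :: nat and S :: "'a \<Rightarrow> real Matrix.mat"
  assumes S: "\<And>\<omega>. S \<omega> \<in> carrier_mat p p"
    and S_meas: "\<And>i j. i < p \<Longrightarrow> j < p \<Longrightarrow> (\<lambda>\<omega>. S \<omega> $$ (i,j)) \<in> borel_measurable M"
begin

lemma restrict_entry_measurable:
  assumes "i < p" "j < p"
  shows "(\<lambda>\<omega>. restrict_blocks (S \<omega>) B $$ (i,j)) \<in> borel_measurable M"
  using S_meas[OF assms] by (cases "same_block B i j") (auto simp: restrict_blocks_entry[OF S assms])

lemma crit_measurable:
  assumes B: "partition_on {..<p} B"
  shows "(\<lambda>\<omega>. crit \<kappa> (S \<omega>) B) \<in> borel_measurable M"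
proof -
  have [measurable]: "(\<lambda>\<omega>. Determinant.det (restrict_blocks (S \<omega>) B)) \<in> borel_measurable M"
    using S by (intro measurable_det[of _ p] restrict_entry_measurable) auto
  have [measurable]: "(\<lambda>\<omega>. pen (finest_blocks (restrict_blocks (S \<omega>) B))) \<in> borel_measurable M"
  proof (rule measurable_finest_blocks_comp[of _ p])
    show "restrict_blocks (S \<omega>) B \<in> carrier_mat p p" for \<omega> using S by simp
    fix i j assume "i \<in> {..<p}" "j \<in> {..<p}"
    then have [measurable]: "(\<lambda>\<omega>. restrict_blocks (S \<omega>) B $$ (i,j)) \<in> borel_measurable M"
      by (intro restrict_entry_measurable) auto
    show "Measurable.pred M (\<lambda>\<omega>. restrict_blocks (S \<omega>) B $$ (i,j) \<noteq> 0)" by measurable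
  qed
  show ?thesis unfolding crit_def crit_mat_def neg_loglik_restrict[OF S B] by measurable
qed

lemma corr_measurable:
  assumes "i < p" "j < p"
  shows "(\<lambda>\<omega>. corr_mat (S \<omega>) $$ (i,j)) \<in> borel_measurable M"
proof -
  have "corr_mat (S \<omega>) $$ (i,j) = S \<omega> $$ (i,j) / sqrt (S \<omega> $$ (i,i) * S \<omega> $$ (j,j))" for \<omega>
    using S[of \<omega>] assms by (auto simp: corr_mat_def)
  then show ?thesis using S_meas[OF assms] S_meas[OF assms(1,1)] S_meas[OF assms(2,2)] by simp
qed

lemma threshold_blocks_pred:
  assumes t[measurable]: "t \<in> borel_measurable M"
  shows "Measurable.pred M (\<lambda>\<omega>. threshold_blocks (S \<omega>) (t \<omega>) = B)"
  unfolding threshold_blocks_def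
proof (rule pred_finest_blocks[of _ p])
  show "threshold_mat (t \<omega>) (corr_mat (S \<omega>)) \<in> carrier_mat p p" for \<omega> by (rule threshold_mat_carrier[OF S])
  fix i j assume "i \<in> {..<p}" "j \<in> {..<p}"
  then have ij: "i < p" "j < p" by auto
  note [measurable] = corr_measurable[OF ij]
  show "Measurable.pred M (\<lambda>\<omega>. threshold_mat (t \<omega>) (corr_mat (S \<omega>)) $$ (i,j) \<noteq> 0)"
    unfolding threshold_mat_entry[OF S ij] by measurable
qed

lemma dim_S: "dim_row (S \<omega>) = p" using S[of \<omega>] by auto

lemma B_thr_pred: "Measurable.pred M (\<lambda>\<omega>. B_thr n (S \<omega>) = B)"
  unfolding B_thr_def by (rule threshold_blocks_pred) simp

lemma B_tot_pred: "Measurable.pred M (\<lambda>\<omega>. B_tot \<kappa> (S \<omega>) = B)"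
  unfolding B_tot_def dim_S
  by (rule pred_arg_min_on[OF finite_partitions]) (auto intro: crit_measurable)

lemma B_corr_pred: "Measurable.pred M (\<lambda>\<omega>. B_corr \<kappa> (S \<omega>) = B)"
  unfolding B_corr_def
proof (rule pred_arg_min_on[OF finite_partitions])
  show "threshold_blocks (S \<omega>) ` corr_levels (S \<omega>) \<subseteq> {C. partition_on {..<p} C}" for \<omega>
    using threshold_blocks_partition[OF S] by auto
  fix C
  have eq: "C \<in> threshold_blocks (S \<omega>) ` corr_levels (S \<omega>) \<longleftrightarrow>
      (\<exists>ij\<in>{(i,j). i < j \<and> j < p}. threshold_blocks (S \<omega>) \<bar>corr_mat (S \<omega>) $$ ij\<bar> = C)" for \<omega>
    unfolding corr_levels_def dim_S by auto
  have "finite {(i,j). i < j \<and> j < p}"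
    by (rule finite_subset[of _ "{..<p} \<times> {..<p}"]) auto
  moreover have "Measurable.pred M (\<lambda>\<omega>. threshold_blocks (S \<omega>) \<bar>corr_mat (S \<omega>) $$ ij\<bar> = C)"
    if "ij \<in> {(i,j). i < j \<and> j < p}" for ij
    using that corr_measurable[of "fst ij" "snd ij"] by (intro threshold_blocks_pred) auto
  ultimately show "Measurable.pred M (\<lambda>\<omega>. C \<in> threshold_blocks (S \<omega>) ` corr_levels (S \<omega>))"
    unfolding eq by (intro pred_intros_finite)
qed (auto intro: crit_measurable)

lemma grid_start_measurable: "(\<lambda>\<omega>. grid_start m (S \<omega>)) \<in> measurable M (count_space UNIV)"
  unfolding grid_start_def dim_S
proof (rule measurable_Least)
  fix s :: nat
  have "(\<forall>G\<in>threshold_blocks (S \<omega>) (real s / real p). card G \<le> m) \<longleftrightarrow>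
    (\<exists>C\<in>{C. partition_on {..<p} C \<and> (\<forall>G\<in>C. card G \<le> m)}. threshold_blocks (S \<omega>) (real s / real p) = C)" for \<omega>
    using threshold_blocks_partition[OF S] by auto
  moreover have "finite {C. partition_on {..<p} C \<and> (\<forall>G\<in>C. card G \<le> m)}"
    by (rule finite_subset[OF _ finite_partitions]) auto
  ultimately show "Measurable.pred M (\<lambda>\<omega>. \<forall>G\<in>threshold_blocks (S \<omega>) (real s / real p). card G \<le> m)"
    by (simp only:) (intro pred_intros_finite threshold_blocks_pred, auto)
qed

lemma B_grid_pred: "Measurable.pred M (\<lambda>\<omega>. B_grid m \<kappa> (S \<omega>) = B)"
  unfolding B_grid_def
proof (rule pred_arg_min_on[OF finite_partitions])
  show "threshold_blocks (S \<omega>) ` grid_levels m (S \<omega>) \<subseteq> {C. partition_on {..<p} C}" for \<omega>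
    using threshold_blocks_partition[OF S] by auto
  fix C
  have eq: "C \<in> threshold_blocks (S \<omega>) ` grid_levels m (S \<omega>) \<longleftrightarrow>
      (\<exists>k\<in>{..p}. grid_start m (S \<omega>) \<le> k \<and> threshold_blocks (S \<omega>) (real k / real p) = C)" for \<omega>
    unfolding grid_levels_def dim_S image_image by auto
  have "Measurable.pred M (\<lambda>\<omega>. grid_start m (S \<omega>) \<le> k)" for k
    using grid_start_measurable[of m] by measurable
  then show "Measurable.pred M (\<lambda>\<omega>. C \<in> threshold_blocks (S \<omega>) ` grid_levels m (S \<omega>))"
    unfolding eq by (intro pred_intros_finite pred_intros_logic threshold_blocks_pred) auto
qed (auto intro: crit_measurable)

end

section \<open>Linear forms of a Gaussian vector\<close>

lemma inv_mat_inverse: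
  assumes A: "A \<in> carrier_mat p p" and nz: "Determinant.det A \<noteq> 0"
  shows "inv_mat A \<in> carrier_mat p p" "A * inv_mat A = 1\<^sub>m p" "inv_mat A * A = 1\<^sub>m p"
proof -
  have "A \<in> Units (ring_mat TYPE(real) p ())" by (rule det_non_zero_imp_unit[OF A nz])
  then obtain P where P: "mat_inverse A = Some P" using mat_inverse(1)[OF A, of "()"] by (cases "mat_inverse A") auto
  then show "inv_mat A \<in> carrier_mat p p" "A * inv_mat A = 1\<^sub>m p" "inv_mat A * A = 1\<^sub>m p"
    using mat_inverse(2)[OF A P] by (auto simp: inv_mat_def)
qed

lemma scalar_prod_qform:
  assumes "A \<in> carrier_mat p p" "v \<in> carrier_vec p"
  shows "scalar_prod v (A *\<^sub>v v) = qform p A (\<lambda>i. v $ i)"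
proof -
  have "scalar_prod v (A *\<^sub>v v) = (\<Sum>i<p. v $ i * (A *\<^sub>v v) $ i)"
    using assms by (simp add: scalar_prod_def lessThan_atLeast0)
  also have "\<dots> = (\<Sum>i<p. v $ i * (\<Sum>j<p. A $$ (i,j) * v $ j))"
    by (intro sum.cong refl) (simp add: mult_mat_vec_entry[OF assms] del: index_mult_mat_vec)
  finally show ?thesis by (simp add: qform_rows)
qed

interpretation lborel_product: product_sigma_finite "\<lambda>_::nat. lborel :: real measure" ..

lemma sigma_finite_lborel_vec: "sigma_finite_measure (lborel_vec p)"
  by (rule lborel_product.sigma_finite) simp

lemma emeasure_lborel_translate:
  assumes "A \<in> sets (lborel :: real measure)"
  shows "emeasure lborel {x. x + c \<in> A} = emeasure lborel A"
proof -
  have "emeasure lborel A = emeasure (distr lborel borel ((+) c)) A" by (simp add: lborel_distr_plus)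
  also have "\<dots> = emeasure lborel {x. x + c \<in> A}"
    using assms by (subst emeasure_distr) (auto simp: vimage_def add.commute)
  finally show ?thesis ..
qed

text \<open>The law of a linear form of a Gaussian vector is derived from translation invariance, in place of a
  linear change of variables.\<close>

lemma lborel_vec_translate:
  "distr (lborel_vec p) (lborel_vec p) (\<lambda>x. \<lambda>i\<in>{..<p}. x i + c i) = lborel_vec p"
proof (rule lborel_product.PiM_eqI)
  let ?T = "\<lambda>x::nat \<Rightarrow> real. \<lambda>i\<in>{..<p}. x i + c i"
  have T: "?T \<in> measurable (lborel_vec p) (lborel_vec p)"
    by (intro measurable_restrict) (simp add: measurable_lborel2)
  fix A :: "nat \<Rightarrow> real set" assume A: "\<And>i. i \<in> {..<p} \<Longrightarrow> A i \<in> sets lborel"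
  have A': "{x. x + c i \<in> A i} \<in> sets lborel" if "i \<in> {..<p}" for i
  proof -
    have "(\<lambda>x. x + c i) -` A i \<inter> space lborel \<in> sets lborel"
      using A[OF that] by (intro measurable_sets[of _ lborel lborel]) auto
    then show ?thesis by (simp add: vimage_def)
  qed
  have "emeasure (distr (lborel_vec p) (lborel_vec p) ?T) (Pi\<^sub>E {..<p} A)
      = emeasure (lborel_vec p) (?T -` (Pi\<^sub>E {..<p} A) \<inter> space (lborel_vec p))"
    using A by (intro emeasure_distr T sets_PiM_I_finite) auto
  also have "?T -` (Pi\<^sub>E {..<p} A) \<inter> space (lborel_vec p) = Pi\<^sub>E {..<p} (\<lambda>i. {x. x + c i \<in> A i})"
    by (auto simp: space_PiM PiE_def Pi_def)
  also have "emeasure (lborel_vec p) \<dots> = (\<Prod>i<p. emeasure lborel {x. x + c i \<in> A i})"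
    using A' by (intro lborel_product.emeasure_PiM) auto
  also have "\<dots> = (\<Prod>i<p. emeasure lborel (A i))"
    using A by (intro prod.cong refl emeasure_lborel_translate) auto
  finally show "emeasure (distr (lborel_vec p) (lborel_vec p) ?T) (Pi\<^sub>E {..<p} A) = (\<Prod>i<p. emeasure lborel (A i))" .
qed simp_all

lemma component_measurable: "i < p \<Longrightarrow> (\<lambda>x. x i) \<in> borel_measurable (lborel_vec p)"
  using measurable_component_singleton[of i "{..<p}" "\<lambda>_. lborel :: real measure"] by simp

definition centered_form :: "nat \<Rightarrow> real Matrix.vec \<Rightarrow> (nat \<Rightarrow> real) \<Rightarrow> (nat \<Rightarrow> real) \<Rightarrow> real" where
  "centered_form p \<mu> w x = (\<Sum>i<p. w i * (x i - \<mu> $ i))"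

lemma centered_form_measurable [measurable]:
  "centered_form p \<mu> w \<in> borel_measurable (lborel_vec p)"
  unfolding centered_form_def
  by (intro borel_measurable_sum borel_measurable_times borel_measurable_diff component_measurable) auto

context
  fixes p :: nat and \<mu> :: "real Matrix.vec" and \<Sigma> :: "real Matrix.mat"
    and l :: real
  assumes \<mu>: "\<mu> \<in> carrier_vec p" and \<Sigma>: "sym_mat p \<Sigma>"
    and l: "0 < l" "\<And>x. l * sqnorm p x \<le> qform p \<Sigma> x"
begin

lemma covariance_pos_def: "pos_def p \<Sigma>" by (rule qform_ge_imp_pos_def[OF l])

lemma covariance_carrier: "\<Sigma> \<in> carrier_mat p p" using \<Sigma> by (simp add: sym_mat_def)

lemma gaussian_density_qform:
  "gaussian_density p \<mu> \<Sigma> x =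
    exp (- qform p (inv_mat \<Sigma>) (\<lambda>i. x i - \<mu> $ i) / 2) / sqrt ((2 * pi) ^ p * Determinant.det \<Sigma>)"
proof -
  have "scalar_prod (Matrix.vec p x - \<mu>) (inv_mat \<Sigma> *\<^sub>v (Matrix.vec p x - \<mu>)) =
      qform p (inv_mat \<Sigma>) (\<lambda>i. (Matrix.vec p x - \<mu>) $ i)"
    using \<mu> inv_mat_inverse(1)[OF covariance_carrier pos_def_det_nonzero[OF covariance_carrier covariance_pos_def]]
    by (intro scalar_prod_qform) auto
  also have "\<dots> = qform p (inv_mat \<Sigma>) (\<lambda>i. x i - \<mu> $ i)"
    unfolding qform_def using \<mu> by (intro sum.cong refl) auto
  finally show ?thesis by (simp add: gaussian_density_def Let_def)
qed

lemma gaussian_density_measurable: "gaussian_density p \<mu> \<Sigma> \<in> borel_measurable (lborel_vec p)"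
proof -
  have "(\<lambda>x. qform p (inv_mat \<Sigma>) (\<lambda>i. x i - \<mu> $ i)) \<in> borel_measurable (lborel_vec p)"
    unfolding qform_def
    by (intro borel_measurable_sum borel_measurable_times borel_measurable_diff component_measurable) auto
  then show ?thesis unfolding gaussian_density_qform[abs_def] by simp
qed

lemma gaussian_density_nonneg: "0 \<le> gaussian_density p \<mu> \<Sigma> x"
  using qform_ge_imp_det_pos[OF \<Sigma> l] by (simp add: gaussian_density_qform)

text \<open>Completing the square. The translation by \<open>s \<Sigma> w\<close> multiplies the density by the exponential of a
  multiple of the linear form with coefficients \<open>w\<close>.\<close>

lemma gaussian_density_shift:
  fixes w :: "nat \<Rightarrow> real" and s :: real
  defines "h \<equiv> \<lambda>i. \<Sum>j<p. \<Sigma> $$ (i,j) * w j"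
  shows "gaussian_density p \<mu> \<Sigma> (\<lambda>i\<in>{..<p}. x i + s * h i)
      * exp (s * centered_form p \<mu> w x + s\<^sup>2 * qform p \<Sigma> w / 2) = gaussian_density p \<mu> \<Sigma> x"
proof -
  define Q where "Q = inv_mat \<Sigma>"
  have Qc: "Q \<in> carrier_mat p p" and SQ: "\<Sigma> * Q = 1\<^sub>m p" and QS: "Q * \<Sigma> = 1\<^sub>m p"
    using inv_mat_inverse[OF covariance_carrier pos_def_det_nonzero[OF covariance_carrier covariance_pos_def]] by (auto simp: Q_def)
  define v where "v i = x i - \<mu> $ i" for i
  have Qh: "(\<Sum>j<p. Q $$ (i,j) * h j) = w i" if i: "i < p" for i
  proof -
    have "(\<Sum>j<p. Q $$ (i,j) * h j) = (\<Sum>k<p. (\<Sum>j<p. Q $$ (i,j) * \<Sigma> $$ (j,k)) * w k)"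
      unfolding h_def sum_distrib_left sum_distrib_right by (subst sum.swap) (simp add: mult.assoc)
    also have "\<dots> = (\<Sum>k<p. if k = i then w i else 0)"
    proof (rule sum.cong[OF refl])
      fix k assume "k \<in> {..<p}"
      then have "(\<Sum>j<p. Q $$ (i,j) * \<Sigma> $$ (j,k)) = (if k = i then 1 else 0)"
        using mat_mult_entry[OF Qc covariance_carrier i, of k] QS i by auto
      then show "(\<Sum>j<p. Q $$ (i,j) * \<Sigma> $$ (j,k)) * w k = (if k = i then w i else 0)" by simp
    qed
    finally show ?thesis using i by simp
  qed
  have hQ: "(\<Sum>i<p. Q $$ (i,j) * h i) = w j" if j: "j < p" for j
  proof -
    have "(\<Sum>i<p. Q $$ (i,j) * h i) = (\<Sum>k<p. (\<Sum>i<p. \<Sigma> $$ (k,i) * Q $$ (i,j)) * w k)"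
      unfolding h_def sum_distrib_left sum_distrib_right
      by (subst sum.swap) (use \<Sigma> in \<open>auto simp: sym_mat_def mult_ac intro!: sum.cong\<close>)
    also have "\<dots> = (\<Sum>k<p. if k = j then w j else 0)"
    proof (rule sum.cong[OF refl])
      fix k assume "k \<in> {..<p}"
      then have "(\<Sum>i<p. \<Sigma> $$ (k,i) * Q $$ (i,j)) = (if k = j then 1 else 0)"
        using mat_mult_entry[OF covariance_carrier Qc _ j, of k] SQ j by auto
      then show "(\<Sum>i<p. \<Sigma> $$ (k,i) * Q $$ (i,j)) * w k = (if k = j then w j else 0)" by simp
    qed
    finally show ?thesis using j by simp
  qed
  have "qform p Q (\<lambda>i. v i + s * h i) =
      qform p Q v + s * (\<Sum>i<p. \<Sum>j<p. v i * (Q $$ (i,j) * h j)) + s * (\<Sum>i<p. \<Sum>j<p. (Q $$ (i,j) * h i) * v j)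
      + s\<^sup>2 * (\<Sum>i<p. \<Sum>j<p. h i * (Q $$ (i,j) * h j))"
    unfolding qform_def sum_distrib_left sum.distrib[symmetric]
    by (intro sum.cong refl) (simp add: algebra_simps power2_eq_square)
  also have "(\<Sum>i<p. \<Sum>j<p. v i * (Q $$ (i,j) * h j)) = centered_form p \<mu> w x"
    unfolding sum_distrib_left[symmetric] centered_form_def by (intro sum.cong refl) (simp add: Qh v_def)
  also have "(\<Sum>i<p. \<Sum>j<p. (Q $$ (i,j) * h i) * v j) = centered_form p \<mu> w x"
    by (subst sum.swap, unfold sum_distrib_right[symmetric] centered_form_def) (intro sum.cong refl, simp add: hQ v_def)
  also have "(\<Sum>i<p. \<Sum>j<p. h i * (Q $$ (i,j) * h j)) = qform p \<Sigma> w"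
    unfolding sum_distrib_left[symmetric] qform_rows
    by (intro sum.cong refl, simp only: lessThan_iff Qh, simp add: h_def mult.commute)
  finally have q: "qform p Q (\<lambda>i. v i + s * h i) = qform p Q v + 2 * s * centered_form p \<mu> w x + s\<^sup>2 * qform p \<Sigma> w"
    by simp
  have e: "qform p Q (\<lambda>i. (\<lambda>i\<in>{..<p}. x i + s * h i) i - \<mu> $ i) = qform p Q (\<lambda>i. v i + s * h i)"
    unfolding qform_def by (intro sum.cong refl) (auto simp: v_def algebra_simps)
  show ?thesis
    unfolding gaussian_density_qform Q_def[symmetric] e q v_def[symmetric]
    by (simp add: exp_add[symmetric] field_simps)
qed

lemma centered_form_shift:
  fixes w :: "nat \<Rightarrow> real"
  shows "centered_form p \<mu> w (\<lambda>i\<in>{..<p}. x i + s * (\<Sum>j<p. \<Sigma> $$ (i,j) * w j)) =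
    centered_form p \<mu> w x + s * qform p \<Sigma> w"
  unfolding centered_form_def qform_rows sum_distrib_left sum.distrib[symmetric]
  by (intro sum.cong refl) (simp add: algebra_simps sum_distrib_left)

text \<open>Let \<open>z\<close> be the linear form and \<open>v\<close> its variance. The double integral of \<open>g(z(x)) f(x - s \<Sigma> w)\<close> over \<open>x\<close>
  and \<open>s\<close> is computed in two orders. Integrating over \<open>s\<close> first gives a Gaussian integral in one variable, times
  \<open>g(z(x)) f(x)\<close>; translating \<open>x\<close> first gives \<open>g(z(x) + s v) f(x)\<close>, whose integral over \<open>s\<close> does not depend on \<open>x\<close>. Comparison
  determines the law of \<open>z\<close>, without any integration in several variables beyond the total mass of \<open>f\<close>.\<close>

lemma linear_form_normal:
  fixes w :: "nat \<Rightarrow> real"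
  assumes "prob_space M"
    and X: "distributed M (lborel_vec p) X (\<lambda>x. ennreal (gaussian_density p \<mu> \<Sigma> x))"
    and v_pos: "0 < qform p \<Sigma> w"
  shows "distributed M lborel (\<lambda>\<omega>. centered_form p \<mu> w (X \<omega>)) (normal_density 0 (sqrt (qform p \<Sigma> w)))"
proof -
  interpret prob_space M by fact
  let ?L = "lborel_vec p"
  interpret L: sigma_finite_measure ?L by (rule sigma_finite_lborel_vec)
  interpret LR: pair_sigma_finite ?L "lborel :: real measure" ..
  define f where "f = gaussian_density p \<mu> \<Sigma>"
  define z where "z = centered_form p \<mu> w"
  define v where "v = qform p \<Sigma> w"
  define T where "T s x = (\<lambda>i\<in>{..<p}. x i + s * (\<Sum>j<p. \<Sigma> $$ (i,j) * w j))" for s :: real and x :: "nat \<Rightarrow> real"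
  have v: "0 < v" using v_pos by (simp add: v_def)
  have fm[measurable]: "f \<in> borel_measurable ?L" unfolding f_def by (rule gaussian_density_measurable)
  have zm[measurable]: "z \<in> borel_measurable ?L" unfolding z_def by measurable
  have fnn: "0 \<le> f x" for x unfolding f_def by (rule gaussian_density_nonneg)
  have Xm[measurable]: "X \<in> measurable M ?L" by (rule distributed_measurable[OF X])
  have Zm[measurable]: "(\<lambda>\<omega>. z (X \<omega>)) \<in> borel_measurable M" by measurable
  have Tm[measurable]: "T s \<in> measurable ?L ?L" for s
    unfolding T_def by (intro measurable_restrict borel_measurable_add borel_measurable_const
        component_measurable[unfolded measurable_lborel2[symmetric]]) (auto simp: component_measurable)
  have Tdistr: "distr ?L ?L (T s) = ?L" for s unfolding T_def by (rule lborel_vec_translate)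
  have fT: "f (T s x) * exp (s * z x + s\<^sup>2 * v / 2) = f x" for s x
    unfolding f_def T_def z_def v_def by (rule gaussian_density_shift)
  have zT: "z (T s x) = z x + s * v" for s x unfolding z_def T_def v_def by (rule centered_form_shift)
  \<comment> \<open>chosen so that \<open>k u * exp (s u - s\<^sup>2 v / 2)\<close> is a probability density in \<open>s\<close>, for every \<open>u\<close>\<close>
  define k where "k u = exp (- u\<^sup>2 / (2 * v)) * sqrt (v / (2 * pi))" for u :: real
  have knn: "0 \<le> k u" for u using v by (simp add: k_def)
  have km[measurable]: "k \<in> borel_measurable borel" unfolding k_def by measurable
  have total: "(\<integral>\<^sup>+x. ennreal (f x) \<partial>?L) = 1"
    using distributed_nn_integral[OF X, of "\<lambda>_. 1"] by (simp add: f_def emeasure_space_1)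
  have nd: "k u * exp (s * u - s\<^sup>2 * v / 2) = normal_density (u / v) (1 / sqrt v) s" for u s
  proof -
    have "normal_density (u / v) (1 / sqrt v) s = 1 / sqrt (2 * pi * (1 / v)) * exp (- (s - u / v)\<^sup>2 / (2 * (1 / v)))"
      using v by (simp add: normal_density_def power_divide)
    also have "1 / sqrt (2 * pi * (1 / v)) = sqrt (v / (2 * pi))" using v by (simp add: real_sqrt_divide real_sqrt_mult)
    also have "- (s - u / v)\<^sup>2 / (2 * (1 / v)) = - u\<^sup>2 / (2 * v) + (s * u - s\<^sup>2 * v / 2)"
      using v by (simp add: power2_eq_square field_simps)
    finally show ?thesis by (simp only: k_def exp_add mult_ac)
  qed
  have key: "(\<integral>\<^sup>+\<omega>. G (z (X \<omega>)) \<partial>M) = (\<integral>\<^sup>+u. ennreal (normal_density 0 (sqrt v) u) * G u \<partial>lborel)"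
    if Gm[measurable]: "G \<in> borel_measurable borel" for G :: "real \<Rightarrow> ennreal"
  proof -
    \<comment> \<open>the function whose double integral is computed twice; the factor \<open>k\<close> cancels the Gaussian integral over \<open>s\<close>\<close>
    define g where "g u = ennreal (k u) * G u" for u
    have gm[measurable]: "g \<in> borel_measurable borel" unfolding g_def by measurable
    have "(\<integral>\<^sup>+\<omega>. G (z (X \<omega>)) \<partial>M) = (\<integral>\<^sup>+x. ennreal (f x) * G (z x) \<partial>?L)"
      using distributed_nn_integral[OF X, of "\<lambda>x. G (z x)"] by (simp add: f_def)
    also have "\<dots> = (\<integral>\<^sup>+x. (\<integral>\<^sup>+s. ennreal (f x * exp (s * z x - s\<^sup>2 * v / 2)) * g (z x) \<partial>lborel) \<partial>?L)"
    proof (rule nn_integral_cong)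
      fix x
      have "(\<integral>\<^sup>+s. ennreal (f x * exp (s * z x - s\<^sup>2 * v / 2)) * g (z x) \<partial>lborel)
        = (\<integral>\<^sup>+s. (ennreal (f x) * G (z x)) * ennreal (normal_density (z x / v) (1 / sqrt v) s) \<partial>lborel)"
        unfolding nd[symmetric] g_def using fnn knn
        by (intro nn_integral_cong) (simp add: ennreal_mult mult_ac)
      also have "\<dots> = (ennreal (f x) * G (z x)) * (\<integral>\<^sup>+s. ennreal (normal_density (z x / v) (1 / sqrt v) s) \<partial>lborel)"
        by (intro nn_integral_cmult) simp
      also have "(\<integral>\<^sup>+s. ennreal (normal_density (z x / v) (1 / sqrt v) s) \<partial>lborel) = 1"
        using v by (subst nn_integral_eq_integral) simp_all
      finally show "ennreal (f x) * G (z x) = (\<integral>\<^sup>+s. ennreal (f x * exp (s * z x - s\<^sup>2 * v / 2)) * g (z x) \<partial>lborel)"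
        by simp
    qed
    also have "\<dots> = (\<integral>\<^sup>+s. (\<integral>\<^sup>+x. ennreal (f x * exp (s * z x - s\<^sup>2 * v / 2)) * g (z x) \<partial>?L) \<partial>lborel)"
      by (rule LR.Fubini'[symmetric]) measurable
    also have "\<dots> = (\<integral>\<^sup>+s. (\<integral>\<^sup>+x. ennreal (f x) * g (z x + s * v) \<partial>?L) \<partial>lborel)"
    proof (rule nn_integral_cong)
      fix s :: real
      have "(\<integral>\<^sup>+x. ennreal (f x * exp (s * z x - s\<^sup>2 * v / 2)) * g (z x) \<partial>?L)
        = (\<integral>\<^sup>+x. ennreal (f x * exp (s * z x - s\<^sup>2 * v / 2)) * g (z x) \<partial>distr ?L ?L (T s))"
        by (simp only: Tdistr)
      also have "\<dots> = (\<integral>\<^sup>+x. ennreal (f (T s x) * exp (s * z (T s x) - s\<^sup>2 * v / 2)) * g (z (T s x)) \<partial>?L)"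
        by (rule nn_integral_distr) measurable
      also have "\<dots> = (\<integral>\<^sup>+x. ennreal (f x) * g (z x + s * v) \<partial>?L)"
      proof (rule nn_integral_cong)
        fix x
        have "s * z (T s x) - s\<^sup>2 * v / 2 = s * z x + s\<^sup>2 * v / 2"
          unfolding zT by (simp add: algebra_simps power2_eq_square)
        then show "ennreal (f (T s x) * exp (s * z (T s x) - s\<^sup>2 * v / 2)) * g (z (T s x)) = ennreal (f x) * g (z x + s * v)"
          by (simp only: fT zT)
      qed
      finally show "(\<integral>\<^sup>+x. ennreal (f x * exp (s * z x - s\<^sup>2 * v / 2)) * g (z x) \<partial>?L)
        = (\<integral>\<^sup>+x. ennreal (f x) * g (z x + s * v) \<partial>?L)" .
    qed
    also have "\<dots> = (\<integral>\<^sup>+x. (\<integral>\<^sup>+s. ennreal (f x) * g (z x + s * v) \<partial>lborel) \<partial>?L)"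
      by (rule LR.Fubini') measurable
    also have "\<dots> = (\<integral>\<^sup>+x. ennreal (f x) * (ennreal (1 / v) * (\<integral>\<^sup>+u. g u \<partial>lborel)) \<partial>?L)"
    proof (rule nn_integral_cong)
      fix x
      have "(\<integral>\<^sup>+u. g u \<partial>lborel) = ennreal v * (\<integral>\<^sup>+s. g (z x + v * s) \<partial>lborel)"
        using nn_integral_real_affine[OF gm, of v "z x"] v by simp
      then have "ennreal (1 / v) * (\<integral>\<^sup>+u. g u \<partial>lborel) = (\<integral>\<^sup>+s. g (z x + s * v) \<partial>lborel)"
        using v by (simp add: mult.assoc[symmetric] ennreal_mult[symmetric] mult.commute)
      then show "(\<integral>\<^sup>+s. ennreal (f x) * g (z x + s * v) \<partial>lborel) = ennreal (f x) * (ennreal (1 / v) * (\<integral>\<^sup>+u. g u \<partial>lborel))"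
        by (simp add: nn_integral_cmult)
    qed
    also have "\<dots> = ennreal (1 / v) * (\<integral>\<^sup>+u. g u \<partial>lborel)"
      by (simp add: nn_integral_multc total)
    also have "\<dots> = (\<integral>\<^sup>+u. ennreal (1 / v) * g u \<partial>lborel)" by (simp add: nn_integral_cmult)
    also have "\<dots> = (\<integral>\<^sup>+u. ennreal (normal_density 0 (sqrt v) u) * G u \<partial>lborel)"
    proof (rule nn_integral_cong)
      fix u
      have "sqrt (v / (2 * pi)) / v = 1 / sqrt (2 * pi * v)"
        using v by (simp add: real_sqrt_divide real_sqrt_mult field_simps)
      moreover have "1 / v * k u = (sqrt (v / (2 * pi)) / v) * exp (- u\<^sup>2 / (2 * v))" by (simp add: k_def)
      ultimately have "1 / v * k u = 1 / sqrt (2 * pi * v) * exp (- u\<^sup>2 / (2 * v))" by (simp only:)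
      then have "1 / v * k u = normal_density 0 (sqrt v) u" using v by (simp add: normal_density_def)
      then have "ennreal (normal_density 0 (sqrt v) u) = ennreal (1 / v) * ennreal (k u)"
        using v knn by (simp add: ennreal_mult[symmetric])
      then show "ennreal (1 / v) * g u = ennreal (normal_density 0 (sqrt v) u) * G u" by (simp add: g_def mult.assoc)
    qed
    finally show ?thesis .
  qed
  show ?thesis
    unfolding distributed_def z_def[symmetric] v_def[symmetric]
  proof (intro conjI)
    show "distr M lborel (\<lambda>\<omega>. z (X \<omega>)) = density lborel (\<lambda>u. ennreal (normal_density 0 (sqrt v) u))"
    proof (rule measure_eqI)
      fix A assume "A \<in> sets (distr M lborel (\<lambda>\<omega>. z (X \<omega>)))"
      then have A[measurable]: "A \<in> sets borel" by simp
      have "emeasure (distr M lborel (\<lambda>\<omega>. z (X \<omega>))) A = (\<integral>\<^sup>+\<omega>. indicator A (z (X \<omega>)) \<partial>M)"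
        by (subst emeasure_distr) (auto simp: nn_integral_indicator[symmetric] simp del: nn_integral_indicator intro!: nn_integral_cong split: split_indicator)
      also have "\<dots> = emeasure (density lborel (\<lambda>u. ennreal (normal_density 0 (sqrt v) u))) A"
        by (subst key) (auto simp: emeasure_density)
      finally show "emeasure (distr M lborel (\<lambda>\<omega>. z (X \<omega>))) A = emeasure (density lborel (\<lambda>u. ennreal (normal_density 0 (sqrt v) u))) A" .
    qed simp
  qed simp_all
qed

end

section \<open>Tail and small ball bounds for independent normal variables\<close>

lemma nn_integral_normal_exp:
  assumes v: "0 < v"
  shows "(\<integral>\<^sup>+z. ennreal (normal_density 0 (sqrt v) z) * ennreal (exp (s * z)) \<partial>lborel) = ennreal (exp (s\<^sup>2 * v / 2))"
proof -
  have eq: "normal_density 0 (sqrt v) z * exp (s * z) = exp (s\<^sup>2 * v / 2) * normal_density (s * v) (sqrt v) z" for z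
  proof -
    have "- z\<^sup>2 / (2 * v) + s * z = s\<^sup>2 * v / 2 + (- (z - s * v)\<^sup>2 / (2 * v))"
      using v by (simp add: power2_eq_square field_simps)
    then have "exp (- z\<^sup>2 / (2 * v)) * exp (s * z) = exp (s\<^sup>2 * v / 2) * exp (- (z - s * v)\<^sup>2 / (2 * v))"
      by (simp only: exp_add[symmetric])
    then show ?thesis using v by (simp add: normal_density_def)
  qed
  have "(\<integral>\<^sup>+z. ennreal (normal_density 0 (sqrt v) z) * ennreal (exp (s * z)) \<partial>lborel)
      = (\<integral>\<^sup>+z. ennreal (exp (s\<^sup>2 * v / 2)) * ennreal (normal_density (s * v) (sqrt v) z) \<partial>lborel)"
    by (simp add: ennreal_mult[symmetric] eq)
  also have "\<dots> = ennreal (exp (s\<^sup>2 * v / 2)) * (\<integral>\<^sup>+z. ennreal (normal_density (s * v) (sqrt v) z) \<partial>lborel)"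
    by (rule nn_integral_cmult) simp
  also have "(\<integral>\<^sup>+z. ennreal (normal_density (s * v) (sqrt v) z) \<partial>lborel) = 1"
    using v by (subst nn_integral_eq_integral) simp_all
  finally show ?thesis by simp
qed

lemma nn_integral_normal_exp_square:
  assumes v: "0 < v" and s: "2 * s * v < 1"
  shows "(\<integral>\<^sup>+z. ennreal (normal_density 0 (sqrt v) z) * ennreal (exp (s * z\<^sup>2)) \<partial>lborel) = ennreal (1 / sqrt (1 - 2 * s * v))"
proof -
  define d where "d = 1 - 2 * s * v"
  have d: "0 < d" using s by (simp add: d_def)
  have eq: "normal_density 0 (sqrt v) z * exp (s * z\<^sup>2) = 1 / sqrt d * normal_density 0 (sqrt (v / d)) z" for z
  proof -
    have "- z\<^sup>2 / (2 * v) + s * z\<^sup>2 = - z\<^sup>2 / (2 * (v / d))"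
      using v d by (simp add: d_def field_simps)
    then have "exp (- z\<^sup>2 / (2 * v)) * exp (s * z\<^sup>2) = exp (- z\<^sup>2 / (2 * (v / d)))"
      by (simp only: exp_add[symmetric])
    moreover have "1 / sqrt (2 * pi * v) = 1 / sqrt d * (1 / sqrt (2 * pi * (v / d)))"
      using v d by (simp add: real_sqrt_divide real_sqrt_mult)
    ultimately show ?thesis using v d unfolding normal_density_def by (simp add: mult_ac)
  qed
  have "(\<integral>\<^sup>+z. ennreal (normal_density 0 (sqrt v) z) * ennreal (exp (s * z\<^sup>2)) \<partial>lborel)
      = (\<integral>\<^sup>+z. ennreal (1 / sqrt d) * ennreal (normal_density 0 (sqrt (v / d)) z) \<partial>lborel)"
    by (intro nn_integral_cong) (use d in \<open>simp add: ennreal_mult[symmetric] eq\<close>)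
  also have "\<dots> = ennreal (1 / sqrt d) * (\<integral>\<^sup>+z. ennreal (normal_density 0 (sqrt (v / d)) z) \<partial>lborel)"
    by (rule nn_integral_cmult) simp
  also have "(\<integral>\<^sup>+z. ennreal (normal_density 0 (sqrt (v / d)) z) \<partial>lborel) = 1"
    using v d by (subst nn_integral_eq_integral) simp_all
  finally show ?thesis by (simp add: d_def)
qed

lemma (in prob_space) Chernoff_sum:
  fixes W :: "'b \<Rightarrow> 'a \<Rightarrow> real"
  assumes I: "finite I" and ind: "indep_vars (\<lambda>_. borel) W I" and s: "0 < s"
    and mgf: "\<And>i. i \<in> I \<Longrightarrow> (\<integral>\<^sup>+\<omega>. ennreal (exp (s * W i \<omega>)) \<partial>M) \<le> ennreal (exp b)"
  shows "prob {\<omega> \<in> space M. t \<le> (\<Sum>i\<in>I. W i \<omega>)} \<le> exp (real (card I) * b - s * t)"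
proof -
  have Wm[measurable]: "W i \<in> borel_measurable M" if "i \<in> I" for i
    using ind that unfolding indep_vars_def by auto
  have sm[measurable]: "(\<lambda>\<omega>. \<Sum>i\<in>I. W i \<omega>) \<in> borel_measurable M" by measurable
  have "emeasure M {\<omega> \<in> space M. t \<le> (\<Sum>i\<in>I. W i \<omega>)}
      \<le> ennreal (exp (- s * t)) * (\<integral>\<^sup>+\<omega>. ennreal (exp (s * (\<Sum>i\<in>I. W i \<omega>))) * indicator (space M) \<omega> \<partial>M)"
    by (rule Chernoff_ineq_nn_integral_ge[OF s]) auto
  also have "(\<integral>\<^sup>+\<omega>. ennreal (exp (s * (\<Sum>i\<in>I. W i \<omega>))) * indicator (space M) \<omega> \<partial>M)
      = (\<integral>\<^sup>+\<omega>. (\<Prod>i\<in>I. ennreal (exp (s * W i \<omega>))) \<partial>M)"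
    by (intro nn_integral_cong) (simp add: sum_distrib_left exp_sum[OF I] prod_ennreal)
  also have "\<dots> = (\<Prod>i\<in>I. \<integral>\<^sup>+\<omega>. ennreal (exp (s * W i \<omega>)) \<partial>M)"
    by (rule indep_vars_nn_integral[OF I indep_vars_compose2[OF ind]]) auto
  also have "\<dots> \<le> (\<Prod>i\<in>I. ennreal (exp b))" by (intro prod_mono_ennreal mgf)
  also have "\<dots> = ennreal (exp (real (card I) * b))"
    by (simp add: ennreal_power exp_of_nat_mult)
  finally have "emeasure M {\<omega> \<in> space M. t \<le> (\<Sum>i\<in>I. W i \<omega>)} \<le> ennreal (exp (- s * t)) * ennreal (exp (real (card I) * b))"
    by (simp add: mult_left_mono)
  also have "\<dots> = ennreal (exp (real (card I) * b - s * t))"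
    by (simp add: ennreal_mult[symmetric] exp_add[symmetric])
  finally show ?thesis by (simp add: emeasure_eq_measure)
qed

lemma (in prob_space) Chernoff_sum_two_sided:
  fixes W :: "'b \<Rightarrow> 'a \<Rightarrow> real"
  assumes I: "finite I" and ind: "indep_vars (\<lambda>_. borel) W I" and s: "0 < s"
    and mgf: "\<And>i s'. i \<in> I \<Longrightarrow> s' = s \<or> s' = - s \<Longrightarrow> (\<integral>\<^sup>+\<omega>. ennreal (exp (s' * W i \<omega>)) \<partial>M) \<le> ennreal (exp b)"
  shows "prob {\<omega> \<in> space M. t \<le> \<bar>\<Sum>i\<in>I. W i \<omega>\<bar>} \<le> 2 * exp (real (card I) * b - s * t)"
proof -
  have Wm[measurable]: "W i \<in> borel_measurable M" if "i \<in> I" for i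
    using ind that unfolding indep_vars_def by auto
  have [measurable]: "(\<lambda>\<omega>. \<Sum>i\<in>I. W i \<omega>) \<in> borel_measurable M" by measurable
  have ind': "indep_vars (\<lambda>_. borel) (\<lambda>i \<omega>. - W i \<omega>) I" by (rule indep_vars_compose2[OF ind]) simp
  let ?A = "{\<omega> \<in> space M. t \<le> (\<Sum>i\<in>I. W i \<omega>)}" and ?B = "{\<omega> \<in> space M. t \<le> (\<Sum>i\<in>I. - W i \<omega>)}"
  have 1: "prob ?A \<le> exp (real (card I) * b - s * t)"
    by (rule Chernoff_sum[OF I ind s mgf]) auto
  have 2: "prob ?B \<le> exp (real (card I) * b - s * t)"
    by (rule Chernoff_sum[OF I ind' s]) (use mgf[of _ "- s"] in simp)
  have "{\<omega> \<in> space M. t \<le> \<bar>\<Sum>i\<in>I. W i \<omega>\<bar>} \<subseteq> ?A \<union> ?B"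
    by (auto simp: sum_negf abs_if split: if_splits)
  then have "prob {\<omega> \<in> space M. t \<le> \<bar>\<Sum>i\<in>I. W i \<omega>\<bar>} \<le> prob (?A \<union> ?B)"
    by (rule finite_measure_mono) measurable
  also have "\<dots> \<le> prob ?A + prob ?B" by (rule measure_Un_le) measurable
  finally show ?thesis using 1 2 by linarith
qed

context prob_space
begin

context
  fixes Z :: "'b \<Rightarrow> 'a \<Rightarrow> real" and I :: "'b set" and v V :: real
  assumes I: "finite I" and ind: "indep_vars (\<lambda>_. borel) Z I"
    and normal: "\<And>i. i \<in> I \<Longrightarrow> distributed M lborel (Z i) (normal_density 0 (sqrt v))"
    and v: "0 < v" "v \<le> V"
begin

lemma normal_sum_tail:
  assumes t: "0 < t"
  shows "prob {\<omega> \<in> space M. real (card I) * t \<le> \<bar>\<Sum>i\<in>I. Z i \<omega>\<bar>} \<le> 2 * exp (- real (card I) * t\<^sup>2 / (2 * V))"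
proof -
  have V: "0 < V" using v by simp
  \<comment> \<open>the minimizer of \<open>s\<^sup>2 V / 2 - s t\<close>\<close>
  define s where "s = t / V"
  have s: "0 < s" using t V by (simp add: s_def)
  have mgf: "(\<integral>\<^sup>+\<omega>. ennreal (exp (s' * Z i \<omega>)) \<partial>M) \<le> ennreal (exp (s\<^sup>2 * V / 2))"
    if i: "i \<in> I" and s': "s'\<^sup>2 = s\<^sup>2" for i s'
  proof -
    have "(\<integral>\<^sup>+\<omega>. ennreal (exp (s' * Z i \<omega>)) \<partial>M) = ennreal (exp (s'\<^sup>2 * v / 2))"
      using distributed_nn_integral[OF normal[OF i], of "\<lambda>z. ennreal (exp (s' * z))"]
      by (simp add: nn_integral_normal_exp[OF v(1)])
    also have "\<dots> \<le> ennreal (exp (s\<^sup>2 * V / 2))"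
      using v(2) unfolding s' by (intro ennreal_leI) (simp add: mult_left_mono)
    finally show ?thesis .
  qed
  have bnd: "real (card I) * (s\<^sup>2 * V / 2) - s * (real (card I) * t) = - real (card I) * t\<^sup>2 / (2 * V)"
    using V by (simp add: s_def power2_eq_square field_simps)
  show ?thesis
    unfolding bnd[symmetric] by (rule Chernoff_sum_two_sided[OF I ind s mgf]) auto
qed

text \<open>From the exact Laplace transform \<open>1 / sqrt (1 - 2 s v)\<close> of a squared centered normal variable, valid for both
  signs of \<open>s\<close>. The range of \<open>t\<close> keeps \<open>2 s v\<close> within \<open>1/2\<close>.\<close>

lemma normal_square_sum_tail:
  assumes t: "0 < t" "t \<le> 6 * V"
  shows "prob {\<omega> \<in> space M. real (card I) * t \<le> \<bar>\<Sum>i\<in>I. (Z i \<omega>)\<^sup>2 - v\<bar>} \<le> 2 * exp (- real (card I) * t\<^sup>2 / (48 * V\<^sup>2))"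
proof -
  have V: "0 < V" using v by simp
  \<comment> \<open>the minimizer of \<open>12 s\<^sup>2 V\<^sup>2 - s t\<close>\<close>
  define s where "s = t / (24 * V\<^sup>2)"
  have s: "0 < s" using t V by (simp add: s_def)
  have sV: "2 * s * V \<le> 1/2" using t V by (simp add: s_def power2_eq_square field_simps)
  have Zm[measurable]: "Z i \<in> borel_measurable M" if "i \<in> I" for i
    using ind that unfolding indep_vars_def by auto
  have mgf: "(\<integral>\<^sup>+\<omega>. ennreal (exp (s' * ((Z i \<omega>)\<^sup>2 - v))) \<partial>M) \<le> ennreal (exp (12 * s\<^sup>2 * V\<^sup>2))"
    if i: "i \<in> I" and s': "s' = s \<or> s' = - s" for i s'
  proof -
    have sv: "\<bar>2 * s' * v\<bar> \<le> 1/2"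
    proof -
      have "s * v \<le> s * V" using s v by (intro mult_left_mono) auto
      then have "2 * s * v \<le> 1/2" using sV by simp
      moreover have "\<bar>2 * s' * v\<bar> = 2 * s * v" using s' s v by (auto simp: abs_mult)
      ultimately show ?thesis by simp
    qed
    then have lt: "2 * s' * v < 1" by linarith
    have "(\<integral>\<^sup>+\<omega>. ennreal (exp (s' * ((Z i \<omega>)\<^sup>2 - v))) \<partial>M)
       = (\<integral>\<^sup>+\<omega>. ennreal (exp (- s' * v)) * ennreal (exp (s' * (Z i \<omega>)\<^sup>2)) \<partial>M)"
      by (intro nn_integral_cong) (simp add: ennreal_mult[symmetric] exp_add[symmetric] algebra_simps)
    also have "\<dots> = ennreal (exp (- s' * v)) * (\<integral>\<^sup>+\<omega>. ennreal (exp (s' * (Z i \<omega>)\<^sup>2)) \<partial>M)"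
      using i by (intro nn_integral_cmult) simp
    also have "(\<integral>\<^sup>+\<omega>. ennreal (exp (s' * (Z i \<omega>)\<^sup>2)) \<partial>M) = ennreal (1 / sqrt (1 - 2 * s' * v))"
      using distributed_nn_integral[OF normal[OF i], of "\<lambda>z. ennreal (exp (s' * z\<^sup>2))"]
      by (simp add: nn_integral_normal_exp_square[OF v(1) lt])
    also have "1 / sqrt (1 - 2 * s' * v) = exp (- ln (1 + - (2 * s' * v)) / 2)"
    proof -
      have "sqrt (1 - 2 * s' * v) = exp (ln (1 + - (2 * s' * v)) / 2)"
        using lt by (simp add: powr_half_sqrt[symmetric] powr_def)
      then show ?thesis by (simp add: exp_minus inverse_eq_divide)
    qed
    also have "ennreal (exp (- s' * v)) * ennreal (exp (- ln (1 + - (2 * s' * v)) / 2))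
       = ennreal (exp (- s' * v + (- ln (1 + - (2 * s' * v)) / 2)))"
      by (simp only: ennreal_mult[symmetric] exp_ge_zero exp_add[symmetric])
    also have "\<dots> \<le> ennreal (exp (12 * s\<^sup>2 * V\<^sup>2))"
    proof -
      have "- ln (1 + - (2 * s' * v)) \<le> - (- (2 * s' * v)) + (2 + 4 * ln (1/(1/2))) * (- (2 * s' * v))\<^sup>2"
        by (rule minus_ln_one_plus_le) (use sv in auto)
      also have "(2 + 4 * ln (1/(1/2::real))) * (- (2 * s' * v))\<^sup>2 \<le> 6 * (- (2 * s' * v))\<^sup>2"
        using ln_le_minus_one[of "2::real"] by (intro mult_right_mono) auto
      also have "(- (2 * s' * v))\<^sup>2 = 4 * (s\<^sup>2 * v\<^sup>2)" using s' by (auto simp: power_mult_distrib)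
      finally have "- s' * v + (- ln (1 + - (2 * s' * v)) / 2) \<le> 12 * (s\<^sup>2 * v\<^sup>2)" by simp
      also have "\<dots> \<le> 12 * (s\<^sup>2 * V\<^sup>2)" using v by (intro mult_left_mono power_mono) auto
      finally show ?thesis by (intro ennreal_leI) (simp add: mult.assoc)
    qed
    finally show ?thesis .
  qed
  have bnd: "real (card I) * (12 * s\<^sup>2 * V\<^sup>2) - s * (real (card I) * t) = - real (card I) * t\<^sup>2 / (48 * V\<^sup>2)"
    using V by (simp add: s_def power2_eq_square field_simps)
  have ind1: "indep_vars (\<lambda>_. borel) (\<lambda>i \<omega>. (Z i \<omega>)\<^sup>2 - v) I" by (rule indep_vars_compose2[OF ind]) simp
  show ?thesis
    unfolding bnd[symmetric] by (rule Chernoff_sum_two_sided[OF I ind1 s mgf])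
qed

text \<open>The density is at most \<open>1 / sqrt (2 pi v)\<close>, which is below \<open>1 / (2 sqrt v)\<close>.\<close>

lemma normal_small_ball:
  assumes i: "i \<in> I" and t: "0 \<le> t"
  shows "prob {\<omega> \<in> space M. \<bar>Z i \<omega> - c\<bar> \<le> t} \<le> t / sqrt v"
proof -
  have Zm[measurable]: "Z i \<in> borel_measurable M"
    using ind i unfolding indep_vars_def by auto
  have "emeasure M {\<omega> \<in> space M. \<bar>Z i \<omega> - c\<bar> \<le> t} = emeasure M (Z i -` {c - t..c + t} \<inter> space M)"
    by (rule arg_cong[where f = "emeasure M"]) auto
  also have "\<dots> = (\<integral>\<^sup>+z. ennreal (normal_density 0 (sqrt v) z) * indicator {c - t..c + t} z \<partial>lborel)"
    by (rule distributed_emeasure[OF normal[OF i]]) simp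
  also have "\<dots> \<le> (\<integral>\<^sup>+z. ennreal (1 / sqrt (2 * pi * v)) * indicator {c - t..c + t} z \<partial>lborel)"
  proof (intro nn_integral_mono mult_right_mono ennreal_leI)
    fix z
    have "normal_density 0 (sqrt v) z = 1 / sqrt (2 * pi * v) * exp (- z\<^sup>2 / (2 * v))"
      using v by (simp add: normal_density_def)
    also have "\<dots> \<le> 1 / sqrt (2 * pi * v) * 1" using v by (intro mult_left_mono) auto
    finally show "normal_density 0 (sqrt v) z \<le> 1 / sqrt (2 * pi * v)" by simp
  qed auto
  also have "\<dots> = ennreal (1 / sqrt (2 * pi * v)) * ennreal (2 * t)"
    using t by (simp add: nn_integral_cmult)
  also have "\<dots> = ennreal (2 * t / sqrt (2 * pi * v))"
    using t v by (simp add: ennreal_mult[symmetric])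
  finally have "prob {\<omega> \<in> space M. \<bar>Z i \<omega> - c\<bar> \<le> t} \<le> 2 * t / sqrt (2 * pi * v)"
    using t v by (simp add: emeasure_eq_measure)
  also have "\<dots> \<le> 2 * t / sqrt (4 * v)"
    using t v pi_ge_two by (intro divide_left_mono) (auto intro!: mult_right_mono)
  also have "sqrt (4 * v) = 2 * sqrt v" by (simp add: real_sqrt_mult)
  finally show ?thesis by simp
qed

end

end

section \<open>Empirical covariances and a net of directions\<close>

lemma centered_form_pair_dir:
  assumes "i < p" "j < p"
  shows "centered_form p \<mu> (pair_dir i j s) x = (x i - \<mu> $ i) + s * (x j - \<mu> $ j)"
  unfolding centered_form_def by (rule sum_pair_dir[OF assms])

lemma emp_cov_carrier: "emp_cov n p x \<in> carrier_mat p p"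
  by (simp add: emp_cov_def)

text \<open>The centering constants \<open>a\<close> and \<open>b\<close> are free: in applications they are the true means, or \<open>0\<close>.\<close>

lemma emp_cov_entry:
  assumes n: "1 \<le> n" and ij: "i < p" "j < p"
  shows "emp_cov n p x $$ (i,j) =
    (\<Sum>l=1..n. (x l i - a) * (x l j - b)) / real n - ((\<Sum>l=1..n. x l i - a) / real n) * ((\<Sum>l=1..n. x l j - b) / real n)"
proof -
  define A where "A = (\<Sum>l=1..n. x l i - a) / real n"
  define B where "B = (\<Sum>l=1..n. x l j - b) / real n"
  have sA: "(\<Sum>l=1..n. x l i - a) = real n * A" and sB: "(\<Sum>l=1..n. x l j - b) = real n * B"
    using n by (simp_all add: A_def B_def)
  have mA: "x l i - emp_mean n x i = (x l i - a) - A" and mB: "x l j - emp_mean n x j = (x l j - b) - B" for l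
    using n by (simp_all add: A_def B_def emp_mean_def sum_subtractf diff_divide_distrib)
  have "(\<Sum>l=1..n. (x l i - emp_mean n x i) * (x l j - emp_mean n x j))
      = (\<Sum>l=1..n. (x l i - a) * (x l j - b) - B * (x l i - a) - A * (x l j - b) + A * B)"
    unfolding mA mB by (intro sum.cong refl) (simp add: algebra_simps)
  also have "\<dots> = (\<Sum>l=1..n. (x l i - a) * (x l j - b)) - B * (\<Sum>l=1..n. x l i - a) - A * (\<Sum>l=1..n. x l j - b) + real n * (A * B)"
    by (simp only: sum.distrib sum_subtractf sum_distrib_left[symmetric] sum_constant card_atLeastAtMost) simp
  also have "\<dots> = (\<Sum>l=1..n. (x l i - a) * (x l j - b)) - real n * (A * B)"
    unfolding sA sB by (simp add: algebra_simps)
  finally have "(\<Sum>l=1..n. (x l i - emp_mean n x i) * (x l j - emp_mean n x j)) / real n =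
      (\<Sum>l=1..n. (x l i - a) * (x l j - b)) / real n - A * B"
    using n by (simp add: diff_divide_distrib)
  then show ?thesis using ij unfolding A_def B_def by (simp add: emp_cov_def)
qed

lemma emp_cov_sym: "sym_mat p (emp_cov n p x)"
  by (auto simp: sym_mat_def emp_cov_def mult.commute)

lemma emp_cov_qform:
  assumes n: "1 \<le> n"
  shows "real n * qform p (emp_cov n p x) y =
    (\<Sum>l=1..n. (centered_form p \<mu> y (x l) - (\<Sum>k=1..n. centered_form p \<mu> y (x k)) / real n)\<^sup>2)"
proof -
  have m: "(\<Sum>i<p. y i * (x l i - emp_mean n x i)) = centered_form p \<mu> y (x l) - (\<Sum>k=1..n. centered_form p \<mu> y (x k)) / real n" for l
  proof -
    have "(\<Sum>k=1..n. centered_form p \<mu> y (x k)) / real n = (\<Sum>i<p. y i * ((\<Sum>k=1..n. x k i - \<mu> $ i) / real n))"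
      unfolding centered_form_def sum_divide_distrib sum_distrib_left
      by (subst sum.swap) simp
    also have "\<dots> = (\<Sum>i<p. y i * (emp_mean n x i - \<mu> $ i))"
      using n by (simp add: emp_mean_def sum_subtractf diff_divide_distrib)
    finally show ?thesis unfolding centered_form_def sum_subtractf[symmetric]
      by (simp add: sum_subtractf[symmetric] algebra_simps)
  qed
  have "real n * qform p (emp_cov n p x) y =
     (\<Sum>i<p. \<Sum>j<p. \<Sum>l=1..n. (y i * (x l i - emp_mean n x i)) * (y j * (x l j - emp_mean n x j)))"
    unfolding qform_def sum_distrib_left
  proof (intro sum.cong refl)
    fix i j assume "i \<in> {..<p}" "j \<in> {..<p}"
    then have "real n * (emp_cov n p x $$ (i,j) * y i * y j) = (\<Sum>l=1..n. (x l i - emp_mean n x i) * (x l j - emp_mean n x j)) * (y i * y j)"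
      using n by (simp add: emp_cov_def)
    then show "real n * (emp_cov n p x $$ (i,j) * y i * y j) =
      (\<Sum>l=1..n. (y i * (x l i - emp_mean n x i)) * (y j * (x l j - emp_mean n x j)))"
      by (simp add: sum_distrib_left sum_distrib_right mult_ac)
  qed
  also have "\<dots> = (\<Sum>i<p. \<Sum>l=1..n. \<Sum>j<p. (y i * (x l i - emp_mean n x i)) * (y j * (x l j - emp_mean n x j)))"
    by (intro sum.cong[OF refl] sum.swap)
  also have "\<dots> = (\<Sum>l=1..n. \<Sum>i<p. \<Sum>j<p. (y i * (x l i - emp_mean n x i)) * (y j * (x l j - emp_mean n x j)))"
    by (rule sum.swap)
  also have "\<dots> = (\<Sum>l=1..n. (\<Sum>i<p. y i * (x l i - emp_mean n x i))\<^sup>2)"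
    by (simp add: power2_eq_square sum_product)
  finally show ?thesis unfolding m .
qed

text \<open>Polarization: the product of two coordinates is a difference of squares of linear forms in the directions
  \<open>e\<^sub>i + e\<^sub>j\<close> and \<open>e\<^sub>i - e\<^sub>j\<close>, and diagonal entries come from \<open>e\<^sub>i\<close>. The product of the two means is of smaller order.\<close>

lemma emp_cov_close:
  assumes n: "1 \<le> n" and ij: "i < p" "j < p" and A: "sym_mat p A" and \<tau>: "0 \<le> \<tau>" "\<tau> \<le> 1"
    and mean: "\<And>i j s. i < p \<Longrightarrow> j < p \<Longrightarrow> s \<in> {-1,0,1} \<Longrightarrow> i \<noteq> j \<or> s = 0 \<Longrightarrow>
       \<bar>\<Sum>l=1..n. centered_form p \<mu> (pair_dir i j s) (x l)\<bar> \<le> real n * \<tau>"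
    and square: "\<And>i j s. i < p \<Longrightarrow> j < p \<Longrightarrow> s \<in> {-1,0,1} \<Longrightarrow> i \<noteq> j \<or> s = 0 \<Longrightarrow>
       \<bar>\<Sum>l=1..n. (centered_form p \<mu> (pair_dir i j s) (x l))\<^sup>2 - qform p A (pair_dir i j s)\<bar> \<le> real n * \<tau>"
  shows "\<bar>emp_cov n p x $$ (i,j) - A $$ (i,j)\<bar> \<le> 2 * \<tau>"
proof -
  have npos: "0 < real n" using n by simp
  define U where "U l = x l i - \<mu> $ i" for l
  define V where "V l = x l j - \<mu> $ j" for l
  have mU: "\<bar>(\<Sum>l=1..n. U l) / real n\<bar> \<le> \<tau>"
    using mean[of i i 0] ij npos by (simp add: centered_form_pair_dir U_def pos_divide_le_eq mult.commute)
  have mV: "\<bar>(\<Sum>l=1..n. V l) / real n\<bar> \<le> \<tau>"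
    using mean[of j j 0] ij npos by (simp add: centered_form_pair_dir V_def pos_divide_le_eq mult.commute)
  have "\<bar>((\<Sum>l=1..n. U l) / real n) * ((\<Sum>l=1..n. V l) / real n)\<bar> \<le> \<tau> * 1"
    unfolding abs_mult using mU mV \<tau> by (intro mult_mono) auto
  then have prod: "\<bar>((\<Sum>l=1..n. U l) / real n) * ((\<Sum>l=1..n. V l) / real n)\<bar> \<le> \<tau>" by simp
  have cov: "\<bar>(\<Sum>l=1..n. U l * V l) - real n * A $$ (i,j)\<bar> \<le> real n * \<tau>"
  proof (cases "i = j")
    case True
    have "(\<Sum>l=1..n. (centered_form p \<mu> (pair_dir i i 0) (x l))\<^sup>2 - qform p A (pair_dir i i 0)) = (\<Sum>l=1..n. U l * V l) - real n * A $$ (i,j)"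
      using True ij by (simp add: centered_form_pair_dir qform_pair_dir[OF A] U_def V_def power2_eq_square sum_subtractf)
    then show ?thesis using square[of i i 0] ij by simp
  next
    case False
    define Q where "Q s = (\<Sum>l=1..n. (centered_form p \<mu> (pair_dir i j s) (x l))\<^sup>2 - qform p A (pair_dir i j s))" for s
    have Q: "Q s = (\<Sum>l=1..n. (U l)\<^sup>2) + 2 * s * (\<Sum>l=1..n. U l * V l) + s\<^sup>2 * (\<Sum>l=1..n. (V l)\<^sup>2)
       - real n * (A $$ (i,i) + 2 * s * A $$ (i,j) + s\<^sup>2 * A $$ (j,j))" for s
    proof -
      have "Q s = (\<Sum>l=1..n. (U l)\<^sup>2 + 2 * s * (U l * V l) + s\<^sup>2 * (V l)\<^sup>2 - qform p A (pair_dir i j s))"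
        unfolding Q_def centered_form_pair_dir[OF ij] U_def[symmetric] V_def[symmetric]
        by (intro sum.cong refl) (simp add: power2_eq_square algebra_simps)
      then show ?thesis
        by (simp add: sum_subtractf sum.distrib sum_distrib_left qform_pair_dir[OF A ij])
    qed
    define D e where "D = (\<Sum>l=1..n. U l * V l) - real n * A $$ (i,j)" and "e = real n * \<tau>"
    have "Q 1 - Q (-1) = 4 * D"
      unfolding Q D_def by (simp add: algebra_simps)
    moreover have "\<bar>Q 1\<bar> \<le> e" "\<bar>Q (-1)\<bar> \<le> e"
      using square[of i j 1] square[of i j "-1"] ij False by (simp_all add: Q_def e_def)
    ultimately have "\<bar>4 * D\<bar> \<le> e + e" using abs_triangle_ineq4[of "Q 1" "Q (-1)"] by linarith
    moreover have "0 \<le> e" using \<tau> by (simp add: e_def)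
    ultimately have "\<bar>D\<bar> \<le> e" by (simp add: abs_mult)
    then show ?thesis unfolding D_def e_def .
  qed
  have "\<bar>(\<Sum>l=1..n. U l * V l) / real n - A $$ (i,j)\<bar> = \<bar>(\<Sum>l=1..n. U l * V l) - real n * A $$ (i,j)\<bar> / real n"
    using npos by (simp add: diff_divide_distrib[symmetric] abs_divide field_simps)
  also have "\<dots> \<le> \<tau>" using cov npos by (simp add: pos_divide_le_eq mult.commute)
  finally have "\<bar>(\<Sum>l=1..n. U l * V l) / real n - A $$ (i,j)\<bar> \<le> \<tau>" .
  moreover have "emp_cov n p x $$ (i,j) = (\<Sum>l=1..n. U l * V l) / real n - ((\<Sum>l=1..n. U l) / real n) * ((\<Sum>l=1..n. V l) / real n)"
    unfolding U_def V_def by (rule emp_cov_entry[OF n ij])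
  ultimately show ?thesis using prod by linarith
qed

text \<open>The vectors \<open>k / N\<close> with a coordinate of modulus one: a net of the sphere of the maximum norm, kept as
  integers for counting.\<close>

definition net :: "nat \<Rightarrow> nat \<Rightarrow> (nat \<Rightarrow> int) set" where
  "net p N = {k \<in> {..<p} \<rightarrow>\<^sub>E {- int N..int N}. \<exists>i<p. \<bar>k i\<bar> = int N}"

lemma finite_net: "finite (net p N)"
  unfolding net_def by (rule finite_subset[of _ "{..<p} \<rightarrow>\<^sub>E {- int N..int N}"]) (auto intro: finite_PiE)

lemma card_net: "card (net p N) \<le> (2 * N + 1) ^ p"
proof -
  have "card (net p N) \<le> card ({..<p} \<rightarrow>\<^sub>E {- int N..int N})"
    unfolding net_def by (rule card_mono) (auto intro: finite_PiE)
  also have "\<dots> = (2 * N + 1) ^ p" by (simp add: card_PiE nat_add_distrib nat_mult_distrib)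
  finally show ?thesis .
qed

lemma net_sqnorm_ge:
  assumes "k \<in> net p N" "0 < N"
  shows "1 \<le> sqnorm p (\<lambda>i. of_int (k i) / real N)"
proof -
  obtain i where i: "i < p" "\<bar>k i\<bar> = int N" using assms by (auto simp: net_def)
  have "\<bar>real_of_int (k i)\<bar> = real N" using i(2) by linarith
  then have "(real_of_int (k i))\<^sup>2 = (real N)\<^sup>2" by (metis power2_abs)
  then have "(of_int (k i) / real N)\<^sup>2 = (1::real)" using assms(2) by (simp add: power_divide)
  then show ?thesis using sq_le_sqnorm[OF i(1), of "\<lambda>i. of_int (k i) / real N"] by simp
qed

lemma abs_diff_scaled:
  fixes a b N :: real
  assumes "0 < N"
  shows "\<bar>a - b * N\<bar> / N = \<bar>a / N - b\<bar>"
proof -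
  have "a / N - b = (a - b * N) / N" using assms by (simp add: diff_divide_distrib)
  then show ?thesis using assms by (simp add: abs_divide)
qed

text \<open>If \<open>y\<close> is nearly annihilated by the empirical covariance, the linear form in direction \<open>y\<close> is nearly
  constant over the sample. This survives rounding the direction and the constant to multiples of \<open>1/N\<close>.\<close>

lemma small_qform_imp_net:
  assumes n: "1 \<le> n" and p: "1 \<le> p" and N: "1 \<le> N"
    and bnd: "\<And>l i. l \<in> {1..n} \<Longrightarrow> i < p \<Longrightarrow> \<bar>x l i - \<mu> $ i\<bar> \<le> real b"
    and deg: "qform p (emp_cov n p x) y < (1 / (real n * real p * (real N)\<^sup>2)) * sqnorm p y"
  obtains k r where "k \<in> net p N" "r \<in> {- int (p * b * N + 1)..int (p * b * N + 1)}"
    "\<And>l. l \<in> {1..n} \<Longrightarrow> \<bar>centered_form p \<mu> (\<lambda>i. of_int (k i) / real N) (x l) - of_int r / real N\<bar> \<le> real (p * b + 2) / real N"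
proof -
  have Npos: "0 < real N" and npos: "0 < real n" and ppos: "0 < real p" using N n p by auto
  define m where "m = Max ((\<lambda>i. \<bar>y i\<bar>) ` {..<p})"
  have "m \<in> (\<lambda>i. \<bar>y i\<bar>) ` {..<p}" unfolding m_def using p by (intro Max_in) (auto simp: lessThan_empty_iff)
  then obtain i0 where i0: "i0 < p" "\<bar>y i0\<bar> = m" by auto
  have mi: "\<bar>y i\<bar> \<le> m" if "i < p" for i unfolding m_def using that by (intro Max_ge) auto
  have m: "0 < m"
  proof (rule ccontr)
    assume "\<not> 0 < m"
    then have "y i = 0" if "i < p" for i using mi[OF that] by linarith
    then have "qform p (emp_cov n p x) y = 0" "sqnorm p y = 0" by (auto intro: qform_0 simp: sqnorm_def)
    then show False using deg by simp
  qed
  define w where "w i = y i / m" for i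
  have w1: "\<bar>w i\<bar> \<le> 1" if "i < p" for i using mi[OF that] m by (simp add: w_def abs_divide)
  have w0: "\<bar>w i0\<bar> = 1" using i0 m by (simp add: w_def abs_divide)
  have q: "qform p (emp_cov n p x) w = qform p (emp_cov n p x) y / m\<^sup>2"
    unfolding qform_def w_def sum_divide_distrib by (intro sum.cong refl) (simp add: power2_eq_square)
  have sq: "sqnorm p w = sqnorm p y / m\<^sup>2" unfolding sqnorm_def w_def sum_divide_distrib by (simp add: power_divide)
  have "sqnorm p w \<le> (\<Sum>i<p. 1)" unfolding sqnorm_def
    using w1 by (intro sum_mono) (simp add: abs_square_le_1)
  then have sp: "sqnorm p w \<le> real p" by simp
  have "qform p (emp_cov n p x) w < (1 / (real n * real p * (real N)\<^sup>2)) * sqnorm p w"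
    unfolding q sq times_divide_eq_right[symmetric]
    using divide_strict_right_mono[OF deg, of "m\<^sup>2"] m by simp
  also have "\<dots> \<le> (1 / (real n * real p * (real N)\<^sup>2)) * real p" using sp by (intro mult_left_mono) auto
  finally have qw: "real n * qform p (emp_cov n p x) w < 1 / (real N)\<^sup>2"
    using npos ppos Npos by (simp add: field_simps)
  define z where "z l = centered_form p \<mu> w (x l)" for l
  define c where "c = (\<Sum>l=1..n. z l) / real n"
  have zc: "\<bar>z l - c\<bar> \<le> 1 / real N" if l: "l \<in> {1..n}" for l
  proof -
    have "(z l - c)\<^sup>2 \<le> (\<Sum>l=1..n. (z l - c)\<^sup>2)" by (rule member_le_sum[OF l]) auto
    also have "\<dots> = real n * qform p (emp_cov n p x) w" unfolding emp_cov_qform[OF n, where \<mu> = \<mu>] z_def c_def ..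
    finally have "(z l - c)\<^sup>2 \<le> (1 / real N)\<^sup>2" using qw by (simp add: power_divide)
    then show ?thesis using abs_le_square_iff[of "z l - c" "1 / real N"] by simp
  qed
  have form_bound: "\<bar>centered_form p \<mu> a (x l)\<bar> \<le> real p * real b * e"
    if l: "l \<in> {1..n}" and e: "\<And>i. i < p \<Longrightarrow> \<bar>a i\<bar> \<le> e" for a l e
  proof -
    have "\<bar>centered_form p \<mu> a (x l)\<bar> \<le> (\<Sum>i<p. \<bar>a i * (x l i - \<mu> $ i)\<bar>)"
      unfolding centered_form_def by (rule sum_abs)
    also have "\<dots> \<le> (\<Sum>i<p. e * real b)"
      unfolding abs_mult using bnd[OF l] e by (intro sum_mono mult_mono) (auto intro: order.trans[OF abs_ge_zero])
    finally show ?thesis by (simp add: mult_ac)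
  qed
  \<comment> \<open>rounding down fixes the multiples of \<open>1/N\<close>, so a coordinate equal to \<open>1\<close> or \<open>-1\<close> stays on the boundary\<close>
  define k where "k = (\<lambda>i\<in>{..<p}. \<lfloor>w i * real N\<rfloor>)"
  define r where "r = \<lfloor>c * real N\<rfloor>"
  have kclose: "\<bar>of_int (k i) / real N - w i\<bar> \<le> 1 / real N" if i: "i < p" for i
  proof -
    have "\<bar>of_int (k i) - w i * real N\<bar> \<le> 1" using i unfolding k_def by simp linarith
    then have "\<bar>of_int (k i) - w i * real N\<bar> / real N \<le> 1 / real N" using Npos by (intro divide_right_mono) auto
    moreover have "\<bar>of_int (k i) - w i * real N\<bar> / real N = \<bar>of_int (k i) / real N - w i\<bar>"
      by (rule abs_diff_scaled[OF Npos])
    ultimately show ?thesis by simp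
  qed
  have knet: "k \<in> net p N"
  proof -
    have "\<lfloor>w i * real N\<rfloor> \<in> {- int N..int N}" if i: "i < p" for i
    proof -
      have "\<bar>w i * real N\<bar> \<le> 1 * real N" unfolding abs_mult using w1[OF i] by (intro mult_mono) auto
      then have "- real N \<le> w i * real N" "w i * real N \<le> real N" by linarith+
      then have "real_of_int (- int N) \<le> w i * real N" "w i * real N \<le> real_of_int (int N)" by simp_all
      then show ?thesis unfolding atLeastAtMost_iff le_floor_iff using floor_mono[of "w i * real N" "real_of_int (int N)"] by simp
    qed
    moreover have "\<bar>k i0\<bar> = int N"
    proof -
      have "w i0 = 1 \<or> w i0 = -1" using w0 by linarith
      then have "w i0 * real N = real_of_int (int N) \<or> w i0 * real N = real_of_int (- int N)" by auto
      then have "\<lfloor>w i0 * real N\<rfloor> = int N \<or> \<lfloor>w i0 * real N\<rfloor> = - int N" by (metis floor_of_int)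
      then show ?thesis using i0 by (auto simp: k_def)
    qed
    ultimately show ?thesis using i0 unfolding net_def k_def by auto
  qed
  have rclose: "\<bar>of_int r / real N - c\<bar> \<le> 1 / real N"
  proof -
    have "\<bar>of_int r - c * real N\<bar> \<le> 1" unfolding r_def by linarith
    then have "\<bar>of_int r - c * real N\<bar> / real N \<le> 1 / real N" using Npos by (intro divide_right_mono) auto
    moreover have "\<bar>of_int r - c * real N\<bar> / real N = \<bar>of_int r / real N - c\<bar>"
      by (rule abs_diff_scaled[OF Npos])
    ultimately show ?thesis by simp
  qed
  have rb: "r \<in> {- int (p * b * N + 1)..int (p * b * N + 1)}"
  proof -
    have "\<bar>\<Sum>l=1..n. z l\<bar> \<le> (\<Sum>l=1..n. real p * real b * 1)"
      unfolding z_def by (intro order.trans[OF sum_abs] sum_mono form_bound w1) auto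
    then have "\<bar>c\<bar> \<le> real p * real b" using npos by (simp add: c_def abs_divide pos_divide_le_eq mult_ac)
    then have "\<bar>c * real N\<bar> \<le> real p * real b * real N" unfolding abs_mult by (intro mult_mono) auto
    then have "\<bar>real_of_int r\<bar> \<le> real (p * b * N + 1)" unfolding r_def of_nat_add of_nat_mult by linarith
    then have "real_of_int \<bar>r\<bar> \<le> real_of_int (int (p * b * N + 1))" by simp
    then have "\<bar>r\<bar> \<le> int (p * b * N + 1)" by (simp only: of_int_le_iff)
    then show ?thesis unfolding atLeastAtMost_iff abs_le_iff by linarith
  qed
  show ?thesis
  proof (rule that[OF knet rb])
    fix l assume l: "l \<in> {1..n}"
    have "centered_form p \<mu> (\<lambda>i. of_int (k i) / real N) (x l) - z l = centered_form p \<mu> (\<lambda>i. of_int (k i) / real N - w i) (x l)"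
      unfolding centered_form_def z_def sum_subtractf[symmetric] by (simp add: left_diff_distrib)
    then have "\<bar>centered_form p \<mu> (\<lambda>i. of_int (k i) / real N) (x l) - z l\<bar> \<le> real p * real b * (1 / real N)"
      using form_bound[OF l kclose] by simp
    then have "\<bar>centered_form p \<mu> (\<lambda>i. of_int (k i) / real N) (x l) - of_int r / real N\<bar>
      \<le> real p * real b * (1 / real N) + 1 / real N + 1 / real N"
      using zc[OF l] rclose by linarith
    also have "\<dots> = real (p * b + 2) / real N" by (simp add: add_divide_distrib)
    finally show "\<bar>centered_form p \<mu> (\<lambda>i. of_int (k i) / real N) (x l) - of_int r / real N\<bar> \<le> real (p * b + 2) / real N" .
  qed
qed

section \<open>Almost sure nonvanishing of empirical covariances\<close>

lemma emp_cov_first: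
  assumes n: "2 \<le> n" and ij: "i < p" "j < p"
  shows "emp_cov n p x $$ (i,j) = 0 \<longleftrightarrow>
    real n * (x 1 i * x 1 j + (\<Sum>l=2..n. x l i * x l j)) =
    (x 1 i + (\<Sum>l=2..n. x l i)) * (x 1 j + (\<Sum>l=2..n. x l j))"
proof -
  have split: "(\<Sum>l=1..n. f l) = f 1 + (\<Sum>l=2..n. f l)" for f :: "nat \<Rightarrow> real"
  proof -
    have "{1..n} = insert 1 {2..n}" using n by auto
    then show ?thesis by simp
  qed
  have npos: "0 < real n" using n by simp
  have "emp_cov n p x $$ (i,j) = (\<Sum>l=1..n. x l i * x l j) / real n - ((\<Sum>l=1..n. x l i) / real n) * ((\<Sum>l=1..n. x l j) / real n)"
    using emp_cov_entry[of n i p j x 0 0] n ij by simp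
  also have "\<dots> = (real n * (\<Sum>l=1..n. x l i * x l j) - (\<Sum>l=1..n. x l i) * (\<Sum>l=1..n. x l j)) / (real n)\<^sup>2"
    using npos by (simp add: diff_divide_distrib power2_eq_square)
  finally have eq: "emp_cov n p x $$ (i,j) = \<dots>" .
  have nz: "(real n)\<^sup>2 \<noteq> 0" using npos by simp
  show ?thesis unfolding eq split divide_eq_0_iff right_minus_eq by (simp only: nz simp_thms)
qed

lemma hyperplane_null:
  assumes J: "finite J" "j \<in> J"
  shows "AE x in Pi\<^sub>M J (\<lambda>_::nat. lborel :: real measure). x j \<noteq> c"
proof (rule AE_I)
  let ?N = "Pi\<^sub>E J (\<lambda>k. if k = j then {c} else UNIV)"
  show "{x \<in> space (Pi\<^sub>M J (\<lambda>_. lborel)). \<not> x j \<noteq> c} \<subseteq> ?N"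
    by (auto simp: space_PiM PiE_def Pi_def)
  have "emeasure (Pi\<^sub>M J (\<lambda>_. lborel)) ?N = (\<Prod>k\<in>J. emeasure lborel (if k = j then {c} else UNIV :: real set))"
    using J by (intro lborel_product.emeasure_PiM) auto
  also have "\<dots> = 0" using J by (intro prod_zero bexI[of _ j]) auto
  finally show "emeasure (Pi\<^sub>M J (\<lambda>_. lborel)) ?N = 0" .
  show "?N \<in> sets (Pi\<^sub>M J (\<lambda>_. lborel))" using J by (intro sets_PiM_I_finite) auto
qed

text \<open>For almost every value of \<open>x\<^sub>j\<close> the equation is affine in \<open>x\<^sub>i\<close> with nonzero slope \<open>(n - 1) x\<^sub>j - B\<close>.\<close>

lemma curve_null:
  assumes n: "2 \<le> n" and ij: "i < p" "j < p" "i \<noteq> j"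
  shows "AE x in lborel_vec p. real n * (x i * x j + C) \<noteq> (x i + A) * (x j + B)"
proof -
  define J where "J = {..<p} - {i}"
  define LJ where "LJ = Pi\<^sub>M J (\<lambda>_::nat. lborel :: real measure)"
  have ins: "{..<p} = insert i J" and iJ: "i \<notin> J" "finite J" "j \<in> J" using ij by (auto simp: J_def)
  let ?N = "{x \<in> space (lborel_vec p). real n * (x i * x j + C) = (x i + A) * (x j + B)}"
  have N[measurable]: "?N \<in> sets (lborel_vec p)"
    using component_measurable[OF ij(1)] component_measurable[OF ij(2)] by measurable
  have "emeasure (lborel_vec p) ?N = (\<integral>\<^sup>+x. indicator ?N x \<partial>lborel_vec p)" by simp
  also have "\<dots> = (\<integral>\<^sup>+x. (\<integral>\<^sup>+y. indicator ?N (x(i := y)) \<partial>lborel) \<partial>LJ)"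
    unfolding ins LJ_def by (rule lborel_product.product_nn_integral_insert[OF iJ(2,1)]) (use N in \<open>simp add: ins\<close>)
  also have "\<dots> = (\<integral>\<^sup>+x. 0 \<partial>LJ)"
  proof (rule nn_integral_cong_AE)
    have "AE x in LJ. x j \<noteq> B / (real n - 1)" unfolding LJ_def by (rule hyperplane_null[OF iJ(2,3)])
    then show "AE x in LJ. (\<integral>\<^sup>+y. indicator ?N (x(i := y)) \<partial>lborel) = 0"
    proof (rule AE_mp, intro AE_I2 impI)
      fix x assume xj: "x j \<noteq> B / (real n - 1)"
      define q where "q = (real n - 1) * x j - B"
      have "q \<noteq> 0" using xj n by (simp add: q_def field_simps)
      have sub: "indicator ?N (x(i := y)) \<le> (indicator {(A * (x j + B) - real n * C) / q} y :: ennreal)" for y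
      proof (cases "x(i := y) \<in> ?N")
        case True
        then have "y * q = A * (x j + B) - real n * C" using ij(3) by (simp add: q_def algebra_simps)
        then have "y = (A * (x j + B) - real n * C) / q" using \<open>q \<noteq> 0\<close> by (simp add: eq_divide_eq)
        then show ?thesis by (simp add: indicator_def)
      qed simp
      have "(\<integral>\<^sup>+y. indicator ?N (x(i := y)) \<partial>lborel) \<le> (\<integral>\<^sup>+y. indicator {(A * (x j + B) - real n * C) / q} y \<partial>lborel)"
        by (intro nn_integral_mono sub)
      also have "\<dots> = 0" by simp
      finally show "(\<integral>\<^sup>+y. indicator ?N (x(i := y)) \<partial>lborel) = 0" by simp
    qed
  qed
  finally have "emeasure (lborel_vec p) ?N = 0" by simp
  then show ?thesis using N by (intro AE_I[of _ _ ?N]) auto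
qed

text \<open>The first observation is independent of the others and has a density. With the others fixed, the
  equation that the covariance vanishes defines a null set of values of the first observation.\<close>

lemma (in prob_space) emp_cov_nonzero_AE:
  assumes n: "2 \<le> n" and ij: "i < p" "j < p" "i \<noteq> j"
    and ind: "indep_vars (\<lambda>_. lborel_vec p) X {1..n}"
    and X1: "distributed M (lborel_vec p) (X 1) f"
  shows "AE \<omega> in M. emp_cov n p (\<lambda>l. X l \<omega>) $$ (i,j) \<noteq> 0"
proof -
  let ?L = "lborel_vec p"
  let ?R = "Pi\<^sub>M {2..n} (\<lambda>_. ?L)" and ?R1 = "Pi\<^sub>M {1} (\<lambda>_. ?L)"
  have "indep_var ?R1 (\<lambda>\<omega>. restrict (\<lambda>l. X l \<omega>) {1}) ?R (\<lambda>\<omega>. restrict (\<lambda>l. X l \<omega>) {2..n})"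
    using n by (intro indep_var_restrict[OF ind]) auto
  then have iv: "indep_var ?R1 (\<lambda>\<omega>. restrict (\<lambda>l. X l \<omega>) {1}) ?R (\<lambda>\<omega>. restrict (\<lambda>l. X l \<omega>) {2..n})" (is "indep_var _ ?U _ ?Y")
    .
  have Xm[measurable]: "X 1 \<in> measurable M ?L" using X1 by (rule distributed_measurable)
  have Um[measurable]: "?U \<in> measurable M ?R1" and Ym[measurable]: "?Y \<in> measurable M ?R"
    and prod: "distr M ?R1 ?U \<Otimes>\<^sub>M distr M ?R ?Y = distr M (?R1 \<Otimes>\<^sub>M ?R) (\<lambda>\<omega>. (?U \<omega>, ?Y \<omega>))"
    using iv unfolding indep_var_distribution_eq by auto
  interpret D1: prob_space "distr M ?R1 ?U" by (rule prob_space_distr[OF Um])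
  interpret D2: prob_space "distr M ?R ?Y" by (rule prob_space_distr[OF Ym])
  interpret P: pair_prob_space "distr M ?R1 ?U" "distr M ?R ?Y" ..
  define Q where "Q x h \<longleftrightarrow> real n * (x i * x j + (\<Sum>l=2..n. h l i * h l j)) =
    (x i + (\<Sum>l=2..n. h l i)) * (x j + (\<Sum>l=2..n. h l j))" for x :: "nat \<Rightarrow> real" and h :: "nat \<Rightarrow> nat \<Rightarrow> real"
  have hm: "(\<lambda>h. h l k) \<in> borel_measurable ?R" if "l \<in> {2..n}" "k < p" for l k
    using measurable_compose[OF measurable_component_singleton[OF that(1)] component_measurable[OF that(2)]] .
  have [measurable]: "(\<lambda>h. \<Sum>l=2..n. h l i * h l j) \<in> borel_measurable ?R"
    "(\<lambda>h. \<Sum>l=2..n. h l i) \<in> borel_measurable ?R" "(\<lambda>h. \<Sum>l=2..n. h l j) \<in> borel_measurable ?R"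
    using ij by (auto intro!: borel_measurable_sum borel_measurable_times hm)
  note [measurable] = component_measurable[OF ij(1)] component_measurable[OF ij(2)]
  have first[measurable]: "(\<lambda>g. g 1) \<in> measurable ?R1 ?L" by (rule measurable_component_singleton) simp
  have Qm[measurable]: "Measurable.pred (?L \<Otimes>\<^sub>M ?R) (\<lambda>z. Q (fst z) (snd z))"
    unfolding Q_def by measurable
  have Qm1[measurable]: "Measurable.pred (?R1 \<Otimes>\<^sub>M ?R) (\<lambda>z. Q (fst z 1) (snd z))"
  proof -
    have "(\<lambda>z. (fst z 1, snd z)) \<in> measurable (?R1 \<Otimes>\<^sub>M ?R) (?L \<Otimes>\<^sub>M ?R)"
      by (intro measurable_Pair measurable_compose[OF measurable_fst first] measurable_snd)
    from measurable_compose[OF this Qm] show ?thesis by simp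
  qed
  have Qmh[measurable]: "Measurable.pred ?L (\<lambda>x. Q x h)" for h
  proof -
    have "(\<lambda>x. real n * (x i * x j + (\<Sum>l=2..n. h l i * h l j))) \<in> borel_measurable ?L"
      "(\<lambda>x. (x i + (\<Sum>l=2..n. h l i)) * (x j + (\<Sum>l=2..n. h l j))) \<in> borel_measurable ?L"
      by (rule borel_measurable_times borel_measurable_add borel_measurable_const
          component_measurable[OF ij(1)] component_measurable[OF ij(2)])+
    then show ?thesis unfolding Q_def pred_def by (rule borel_measurable_eq)
  qed
  have dens: "distr M ?L (X 1) = density ?L f" and fm: "f \<in> borel_measurable ?L" using X1 by (auto simp: distributed_def)
  have "AE h in distr M ?R ?Y. AE g in distr M ?R1 ?U. \<not> Q (g 1) h"
  proof (rule AE_I2)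
    fix h
    have "AE x in ?L. \<not> Q x h" unfolding Q_def by (rule curve_null[OF n ij])
    then have "AE x in distr M ?L (X 1). \<not> Q x h" unfolding dens AE_density[OF fm] by (rule AE_mp) auto
    then have ae: "AE \<omega> in M. \<not> Q (X 1 \<omega>) h"
      using AE_distr_iff[OF Xm sets.sets_Collect_neg[OF Qmh[of h, unfolded pred_def]]] by blast
    have "Measurable.pred ?R1 (\<lambda>g. Q (g 1) h)" by (rule measurable_compose[OF first Qmh])
    then have "{g \<in> space ?R1. \<not> Q (g 1) h} \<in> sets ?R1" unfolding pred_def by (rule sets.sets_Collect_neg)
    from AE_distr_iff[OF Um this] show "AE g in distr M ?R1 ?U. \<not> Q (g 1) h" using ae by simp
  qed
  moreover have sets_eq: "sets (distr M ?R1 ?U \<Otimes>\<^sub>M distr M ?R ?Y) = sets (?R1 \<Otimes>\<^sub>M ?R)"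
    by (intro sets_pair_measure_cong sets_distr)
  have mset: "{z \<in> space (distr M ?R1 ?U \<Otimes>\<^sub>M distr M ?R ?Y). \<not> Q (fst z 1) (snd z)} \<in> sets (distr M ?R1 ?U \<Otimes>\<^sub>M distr M ?R ?Y)"
    unfolding sets_eq sets_eq_imp_space_eq[OF sets_eq]
    using Qm1 unfolding pred_def by (rule sets.sets_Collect_neg)
  ultimately have "AE g in distr M ?R1 ?U. AE h in distr M ?R ?Y. \<not> Q (g 1) h"
    using P.AE_commute[OF mset] by simp
  then have "AE z in distr M ?R1 ?U \<Otimes>\<^sub>M distr M ?R ?Y. \<not> Q (fst z 1) (snd z)"
    using P.AE_pair_measure[OF mset] by simp
  then have ae: "AE z in distr M (?R1 \<Otimes>\<^sub>M ?R) (\<lambda>\<omega>. (?U \<omega>, ?Y \<omega>)). \<not> Q (fst z 1) (snd z)"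
    unfolding prod .
  have UY: "(\<lambda>\<omega>. (?U \<omega>, ?Y \<omega>)) \<in> measurable M (?R1 \<Otimes>\<^sub>M ?R)" using Um Ym by (rule measurable_Pair)
  have "AE \<omega> in M. \<not> Q (X 1 \<omega>) (?Y \<omega>)"
    using ae AE_distr_iff[OF UY sets.sets_Collect_neg[OF Qm1[unfolded pred_def]]] by simp
  then show ?thesis
  proof (rule AE_mp, intro AE_I2 impI)
    fix \<omega> assume "\<not> Q (X 1 \<omega>) (?Y \<omega>)"
    then show "emp_cov n p (\<lambda>l. X l \<omega>) $$ (i,j) \<noteq> 0"
      unfolding emp_cov_first[OF n ij(1,2)] Q_def by simp
  qed
qed

section \<open>The event on which the sample is concentrated\<close>

lemma (in prob_space) emp_cov_measurable:
  assumes X: "\<And>l. l \<in> {1..n} \<Longrightarrow> X l \<in> measurable M (lborel_vec p)" and ij: "i < p" "j < p"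
  shows "(\<lambda>\<omega>. emp_cov n p (\<lambda>l. X l \<omega>) $$ (i,j)) \<in> borel_measurable M"
proof -
  have c: "(\<lambda>\<omega>. X l \<omega> k) \<in> borel_measurable M" if "l \<in> {1..n}" "k < p" for l k
    by (rule measurable_compose[OF X[OF that(1)] component_measurable[OF that(2)]])
  have m: "(\<lambda>\<omega>. emp_mean n (\<lambda>l. X l \<omega>) k) \<in> borel_measurable M" if "k < p" for k
    unfolding emp_mean_def using c that by (intro borel_measurable_divide borel_measurable_sum) auto
  have "(\<lambda>\<omega>. (\<Sum>l=1..n. (X l \<omega> i - emp_mean n (\<lambda>l. X l \<omega>) i) * (X l \<omega> j - emp_mean n (\<lambda>l. X l \<omega>) j)) / real n) \<in> borel_measurable M"
    using c m ij by (intro borel_measurable_divide borel_measurable_sum borel_measurable_times borel_measurable_diff) auto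
  then show ?thesis using ij by (simp add: emp_cov_def)
qed

text \<open>The complement is a union of four kinds of events: a first or a second moment in one of at most \<open>3 p\<^sup>2\<close>
  directions deviates; all observations are nearly constant along a net direction; an empirical covariance is zero. The third
  kind is controlled by independence, each observation contributing a factor \<open>t / sqrt l\<close>, against the number of net points.\<close>

lemma (in prob_space) concentration_event:
  fixes X :: "nat \<Rightarrow> 'a \<Rightarrow> nat \<Rightarrow> real"
  assumes n: "2 \<le> n" and p: "1 \<le> p" and N: "1 \<le> N"
    and \<mu>: "\<mu> \<in> carrier_vec p" and \<Sigma>: "sym_mat p \<Sigma>"
    and l: "0 < l" "\<And>x. l * sqnorm p x \<le> qform p \<Sigma> x" and u: "\<And>x. qform p \<Sigma> x \<le> u * sqnorm p x"
    and sample: "gaussian_sample M n p \<mu> \<Sigma> X"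
    and \<tau>: "0 < \<tau>" "\<tau> \<le> 1" "\<tau> \<le> 12 * u" and nu: "u + 1 \<le> real n"
    and c: "c \<le> 1 / (192 * u\<^sup>2)" "c \<le> 1 / (4 * u)"
  obtains G where "G \<in> events"
    "1 - (12 * (real p)\<^sup>2 * exp (- c * real n * \<tau>\<^sup>2) +
       real ((2 * N + 1) ^ p * (2 * (p * n * N + 1) + 1)) * (real (p * n + 2) / real N / sqrt l) ^ n) \<le> prob G"
    "\<And>\<omega> i j. \<omega> \<in> G \<Longrightarrow> i < p \<Longrightarrow> j < p \<Longrightarrow> \<bar>emp_cov n p (\<lambda>l. X l \<omega>) $$ (i,j) - \<Sigma> $$ (i,j)\<bar> \<le> 2 * \<tau>"
    "\<And>\<omega> y. \<omega> \<in> G \<Longrightarrow> (1 / (real n * real p * (real N)\<^sup>2)) * sqnorm p y \<le> qform p (emp_cov n p (\<lambda>l. X l \<omega>)) y"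
    "\<And>\<omega> i j. \<omega> \<in> G \<Longrightarrow> i < p \<Longrightarrow> j < p \<Longrightarrow> i \<noteq> j \<Longrightarrow> emp_cov n p (\<lambda>l. X l \<omega>) $$ (i,j) \<noteq> 0"
proof -
  have n1: "1 \<le> n" using n by simp
  have npos: "0 < real n" using n by simp
  have Npos: "0 < real N" using N by simp
  have ind: "indep_vars (\<lambda>_. lborel_vec p) X {1..n}"
    and dist: "\<And>l. l \<in> {1..n} \<Longrightarrow> distributed M (lborel_vec p) (X l) (\<lambda>x. ennreal (gaussian_density p \<mu> \<Sigma> x))"
    using sample unfolding gaussian_sample_def by auto
  have Xm: "X l \<in> measurable M (lborel_vec p)" if "l \<in> {1..n}" for l
    by (rule distributed_measurable[OF dist[OF that]])
  define S where "S \<omega> = emp_cov n p (\<lambda>l. X l \<omega>)" for \<omega>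
  define Z where "Z w l \<omega> = centered_form p \<mu> w (X l \<omega>)" for w l \<omega>
  have Zind: "indep_vars (\<lambda>_. borel) (Z w) {1..n}" for w
    unfolding Z_def[abs_def] by (rule indep_vars_compose2[OF ind]) (rule centered_form_measurable)
  have Zm: "Z w l \<in> borel_measurable M" if "l \<in> {1..n}" for w l
    unfolding Z_def[abs_def] by (rule measurable_compose[OF Xm[OF that] centered_form_measurable])
  have Znormal: "distributed M lborel (Z w l) (normal_density 0 (sqrt (qform p \<Sigma> w)))"
    if "l \<in> {1..n}" "0 < qform p \<Sigma> w" for w l
    unfolding Z_def[abs_def] by (rule linear_form_normal[OF \<mu> \<Sigma> assms(6,7) prob_space_axioms dist[OF that(1)] that(2)])
  define D where "D = {(i,j,s::real). i < p \<and> j < p \<and> s \<in> {-1,0,1} \<and> (i \<noteq> j \<or> s = 0)}"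
  have Dsub: "D \<subseteq> {..<p} \<times> {..<p} \<times> {-1,0,1}" by (auto simp: D_def)
  have Dfin: "finite D" by (rule finite_subset[OF Dsub]) auto
  have "card D \<le> card ({..<p} \<times> {..<p} \<times> {-1,0,1::real})" by (rule card_mono[OF _ Dsub]) auto
  also have "\<dots> = 3 * p\<^sup>2" by (simp add: card_cartesian_product power2_eq_square)
  finally have Dcard: "real (card D) \<le> 3 * (real p)\<^sup>2"
    by (metis of_nat_le_iff of_nat_mult of_nat_numeral of_nat_power)
  define dir where "dir d = (case d of (i,j,s) \<Rightarrow> pair_dir i j s)" for d :: "nat \<times> nat \<times> real"
  have dirv: "l \<le> qform p \<Sigma> (dir d)" "qform p \<Sigma> (dir d) \<le> 2 * u" if d: "d \<in> D" for d
  proof -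
    obtain i j s where [simp]: "d = (i,j,s)" by (cases d)
    have ij: "i < p" "j < p" "i \<noteq> j \<or> s = 0" "s \<in> {-1,0,1}" using d by (auto simp: D_def)
    have sq: "sqnorm p (dir d) = 1 + s\<^sup>2" using sqnorm_pair_dir[OF ij(1-3)] by (simp add: dir_def)
    have "l * 1 \<le> l * sqnorm p (dir d)" unfolding sq using l by (intro mult_left_mono) auto
    then show "l \<le> qform p \<Sigma> (dir d)" using l(2)[of "dir d"] by simp
    have "0 < u" using l u \<tau> by linarith
    have "qform p \<Sigma> (dir d) \<le> u * (1 + s\<^sup>2)" using u[of "dir d"] unfolding sq .
    also have "\<dots> \<le> u * 2" using \<open>0 < u\<close> ij(4) by (intro mult_left_mono) auto
    finally show "qform p \<Sigma> (dir d) \<le> 2 * u" by simp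
  qed
  have upos: "0 < u" using \<tau> by linarith
  define bad1 where "bad1 d = {\<omega> \<in> space M. real n * \<tau> \<le> \<bar>\<Sum>l=1..n. Z (dir d) l \<omega>\<bar>}" for d
  define bad2 where "bad2 d = {\<omega> \<in> space M. real n * \<tau> \<le> \<bar>\<Sum>l=1..n. (Z (dir d) l \<omega>)\<^sup>2 - qform p \<Sigma> (dir d)\<bar>}" for d
  have sum1: "(\<lambda>\<omega>. \<Sum>l=1..n. Z w l \<omega>) \<in> borel_measurable M" for w
    using Zm by (intro borel_measurable_sum) auto
  have sum2: "(\<lambda>\<omega>. \<Sum>l=1..n. (Z w l \<omega>)\<^sup>2 - b) \<in> borel_measurable M" for w b
    using Zm by (intro borel_measurable_sum borel_measurable_diff borel_measurable_power) auto
  have b1m: "bad1 d \<in> events" for d unfolding bad1_def using sum1 by measurable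
  have b2m: "bad2 d \<in> events" for d unfolding bad2_def using sum2 by measurable
  have b1: "prob (bad1 d) \<le> 2 * exp (- c * real n * \<tau>\<^sup>2)" if d: "d \<in> D" for d
  proof -
    have "prob (bad1 d) \<le> 2 * exp (- real (card {1..n}) * \<tau>\<^sup>2 / (2 * (2 * u)))"
      using normal_sum_tail[OF _ Zind Znormal _ dirv(2)[OF d] \<tau>(1)] dirv(1)[OF d] l(1)
      by (simp add: bad1_def)
    also have "- real (card {1..n}) * \<tau>\<^sup>2 / (2 * (2 * u)) \<le> - c * real n * \<tau>\<^sup>2"
      using mult_right_mono[OF c(2), of "real n * \<tau>\<^sup>2"] by simp
    finally show ?thesis by simp
  qed
  have b2: "prob (bad2 d) \<le> 2 * exp (- c * real n * \<tau>\<^sup>2)" if d: "d \<in> D" for d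
  proof -
    have "prob (bad2 d) \<le> 2 * exp (- real (card {1..n}) * \<tau>\<^sup>2 / (48 * (2 * u)\<^sup>2))"
      using normal_square_sum_tail[OF _ Zind Znormal _ dirv(2)[OF d] \<tau>(1)] dirv(1)[OF d] l(1) \<tau>(3)
      by (simp add: bad2_def)
    also have "- real (card {1..n}) * \<tau>\<^sup>2 / (48 * (2 * u)\<^sup>2) \<le> - c * real n * \<tau>\<^sup>2"
      using mult_right_mono[OF c(1), of "real n * \<tau>\<^sup>2"] by (simp add: power_mult_distrib)
    finally show ?thesis by simp
  qed
  define t where "t = real (p * n + 2) / real N"
  have tpos: "0 \<le> t" by (simp add: t_def)
  define E where "E = net p N \<times> {- int (p * n * N + 1)..int (p * n * N + 1)}"
  have Efin: "finite E" unfolding E_def using finite_net by auto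
  have Ecard: "card E \<le> (2 * N + 1) ^ p * (2 * (p * n * N + 1) + 1)"
  proof -
    have "card {- int a..int a} = 2 * a + 1" for a :: nat by simp
    from this[of "p * n * N + 1"] show ?thesis
      unfolding E_def card_cartesian_product by (simp only: mult_le_mono1[OF card_net])
  qed
  define wk where "wk k i = real_of_int (k i) / real N" for k :: "nat \<Rightarrow> int" and i :: nat
  define bad3 where "bad3 kr = (\<Inter>l\<in>{1..n}. Z (wk (fst kr)) l -` {of_int (snd kr) / real N - t..of_int (snd kr) / real N + t} \<inter> space M)" for kr :: "(nat \<Rightarrow> int) \<times> int"
  have b3m: "bad3 kr \<in> events" for kr
    unfolding bad3_def using n Zm by (intro sets.finite_INT measurable_sets[OF Zm]) auto
  have b3: "prob (bad3 kr) \<le> (t / sqrt l) ^ n" if kr: "kr \<in> E" for kr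
  proof -
    let ?w = "wk (fst kr)" and ?c = "of_int (snd kr) / real N :: real"
    have "l * 1 \<le> l * sqnorm p ?w"
      using net_sqnorm_ge[of "fst kr" p N] kr N l unfolding wk_def[abs_def] E_def by (intro mult_left_mono) auto
    then have v: "l \<le> qform p \<Sigma> ?w" using l(2)[of ?w] by simp
    have each: "prob (Z ?w i -` {?c - t..?c + t} \<inter> space M) \<le> t / sqrt l" if i: "i \<in> {1..n}" for i
    proof -
      have "prob {\<omega> \<in> space M. \<bar>Z ?w i \<omega> - ?c\<bar> \<le> t} \<le> t / sqrt (qform p \<Sigma> ?w)"
        by (rule normal_small_ball[OF _ Zind Znormal _ order.refl i tpos]) (use v l(1) in auto)
      also have "\<dots> \<le> t / sqrt l" using v l(1) tpos by (intro divide_left_mono) auto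
      finally show ?thesis by (simp add: abs_le_iff vimage_def Int_def conj_commute) (smt (verit) Collect_cong)
    qed
    have "prob (bad3 kr) = (\<Prod>i\<in>{1..n}. prob (Z ?w i -` {?c - t..?c + t} \<inter> space M))"
      unfolding bad3_def using n by (intro indep_varsD_finite[OF Zind]) auto
    also have "\<dots> \<le> (\<Prod>i\<in>{1..n}. t / sqrt l)" using each by (intro prod_mono) auto
    finally show ?thesis by simp
  qed
  define F where "F = {(i,j). i < p \<and> j < p \<and> i \<noteq> j}"
  have Ffin: "finite F" by (rule finite_subset[of _ "{..<p} \<times> {..<p}"]) (auto simp: F_def)
  define bad4 where "bad4 ij = {\<omega> \<in> space M. S \<omega> $$ ij = 0}" for ij
  have b4m: "bad4 ij \<in> events" if ijF: "ij \<in> F" for ij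
  proof -
    obtain i j where ij: "ij = (i,j)" "i < p" "j < p" using ijF by (auto simp: F_def)
    have "(\<lambda>\<omega>. S \<omega> $$ ij) \<in> borel_measurable M"
      unfolding S_def ij(1) by (rule emp_cov_measurable[OF Xm ij(2,3)])
    then show ?thesis unfolding bad4_def by measurable
  qed
  have b4: "prob (bad4 ij) = 0" if ijF: "ij \<in> F" for ij
  proof -
    obtain i j where ij: "ij = (i,j)" "i < p" "j < p" "i \<noteq> j" using ijF by (auto simp: F_def)
    have "AE \<omega> in M. \<not> (S \<omega> $$ ij = 0)"
      unfolding S_def ij(1) by (rule emp_cov_nonzero_AE[OF n ij(2-4) ind dist]) (use n in auto)
    then show ?thesis unfolding bad4_def using b4m[OF ijF] by (subst (asm) prob_Collect_eq_0[symmetric]) (auto simp: bad4_def)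
  qed
  define bad where "bad = (\<Union>d\<in>D. bad1 d) \<union> (\<Union>d\<in>D. bad2 d) \<union> (\<Union>kr\<in>E. bad3 kr) \<union> (\<Union>ij\<in>F. bad4 ij)"
  have U1: "(\<Union>d\<in>D. bad1 d) \<in> events" "(\<Union>d\<in>D. bad2 d) \<in> events" "(\<Union>kr\<in>E. bad3 kr) \<in> events" "(\<Union>ij\<in>F. bad4 ij) \<in> events"
    using Dfin Efin Ffin b1m b2m b3m b4m by (auto intro!: sets.finite_UN)
  then have badm: "bad \<in> events" unfolding bad_def by auto
  have p1: "prob (\<Union>d\<in>D. bad1 d) \<le> 3 * (real p)\<^sup>2 * (2 * exp (- c * real n * \<tau>\<^sup>2))"
  proof -
    have "prob (\<Union>d\<in>D. bad1 d) \<le> (\<Sum>d\<in>D. prob (bad1 d))" using Dfin b1m by (intro measure_UNION_le) auto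
    also have "\<dots> \<le> real (card D) * (2 * exp (- c * real n * \<tau>\<^sup>2))" by (rule sum_bounded_above[OF b1])
    also have "\<dots> \<le> 3 * (real p)\<^sup>2 * (2 * exp (- c * real n * \<tau>\<^sup>2))" using Dcard by (intro mult_right_mono) auto
    finally show ?thesis .
  qed
  have p2: "prob (\<Union>d\<in>D. bad2 d) \<le> 3 * (real p)\<^sup>2 * (2 * exp (- c * real n * \<tau>\<^sup>2))"
  proof -
    have "prob (\<Union>d\<in>D. bad2 d) \<le> (\<Sum>d\<in>D. prob (bad2 d))" using Dfin b2m by (intro measure_UNION_le) auto
    also have "\<dots> \<le> real (card D) * (2 * exp (- c * real n * \<tau>\<^sup>2))" by (rule sum_bounded_above[OF b2])
    also have "\<dots> \<le> 3 * (real p)\<^sup>2 * (2 * exp (- c * real n * \<tau>\<^sup>2))" using Dcard by (intro mult_right_mono) auto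
    finally show ?thesis .
  qed
  have p3: "prob (\<Union>kr\<in>E. bad3 kr) \<le> real ((2 * N + 1) ^ p * (2 * (p * n * N + 1) + 1)) * (t / sqrt l) ^ n"
  proof -
    have "prob (\<Union>kr\<in>E. bad3 kr) \<le> (\<Sum>kr\<in>E. prob (bad3 kr))" using Efin b3m by (intro measure_UNION_le) auto
    also have "\<dots> \<le> real (card E) * (t / sqrt l) ^ n" by (rule sum_bounded_above[OF b3])
    also have "\<dots> \<le> real ((2 * N + 1) ^ p * (2 * (p * n * N + 1) + 1)) * (t / sqrt l) ^ n"
      using Ecard tpos l(1) by (intro mult_right_mono) (simp_all only: of_nat_le_iff zero_le_power divide_nonneg_nonneg real_sqrt_ge_zero less_imp_le)
    finally show ?thesis .
  qed
  have p4: "prob (\<Union>ij\<in>F. bad4 ij) \<le> 0"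
  proof -
    have "prob (\<Union>ij\<in>F. bad4 ij) \<le> (\<Sum>ij\<in>F. prob (bad4 ij))" using Ffin b4m by (intro measure_UNION_le) auto
    then show ?thesis using b4 by simp
  qed
  have "prob bad \<le> prob (\<Union>d\<in>D. bad1 d) + prob (\<Union>d\<in>D. bad2 d) + prob (\<Union>kr\<in>E. bad3 kr) + prob (\<Union>ij\<in>F. bad4 ij)"
    unfolding bad_def using U1
    by (intro order.trans[OF measure_Un_le] add_mono order.refl) auto
  then have pb: "prob bad \<le> 12 * (real p)\<^sup>2 * exp (- c * real n * \<tau>\<^sup>2) + real ((2 * N + 1) ^ p * (2 * (p * n * N + 1) + 1)) * (t / sqrt l) ^ n"
    using p1 p2 p3 p4 by linarith
  show ?thesis
  proof (rule that[of "space M - bad"])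
    show "space M - bad \<in> events" using badm by auto
    show "1 - (12 * (real p)\<^sup>2 * exp (- c * real n * \<tau>\<^sup>2) +
       real ((2 * N + 1) ^ p * (2 * (p * n * N + 1) + 1)) * (real (p * n + 2) / real N / sqrt l) ^ n) \<le> prob (space M - bad)"
      unfolding prob_compl[OF badm] using pb unfolding t_def by linarith
    fix \<omega> assume \<omega>: "\<omega> \<in> space M - bad"
    have mean: "\<bar>\<Sum>l=1..n. centered_form p \<mu> (pair_dir i j s) (X l \<omega>)\<bar> \<le> real n * \<tau>"
      and square: "\<bar>\<Sum>l=1..n. (centered_form p \<mu> (pair_dir i j s) (X l \<omega>))\<^sup>2 - qform p \<Sigma> (pair_dir i j s)\<bar> \<le> real n * \<tau>"
      if "i < p" "j < p" "s \<in> {-1,0,1}" "i \<noteq> j \<or> s = 0" for i j s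
    proof -
      have d: "(i,j,s) \<in> D" using that by (auto simp: D_def)
      then have "\<omega> \<notin> bad1 (i,j,s)" "\<omega> \<notin> bad2 (i,j,s)" using \<omega> unfolding bad_def by blast+
      then show "\<bar>\<Sum>l=1..n. centered_form p \<mu> (pair_dir i j s) (X l \<omega>)\<bar> \<le> real n * \<tau>"
        "\<bar>\<Sum>l=1..n. (centered_form p \<mu> (pair_dir i j s) (X l \<omega>))\<^sup>2 - qform p \<Sigma> (pair_dir i j s)\<bar> \<le> real n * \<tau>"
        using \<omega> by (auto simp: bad1_def bad2_def Z_def dir_def)
    qed
    show "\<bar>emp_cov n p (\<lambda>l. X l \<omega>) $$ (i,j) - \<Sigma> $$ (i,j)\<bar> \<le> 2 * \<tau>" if "i < p" "j < p" for i j
      by (rule emp_cov_close[OF n1 that \<Sigma> _ \<tau>(2) mean square]) (use \<tau> in auto)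
    show "emp_cov n p (\<lambda>l. X l \<omega>) $$ (i,j) \<noteq> 0" if "i < p" "j < p" "i \<noteq> j" for i j
    proof -
      have "(i,j) \<in> F" using that by (simp add: F_def)
      then have "\<omega> \<notin> bad4 (i,j)" using \<omega> unfolding bad_def by blast
      then show ?thesis using \<omega> by (auto simp: bad4_def S_def)
    qed
    \<comment> \<open>the second moment in direction \<open>e\<^sub>i\<close> bounds each single observation crudely, which is all that the net requires\<close>
    have bnd: "\<bar>X l' \<omega> i - \<mu> $ i\<bar> \<le> real n" if l': "l' \<in> {1..n}" and i: "i < p" for l' i
    proof -
      have "\<bar>\<Sum>l=1..n. (X l \<omega> i - \<mu> $ i)\<^sup>2 - qform p \<Sigma> (pair_dir i i 0)\<bar> \<le> real n * \<tau>"
        using square[of i i 0] i by (simp add: centered_form_pair_dir)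
      then have "(\<Sum>l=1..n. (X l \<omega> i - \<mu> $ i)\<^sup>2) \<le> real n * qform p \<Sigma> (pair_dir i i 0) + real n * \<tau>"
        by (simp add: sum_subtractf abs_le_iff)
      also have "\<dots> \<le> real n * u + real n * 1"
        using u[of "pair_dir i i 0"] sqnorm_pair_dir[of i p i 0] i \<tau> by (intro add_mono mult_left_mono) auto
      also have "\<dots> = real n * (u + 1)" by (simp add: distrib_left)
      also have "\<dots> \<le> real n * real n" using nu by (intro mult_left_mono) auto
      finally have "(X l' \<omega> i - \<mu> $ i)\<^sup>2 \<le> (real n)\<^sup>2"
        using member_le_sum[OF l', of "\<lambda>l. (X l \<omega> i - \<mu> $ i)\<^sup>2"] by (simp add: power2_eq_square)
      then show ?thesis using abs_le_square_iff[of "X l' \<omega> i - \<mu> $ i" "real n"] by simp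
    qed
    show "(1 / (real n * real p * (real N)\<^sup>2)) * sqnorm p y \<le> qform p (emp_cov n p (\<lambda>l. X l \<omega>)) y" for y
    proof (rule ccontr)
      assume "\<not> ?thesis"
      then have deg: "qform p (emp_cov n p (\<lambda>l. X l \<omega>)) y < (1 / (real n * real p * (real N)\<^sup>2)) * sqnorm p y" by simp
      obtain k r where kr: "k \<in> net p N" "r \<in> {- int (p * n * N + 1)..int (p * n * N + 1)}"
        "\<And>l. l \<in> {1..n} \<Longrightarrow> \<bar>centered_form p \<mu> (\<lambda>i. of_int (k i) / real N) (X l \<omega>) - of_int r / real N\<bar> \<le> real (p * n + 2) / real N"
        by (rule small_qform_imp_net[OF n1 p N bnd deg]) auto
      have "(k,r) \<in> E" using kr(1,2) by (simp only: E_def mem_Sigma_iff simp_thms)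
      then have "\<omega> \<notin> bad3 (k,r)" using \<omega> unfolding bad_def by blast
      moreover have "\<omega> \<in> bad3 (k,r)"
        unfolding bad3_def
      proof (rule INT_I)
        fix l assume l: "l \<in> {1..n}"
        have "\<bar>Z (wk k) l \<omega> - of_int r / real N\<bar> \<le> t"
          using kr(3)[OF l] unfolding Z_def wk_def[abs_def] t_def .
        then show "\<omega> \<in> Z (wk (fst (k,r))) l -` {of_int (snd (k,r)) / real N - t..of_int (snd (k,r)) / real N + t} \<inter> space M"
          using \<omega> by (auto simp: abs_le_iff)
      qed
      ultimately show False by blast
    qed
  qed
qed

section \<open>Rates\<close>

lemma eventually_powr_less:
  fixes \<alpha> \<beta> C c :: real
  assumes "\<alpha> < \<beta>" "0 < c"
  shows "\<forall>\<^sub>F n::nat in sequentially. C * real n powr \<alpha> < c * real n powr \<beta>"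
proof -
  have "(\<lambda>n::nat. C * real n powr (\<alpha> - \<beta>)) \<longlonglongrightarrow> C * 0"
    using assms(1) by (intro tendsto_mult tendsto_const tendsto_neg_powr filterlim_real_sequentially) auto
  then have "\<forall>\<^sub>F n::nat in sequentially. C * real n powr (\<alpha> - \<beta>) < c"
    using assms(2) by (auto dest: order_tendstoD(2))
  then show ?thesis using eventually_gt_at_top[of 0]
  proof eventually_elim
    case (elim n)
    then have "C * real n powr (\<alpha> - \<beta>) * real n powr \<beta> < c * real n powr \<beta>"
      by (intro mult_strict_right_mono) auto
    then show ?case using elim by (simp add: mult.assoc powr_add[symmetric])
  qed
qed

lemma eventually_log_powr_less:
  fixes A B \<gamma> c :: real
  assumes "0 < \<gamma>" "0 < c"
  shows "\<forall>\<^sub>F n::nat in sequentially. (A + B * ln (real n)) * real n powr (- \<gamma>) < c"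
proof -
  have "(\<lambda>n::nat. (A + B * ln (real n)) * real n powr (- \<gamma>)) \<longlonglongrightarrow> 0"
    using assms(1) by real_asymp
  then show ?thesis using assms(2) by (auto dest: order_tendstoD(2))
qed

lemma polynomial_exp_tendsto_0:
  fixes c \<gamma> :: real
  assumes "0 < c" "0 < \<gamma>"
  shows "(\<lambda>n::nat. 12 * (real n)\<^sup>2 * exp (- c * real n powr \<gamma>)) \<longlonglongrightarrow> 0"
  using assms by real_asymp

lemma polynomial_geometric_tendsto_0: "(\<lambda>n::nat. 5 * real n ^ k * (1/2) ^ n) \<longlonglongrightarrow> 0"
  by real_asymp

text \<open>With \<open>N = n ^ K\<close> the number of net points is about \<open>N ^ (p + 1)\<close> and each has probability about
  \<open>(n\<^sup>2 / N) ^ n\<close>. The product decreases as soon as \<open>K (n - p)\<close> dominates \<open>2 n\<close>, which is possible exactly because \<open>p / n\<close>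
  stays away from \<open>1\<close>.\<close>

lemma net_union_bound:
  fixes n p K :: nat and l :: real
  assumes n: "1 \<le> n" and p: "1 \<le> p" "p \<le> n" and K: "4 * n \<le> K * (n - p)" and l: "0 < l"
    and big: "18 / sqrt l \<le> (real n)\<^sup>2"
  shows "real ((2 * n ^ K + 1) ^ p * (2 * (p * n * n ^ K + 1) + 1)) * (real (p * n + 2) / real (n ^ K) / sqrt l) ^ n
    \<le> 5 * real n ^ (K + 2) * (1/2) ^ n"
proof -
  define N where "N = n ^ K"
  have N: "1 \<le> N" using n by (simp add: N_def)
  have n0: "0 < real n" using n by simp
  have n2: "1 \<le> n * n" using n by simp
  have pn: "p * n \<le> n * n" using p by simp
  have a: "(2 * N + 1) ^ p \<le> 3 ^ n * N ^ p"
  proof -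
    have "(2 * N + 1) ^ p \<le> (3 * N) ^ p" using N by (intro power_mono) auto
    also have "\<dots> = 3 ^ p * N ^ p" by (simp add: power_mult_distrib)
    also have "\<dots> \<le> 3 ^ n * N ^ p" by (rule mult_right_mono[OF power_increasing[OF p(2)]]) simp_all
    finally show ?thesis .
  qed
  have b: "2 * (p * n * N + 1) + 1 \<le> 5 * (n * n * N)"
  proof -
    have aux: "2 * (x + 1) + 1 \<le> 5 * y" if "x \<le> y" "1 \<le> y" for x y :: nat using that by simp
    have "p * n * N \<le> n * n * N" by (rule mult_right_mono[OF pn]) simp
    moreover have "1 \<le> n * n * N" using n2 N by simp
    ultimately show ?thesis by (rule aux)
  qed
  have c: "real (p * n + 2) \<le> 3 * (real n)\<^sup>2"
  proof -
    have aux: "x + 2 \<le> 3 * y" if "x \<le> y" "1 \<le> y" for x y :: nat using that by simp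
    have "p * n + 2 \<le> 3 * (n * n)" by (rule aux[OF pn n2])
    then have "real (p * n + 2) \<le> real (3 * (n * n))" by (simp only: of_nat_le_iff)
    then show ?thesis by (simp add: power2_eq_square)
  qed
  have "real ((2 * N + 1) ^ p * (2 * (p * n * N + 1) + 1)) \<le> real ((3 ^ n * N ^ p) * (5 * (n * n * N)))"
    unfolding of_nat_le_iff using a b by (intro mult_mono) auto
  also have "\<dots> = 5 * (real n)\<^sup>2 * real N * 3 ^ n * real N ^ p" by (simp add: power2_eq_square)
  finally have 1: "real ((2 * N + 1) ^ p * (2 * (p * n * N + 1) + 1)) \<le> 5 * (real n)\<^sup>2 * real N * 3 ^ n * real N ^ p" .
  have "(real (p * n + 2) / real N / sqrt l) ^ n \<le> (3 * (real n)\<^sup>2 / real N / sqrt l) ^ n"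
    using c l by (intro power_mono divide_right_mono) auto
  also have "\<dots> = 3 ^ n * ((real n)\<^sup>2) ^ n * (1 / sqrt l) ^ n / real N ^ n"
    by (simp add: power_mult_distrib power_divide)
  finally have 2: "(real (p * n + 2) / real N / sqrt l) ^ n \<le> 3 ^ n * ((real n)\<^sup>2) ^ n * (1 / sqrt l) ^ n / real N ^ n" .
  have "real n ^ (4 * n) \<le> real n ^ (K * (n - p))" using n K by (intro power_increasing) auto
  then have 3: "((real n)\<^sup>2) ^ n * ((real n)\<^sup>2) ^ n \<le> real N ^ (n - p)"
    by (simp add: N_def power_mult[symmetric] power_add[symmetric])
  have "real ((2 * N + 1) ^ p * (2 * (p * n * N + 1) + 1)) * (real (p * n + 2) / real N / sqrt l) ^ n
     \<le> (5 * (real n)\<^sup>2 * real N * 3 ^ n * real N ^ p) * (3 ^ n * ((real n)\<^sup>2) ^ n * (1 / sqrt l) ^ n / real N ^ n)"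
    using 1 2 l by (intro mult_mono) auto
  also have "real N ^ n = real N ^ p * real N ^ (n - p)" using p by (simp add: power_add[symmetric])
  also have "(5 * (real n)\<^sup>2 * real N * 3 ^ n * real N ^ p) * (3 ^ n * ((real n)\<^sup>2) ^ n * (1 / sqrt l) ^ n / (real N ^ p * real N ^ (n - p)))
     = 5 * (real n)\<^sup>2 * real N * (9 * (1 / sqrt l)) ^ n * (((real n)\<^sup>2) ^ n / real N ^ (n - p))"
    using N by (simp add: power_mult_distrib power_mult[symmetric] field_simps) (simp add: power_mult_distrib[symmetric])
  also have "\<dots> \<le> 5 * (real n)\<^sup>2 * real N * (9 * (1 / sqrt l)) ^ n * (1 / ((real n)\<^sup>2) ^ n)"
  proof (rule mult_left_mono)
    have "0 < real N ^ (n - p)" "0 < ((real n)\<^sup>2) ^ n" using N n0 by auto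
    then show "((real n)\<^sup>2) ^ n / real N ^ (n - p) \<le> 1 / ((real n)\<^sup>2) ^ n"
      using 3 by (simp add: divide_le_eq le_divide_eq)
  qed (use l in auto)
  also have "\<dots> = 5 * (real n)\<^sup>2 * real N * (9 / sqrt l / (real n)\<^sup>2) ^ n"
    by (simp add: power_divide power_mult_distrib)
  also have "\<dots> \<le> 5 * (real n)\<^sup>2 * real N * (1/2) ^ n"
  proof (intro mult_left_mono power_mono)
    show "9 / sqrt l / (real n)\<^sup>2 \<le> 1/2" using big n0 l by (simp add: divide_le_eq mult.commute)
  qed (use l in auto)
  also have "\<dots> = 5 * real n ^ (K + 2) * (1/2) ^ n" by (simp add: N_def power_add power2_eq_square mult_ac)
  finally show ?thesis unfolding N_def .
qed

section \<open>Consistency\<close>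

lemma qform_bounds_imp_entries:
  assumes A: "sym_mat p A" and nn: "\<And>x. 0 \<le> qform p A x" and u: "\<And>x. qform p A x \<le> u * sqnorm p x"
    and ij: "i < p" "j < p"
  shows "\<bar>A $$ (i,j)\<bar> \<le> u"
proof -
  have diag: "A $$ (k,k) \<le> u" if "k < p" for k
    using u[of "pair_dir k k 0"] qform_pair_dir[OF A that that, of 0] sqnorm_pair_dir[OF that that, of 0] by simp
  have "0 \<le> A $$ (i,i) + 2 * A $$ (i,j) + A $$ (j,j)" "0 \<le> A $$ (i,i) - 2 * A $$ (i,j) + A $$ (j,j)"
    using nn[of "pair_dir i j 1"] nn[of "pair_dir i j (-1)"] qform_pair_dir[OF A ij, of 1] qform_pair_dir[OF A ij, of "-1"] by simp_all
  then show ?thesis using diag[OF ij(1)] diag[OF ij(2)] by (simp add: abs_le_iff)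
qed

text \<open>On the concentration event the sample satisfies the deterministic conditions with error \<open>2 \<tau>\<close>.
  Measurability of the event that the estimator is right is what permits bounding its probability from below.\<close>

lemma recovery_probability:
  fixes M :: "'a measure" and X :: "nat \<Rightarrow> 'a \<Rightarrow> nat \<Rightarrow> real"
  assumes "prob_space M"
    and n: "2 \<le> n" and p: "1 \<le> p" "m < p" and m: "1 \<le> m" and N: "1 \<le> N"
    and \<mu>: "\<mu> \<in> carrier_vec p" and \<Sigma>: "sym_mat p \<Sigma>"
    and l: "0 < l" "\<And>x. l * sqnorm p x \<le> qform p \<Sigma> x" and u: "\<And>x. qform p \<Sigma> x \<le> u * sqnorm p x" "l \<le> u"
    and sample: "gaussian_sample M n p \<mu> \<Sigma> X"
    and blocks: "\<And>G. G \<in> finest_blocks \<Sigma> \<Longrightarrow> card G \<le> m"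
    and sep: "\<And>B. strictly_refines {..<p} B (finest_blocks \<Sigma>) \<Longrightarrow> \<theta> \<le> max_norm (restrict_blocks \<Sigma> B - \<Sigma>)"
    and \<theta>: "0 < \<theta>" "\<theta> / (4 * u) \<le> 1"
    and \<tau>: "0 < \<tau>" "\<tau> \<le> 1" "\<tau> \<le> 12 * u" "real m * (2 * \<tau>) \<le> l / 2" "2 * \<tau> \<le> \<theta> / 2" "2 * \<tau> \<le> u"
    and nu: "u + 1 \<le> real n"
    and \<eta>: "1 / (real n * real p * (real N)\<^sup>2) \<le> u"
    and c: "c \<le> 1 / (192 * u\<^sup>2)" "c \<le> 1 / (4 * u)"
    and over: "(2 + 4 * ln (4 * u * real m * (real n * real p * (real N)\<^sup>2))) * (4 * (real m)\<^sup>2 * (2 * \<tau>)\<^sup>2 / l\<^sup>2) < \<omega>'"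
    and under: "\<omega>' < \<theta>\<^sup>2 * l / (128 * u^3 * (real m)^5)"
    and \<kappa>: "\<kappa> = \<omega>' / real p"
    and thr: "2 * (2 * \<tau>) / l \<le> real n powr (-1/3)" "real n powr (-1/3) < \<theta> / (4 * u)"
    and grid: "2 * (2 * \<tau>) / l + 1 / real p < \<theta> / (4 * u)"
    and S: "\<And>\<omega>. S \<omega> = emp_cov n p (\<lambda>l. X l \<omega>)"
    and Bh: "Bh \<in> {B_tot \<kappa>, B_corr \<kappa>, B_thr n, B_grid m \<kappa>}"
  shows "1 - (12 * (real p)\<^sup>2 * exp (- c * real n * \<tau>\<^sup>2) +
       real ((2 * N + 1) ^ p * (2 * (p * n * N + 1) + 1)) * (real (p * n + 2) / real N / sqrt l) ^ n)
    \<le> measure M {\<omega> \<in> space M. Bh (S \<omega>) = finest_blocks \<Sigma>}"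
proof -
  interpret prob_space M by fact
  have Xm: "X l \<in> measurable M (lborel_vec p)" if "l \<in> {1..n}" for l
    using sample that unfolding gaussian_sample_def by (auto dest: distributed_measurable)
  have Sc: "S \<omega> \<in> carrier_mat p p" for \<omega> unfolding S by (rule emp_cov_carrier)
  have Sm: "(\<lambda>\<omega>. S \<omega> $$ (i,j)) \<in> borel_measurable M" if "i < p" "j < p" for i j
    unfolding S by (rule emp_cov_measurable[OF Xm that])
  have ev: "{\<omega> \<in> space M. Bh (S \<omega>) = finest_blocks \<Sigma>} \<in> events"
    using Bh B_tot_pred[OF Sc Sm] B_corr_pred[OF Sc Sm] B_thr_pred[OF Sc Sm] B_grid_pred[OF Sc Sm]
    unfolding pred_def by auto
  obtain G where G: "G \<in> events"
    "1 - (12 * (real p)\<^sup>2 * exp (- c * real n * \<tau>\<^sup>2) +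
       real ((2 * N + 1) ^ p * (2 * (p * n * N + 1) + 1)) * (real (p * n + 2) / real N / sqrt l) ^ n) \<le> prob G"
    "\<And>\<omega> i j. \<omega> \<in> G \<Longrightarrow> i < p \<Longrightarrow> j < p \<Longrightarrow> \<bar>S \<omega> $$ (i,j) - \<Sigma> $$ (i,j)\<bar> \<le> 2 * \<tau>"
    "\<And>\<omega> y. \<omega> \<in> G \<Longrightarrow> (1 / (real n * real p * (real N)\<^sup>2)) * sqnorm p y \<le> qform p (S \<omega>) y"
    "\<And>\<omega> i j. \<omega> \<in> G \<Longrightarrow> i < p \<Longrightarrow> j < p \<Longrightarrow> i \<noteq> j \<Longrightarrow> S \<omega> $$ (i,j) \<noteq> 0"
    unfolding S by (rule concentration_event[OF n p(1) N \<mu> \<Sigma> l u(1) sample \<tau>(1-3) nu c]) blast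
  have "G \<subseteq> {\<omega> \<in> space M. Bh (S \<omega>) = finest_blocks \<Sigma>}"
  proof
    fix \<omega> assume \<omega>: "\<omega> \<in> G"
    define \<eta> where "\<eta> = 1 / (real n * real p * (real N)\<^sup>2)"
    have \<eta>pos: "0 < \<eta>" using n p N by (simp add: \<eta>_def)
    have nn: "0 \<le> qform p \<Sigma> x" for x
      using l(2)[of x] mult_nonneg_nonneg[OF less_imp_le[OF l(1)] sqnorm_nonneg[of p x]] by linarith
    interpret concentrated_sample p m \<Sigma> "S \<omega>" "finest_blocks \<Sigma>" l u "2 * \<tau>" \<eta> \<theta>
    proof
      show "0 < p" using p by simp
      show "sym_mat p (S \<omega>)" unfolding S by (rule emp_cov_sym)
      show "\<bar>\<Sigma> $$ (i,j)\<bar> \<le> u" if "i < p" "j < p" for i j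
        by (rule qform_bounds_imp_entries[OF \<Sigma> nn u(1) that])
      show "\<bar>S \<omega> $$ (i,j) - \<Sigma> $$ (i,j)\<bar> \<le> 2 * \<tau>" if "i < p" "j < p" for i j by (rule G(3)[OF \<omega> that])
      show "\<eta> * sqnorm p x \<le> qform p (S \<omega>) x" for x unfolding \<eta>_def by (rule G(4)[OF \<omega>])
      show "S \<omega> $$ (i,j) \<noteq> 0" if "i < p" "j < p" "i \<noteq> j" for i j by (rule G(5)[OF \<omega> that])
      show "\<eta> \<le> u" unfolding \<eta>_def by (rule \<eta>)
    qed (fact m \<Sigma> refl blocks l \<eta>pos \<tau>(4-6) u(2) sep \<theta>(1))+
    have uniq: "crit \<kappa> (S \<omega>) (finest_blocks \<Sigma>) < crit \<kappa> (S \<omega>) B"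
      if "partition_on {..<p} B" "B \<noteq> finest_blocks \<Sigma>" for B
    proof (rule Bst_unique_minimizer[OF \<kappa> _ under that])
      show "(2 + 4 * ln (4 * u * real m / \<eta>)) * (4 * (real m)\<^sup>2 * (2 * \<tau>)\<^sup>2 / l\<^sup>2) < \<omega>'"
        using over by (simp add: \<eta>_def)
    qed
    have w: "2 * (2 * \<tau>) / l < \<theta> / (4 * u)" using thr by linarith
    have "Bh (S \<omega>) = finest_blocks \<Sigma>"
      using Bh B_tot_recovers[OF uniq] B_corr_recovers[OF uniq p(2) w] B_thr_recovers[OF thr]
        B_grid_recovers[OF uniq grid \<theta>(2)] by auto
    then show "\<omega> \<in> {\<omega> \<in> space M. Bh (S \<omega>) = finest_blocks \<Sigma>}"
      using \<omega> sets.sets_into_space[OF G(1)] by auto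
  qed
  then have "prob G \<le> prob {\<omega> \<in> space M. Bh (S \<omega>) = finest_blocks \<Sigma>}" by (rule finite_measure_mono[OF _ ev])
  then show ?thesis using G(2) by linarith
qed

theorem proposition7:
  fixes M :: "nat \<Rightarrow> 'a measure"
    and p :: "nat \<Rightarrow> nat"
    and X :: "nat \<Rightarrow> nat \<Rightarrow> 'a \<Rightarrow> nat \<Rightarrow> real"
    and \<mu> :: "nat \<Rightarrow> real Matrix.vec"
    and \<Sigma> :: "nat \<Rightarrow> real Matrix.mat"
    and Bstar :: "nat \<Rightarrow> nat set set"
    and S :: "nat \<Rightarrow> 'a \<Rightarrow> real Matrix.mat"
    and Bhat :: "nat \<Rightarrow> 'a \<Rightarrow> nat set set"
    and \<kappa> :: "nat \<Rightarrow> real"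
    and y l_inf l_sup a \<delta> :: real
    and m :: nat
  assumes prob: "\<And>n. n \<ge> 1 \<Longrightarrow> prob_space (M n)"
    and mean: "\<And>n. n \<ge> 1 \<Longrightarrow> \<mu> n \<in> carrier_vec (p n)"
    and cov_dim: "\<And>n. n \<ge> 1 \<Longrightarrow> \<Sigma> n \<in> carrier_mat (p n) (p n)"
    and cov_sym: "\<And>n. n \<ge> 1 \<Longrightarrow> transpose_mat (\<Sigma> n) = \<Sigma> n"
    and cov_pd: "\<And>n. n \<ge> 1 \<Longrightarrow> positive_definite (\<Sigma> n)"
    and sample: "\<And>n. n \<ge> 1 \<Longrightarrow> gaussian_sample (M n) n (p n) (\<mu> n) (\<Sigma> n) (X n)"
    and p_lim: "filterlim p at_top sequentially"
    and Bstar: "\<And>n. Bstar n = finest_blocks (\<Sigma> n)"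
    and ratio: "(\<lambda>n. real (p n) / real n) \<longlonglongrightarrow> y" "0 < y" "y < 1"
    and eig: "0 < l_inf"
      "\<And>n k. n \<ge> 1 \<Longrightarrow> eigenvalue (\<Sigma> n) k \<Longrightarrow> l_inf \<le> k \<and> k \<le> l_sup"
    and block_size: "1 \<le> m" "\<And>n G. n \<ge> 1 \<Longrightarrow> G \<in> Bstar n \<Longrightarrow> card G \<le> m"
    and separation: "0 < a"
      "\<And>n B. n \<ge> 1 \<Longrightarrow> strictly_refines {..<p n} B (Bstar n) \<Longrightarrow>
         max_norm (restrict_blocks (\<Sigma> n) B - \<Sigma> n) \<ge> a * real n powr (-1/4)"
    and delta: "1/2 < \<delta>" "\<delta> < 1"
    and kappa: "\<And>n. \<kappa> n = 1 / (real (p n) * real n powr \<delta>)"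
    and S: "\<And>n \<omega>. S n \<omega> = emp_cov n (p n) (\<lambda>l. X n l \<omega>)"
    and estimator: "Bhat \<in>
      {\<lambda>n \<omega>. B_tot (\<kappa> n) (S n \<omega>),
       \<lambda>n \<omega>. B_corr (\<kappa> n) (S n \<omega>),
       \<lambda>n \<omega>. B_thr n (S n \<omega>),
       \<lambda>n \<omega>. B_grid m (\<kappa> n) (S n \<omega>)}"
  shows "(\<lambda>n. measure (M n) {\<omega> \<in> space (M n). Bhat n \<omega> = Bstar n}) \<longlonglongrightarrow> 1"
proof -
  let ?l = l_inf and ?u = l_sup
  obtain Bh where Bh: "\<And>n. Bh n \<in> {B_tot (\<kappa> n), B_corr (\<kappa> n), B_thr n, B_grid m (\<kappa> n)}"
    and Bhat: "\<And>n \<omega>. Bhat n \<omega> = Bh n (S n \<omega>)"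
  proof -
    have "\<exists>Bh. (\<forall>n. Bh n \<in> {B_tot (\<kappa> n), B_corr (\<kappa> n), B_thr n, B_grid m (\<kappa> n)}) \<and> Bhat = (\<lambda>n \<omega>. Bh n (S n \<omega>))"
      using estimator
    proof (elim insertE emptyE)
      assume "Bhat = (\<lambda>n \<omega>. B_tot (\<kappa> n) (S n \<omega>))"
      then show ?thesis by (intro exI[of _ "\<lambda>n. B_tot (\<kappa> n)"]) auto
    next
      assume "Bhat = (\<lambda>n \<omega>. B_corr (\<kappa> n) (S n \<omega>))"
      then show ?thesis by (intro exI[of _ "\<lambda>n. B_corr (\<kappa> n)"]) auto
    next
      assume "Bhat = (\<lambda>n \<omega>. B_thr n (S n \<omega>))"
      then show ?thesis by (intro exI[of _ "\<lambda>n. B_thr n"]) auto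
    next
      assume "Bhat = (\<lambda>n \<omega>. B_grid m (\<kappa> n) (S n \<omega>))"
      then show ?thesis by (intro exI[of _ "\<lambda>n. B_grid m (\<kappa> n)"]) auto
    qed
    then show ?thesis using that by blast
  qed
  have \<Sigma>: "sym_mat (p n) (\<Sigma> n)" if "1 \<le> n" for n
  proof -
    have "\<Sigma> n $$ (i,j) = \<Sigma> n $$ (j,i)" if "i < p n" "j < p n" for i j
    proof -
      have "transpose_mat (\<Sigma> n) $$ (i,j) = \<Sigma> n $$ (j,i)" using cov_dim[OF \<open>1 \<le> n\<close>] that by simp
      then show ?thesis using cov_sym[OF \<open>1 \<le> n\<close>] by simp
    qed
    then show ?thesis using cov_dim[OF that] by (simp add: sym_mat_def)
  qed
  have lower: "?l * sqnorm (p n) x \<le> qform (p n) (\<Sigma> n) x" if "1 \<le> n" for n x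
    using eig(2)[OF that] by (intro eigenvalues_ge_imp_qform_ge[OF \<Sigma>[OF that]]) blast
  have upper: "qform (p n) (\<Sigma> n) x \<le> ?u * sqnorm (p n) x" if "1 \<le> n" for n x
    using eig(2)[OF that] by (intro eigenvalues_le_imp_qform_le[OF \<Sigma>[OF that]]) blast
  have ev_p: "\<forall>\<^sub>F n in sequentially. m < p n"
    by (rule eventually_compose_filterlim[OF eventually_gt_at_top p_lim])
  have lu: "?l \<le> ?u"
  proof -
    obtain n where n: "m < p n" "1 \<le> n"
      using eventually_happens[OF eventually_conj[OF ev_p eventually_ge_at_top[of 1]]] by auto
    then have p0: "0 < p n" by simp
    have "sqnorm (p n) (pair_dir 0 0 0) = 1" using sqnorm_pair_dir[OF p0 p0, of 0] by simp
    then show ?thesis using lower[OF n(2), of "pair_dir 0 0 0"] upper[OF n(2), of "pair_dir 0 0 0"] by simp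
  qed
  have l: "0 < ?l" by (rule eig(1))
  have u: "0 < ?u" using l lu by linarith
  have mpos: "0 < real m" using block_size(1) by simp
  \<comment> \<open>small enough for \<open>2 \<epsilon> + \<delta> < 1\<close>, which makes the penalty exceed the noise, and for \<open>\<epsilon> < 1/6\<close>, which puts \<open>n powr (-1/3)\<close> above the noise\<close>
  define \<epsilon> where "\<epsilon> = (1 - \<delta>) / 8"
  have \<epsilon>: "0 < \<epsilon>" "\<epsilon> < 1/16" using delta by (simp_all add: \<epsilon>_def)
  define \<tau> where "\<tau> n = real n powr (\<epsilon> - 1/2)" for n :: nat
  define \<theta> where "\<theta> n = a * real n powr (-1/4)" for n :: nat
  define \<rho> where "\<rho> = (1 + y) / 2"
  have \<rho>: "y < \<rho>" "\<rho> < 1" using ratio by (simp_all add: \<rho>_def)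
  \<comment> \<open>large enough for \<open>4 n \<le> K (n - p)\<close>\<close>
  define K where "K = nat \<lceil>4 / (1 - \<rho>)\<rceil>"
  have K: "4 \<le> real K * (1 - \<rho>)"
  proof -
    have "4 / (1 - \<rho>) \<le> real K" unfolding K_def by linarith
    then show ?thesis using \<rho> by (simp add: pos_divide_le_eq)
  qed
  define c where "c = min (1 / (192 * ?u\<^sup>2)) (1 / (4 * ?u))"
  have c: "0 < c" using u by (simp add: c_def)
  define b where "b n = 12 * (real n)\<^sup>2 * exp (- c * real n powr (2 * \<epsilon>)) + 5 * real n ^ (K + 2) * (1/2) ^ n" for n :: nat
  have b: "b \<longlonglongrightarrow> 0"
    unfolding b_def[abs_def]
    using tendsto_add[OF polynomial_exp_tendsto_0[OF c, of "2 * \<epsilon>"] polynomial_geometric_tendsto_0[of "K + 2"]] \<epsilon> by simp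
  define A where "A = 2 + 4 * ln (4 * ?u * real m)"
  define L where "L = 16 * (real m)\<^sup>2 / ?l\<^sup>2"
  have L: "0 < L" using mpos l by (simp add: L_def)
  have main: "\<forall>\<^sub>F n in sequentially. 1 - b n \<le> measure (M n) {\<omega> \<in> space (M n). Bhat n \<omega> = Bstar n}"
  proof -
    note pow = eventually_powr_less
    have ev: "\<forall>\<^sub>F n in sequentially. 2 \<le> n" "\<forall>\<^sub>F n in sequentially. nat \<lceil>?u + 1\<rceil> \<le> n"
      "\<forall>\<^sub>F n in sequentially. nat \<lceil>18 / sqrt ?l\<rceil> \<le> n" "\<forall>\<^sub>F n in sequentially. nat \<lceil>1 / ?u\<rceil> \<le> n"
      by (rule eventually_ge_at_top)+
    have evr: "\<forall>\<^sub>F n in sequentially. real (p n) / real n < \<rho>" "\<forall>\<^sub>F n in sequentially. y / 2 < real (p n) / real n"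
      using order_tendstoD(2)[OF ratio(1) \<rho>(1)] order_tendstoD(1)[OF ratio(1), of "y / 2"] ratio(2) by simp_all
    have e1: "\<forall>\<^sub>F n in sequentially. a * real n powr (-1/4) < (4 * ?u) * real n powr 0"
      by (rule pow) (use u in auto)
    have e2: "\<forall>\<^sub>F n in sequentially. 1 * real n powr (\<epsilon> - 1/2) < 1 * real n powr 0"
      by (rule pow) (use \<epsilon> in auto)
    have e3: "\<forall>\<^sub>F n in sequentially. 1 * real n powr (\<epsilon> - 1/2) < (12 * ?u) * real n powr 0"
      by (rule pow) (use \<epsilon> u in auto)
    have e4: "\<forall>\<^sub>F n in sequentially. (2 * real m) * real n powr (\<epsilon> - 1/2) < (?l / 2) * real n powr 0"
      by (rule pow) (use \<epsilon> l in auto)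
    have e5: "\<forall>\<^sub>F n in sequentially. 2 * real n powr (\<epsilon> - 1/2) < (a / 2) * real n powr (-1/4)"
      by (rule pow) (use \<epsilon> separation in auto)
    have e6: "\<forall>\<^sub>F n in sequentially. 2 * real n powr (\<epsilon> - 1/2) < ?u * real n powr 0"
      by (rule pow) (use \<epsilon> u in auto)
    have e7: "\<forall>\<^sub>F n in sequentially. (L * A + L * real (8 * K + 8) * ln (real n)) * real n powr (- (1 - 2 * \<epsilon> - \<delta>)) < 1"
    proof (rule eventually_log_powr_less)
      have "1 - 2 * \<epsilon> - \<delta> = 3 / 4 * (1 - \<delta>)" by (simp add: \<epsilon>_def field_simps)
      then show "0 < 1 - 2 * \<epsilon> - \<delta>" using delta by simp
    qed simp
    have e8: "\<forall>\<^sub>F n in sequentially. 1 * real n powr (- \<delta>) < (a\<^sup>2 * ?l / (128 * ?u^3 * (real m)^5)) * real n powr (-1/2)"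
      by (rule pow) (use delta separation l u mpos in auto)
    have e9: "\<forall>\<^sub>F n in sequentially. (4 / ?l) * real n powr (\<epsilon> - 1/2) < 1 * real n powr (-1/3)"
      by (rule pow) (use \<epsilon> in auto)
    have e10: "\<forall>\<^sub>F n in sequentially. 1 * real n powr (-1/3) < (a / (4 * ?u)) * real n powr (-1/4)"
      by (rule pow) (use separation u in auto)
    have e11: "\<forall>\<^sub>F n in sequentially. (4 / ?l) * real n powr (\<epsilon> - 1/2) < (a / (8 * ?u)) * real n powr (-1/4)"
      by (rule pow) (use \<epsilon> separation u in auto)
    have e12: "\<forall>\<^sub>F n in sequentially. (2 / y) * real n powr (-1) < (a / (8 * ?u)) * real n powr (-1/4)"
      by (rule pow) (use separation u in auto)
    show ?thesis
      using ev evr ev_p e1 e2 e3 e4 e5 e6 e7 e8 e9 e10 e11 e12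
    proof eventually_elim
      case (elim n)
      have n: "1 \<le> n" "2 \<le> n" using elim(1) by auto
      have npos: "0 < real n" using n by simp
      have pm: "m < p n" and p1: "1 \<le> p n" using elim(7) by auto
      have p\<rho>: "real (p n) \<le> \<rho> * real n" using elim(5) npos by (simp add: pos_divide_less_eq)
      then have pn: "p n \<le> n"
      proof -
        have "\<rho> * real n \<le> 1 * real n" using \<rho> by (intro mult_right_mono) auto
        then show ?thesis using p\<rho> by simp
      qed
      have KN: "4 * n \<le> K * (n - p n)"
      proof -
        have "real (4 * n) \<le> (real K * (1 - \<rho>)) * real n" using K npos by simp
        also have "\<dots> = real K * (real n - \<rho> * real n)" by (simp add: algebra_simps)
        also have "\<dots> \<le> real K * (real n - real (p n))" using p\<rho> by (intro mult_left_mono) auto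
        also have "\<dots> = real (K * (n - p n))" using pn by (simp add: of_nat_diff)
        finally show ?thesis by (simp only: of_nat_le_iff)
      qed
      define N where "N = n ^ K"
      have N: "1 \<le> N" using n by (simp add: N_def)
      have \<tau>2: "(\<tau> n)\<^sup>2 = real n powr (2 * \<epsilon> - 1)"
        by (simp add: \<tau>_def power2_eq_square powr_add[symmetric])
      have n\<tau>: "real n * (\<tau> n)\<^sup>2 = real n powr (2 * \<epsilon>)"
        unfolding \<tau>2 using npos powr_add[of "real n" 1 "2 * \<epsilon> - 1"] by simp
      have X: "real n * real (p n) * (real N)\<^sup>2 \<le> real n ^ (2 * K + 2)"
      proof -
        have "real n * real (p n) * (real N)\<^sup>2 \<le> real n * real n * (real N)\<^sup>2"
          using pn by (intro mult_right_mono mult_left_mono) auto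
        also have "\<dots> = real n ^ (2 * K + 2)" by (simp add: N_def power_add power_mult power2_eq_square mult_ac power_mult_distrib)
        finally show ?thesis .
      qed
      have Xpos: "1 \<le> real (p n) * (real N)\<^sup>2"
        using mult_mono[of 1 "real (p n)" 1 "(real N)\<^sup>2"] p1 N by (simp add: one_le_power)
      have "1 - (12 * (real (p n))\<^sup>2 * exp (- c * real n * (\<tau> n)\<^sup>2) +
          real ((2 * N + 1) ^ p n * (2 * (p n * n * N + 1) + 1)) * (real (p n * n + 2) / real N / sqrt ?l) ^ n)
        \<le> measure (M n) {\<omega> \<in> space (M n). Bh n (S n \<omega>) = finest_blocks (\<Sigma> n)}"
      proof (rule recovery_probability[OF prob[OF n(1)] n(2) p1 pm block_size(1) N mean[OF n(1)] \<Sigma>[OF n(1)] l lower[OF n(1)]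
            upper[OF n(1)] lu sample[OF n(1)], where \<theta> = "\<theta> n" and \<omega>' = "real n powr (- \<delta>)" and \<kappa> = "\<kappa> n"])
        show "card G \<le> m" if "G \<in> finest_blocks (\<Sigma> n)" for G
          using block_size(2)[OF n(1)] that by (simp add: Bstar)
        show "\<theta> n \<le> max_norm (restrict_blocks (\<Sigma> n) B - \<Sigma> n)"
          if "strictly_refines {..<p n} B (finest_blocks (\<Sigma> n))" for B
          using separation(2)[OF n(1)] that by (simp add: Bstar \<theta>_def)
        show "0 < \<theta> n" using separation(1) npos by (simp add: \<theta>_def)
        show "\<theta> n / (4 * ?u) \<le> 1" using elim(8) u npos by (simp add: \<theta>_def pos_divide_le_eq)
        show "0 < \<tau> n" using npos by (simp add: \<tau>_def)
        show "\<tau> n \<le> 1" "\<tau> n \<le> 12 * ?u" "2 * \<tau> n \<le> ?u" using elim(9,10,13) npos by (simp_all add: \<tau>_def)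
        show "real m * (2 * \<tau> n) \<le> ?l / 2" using elim(11) npos by (simp add: \<tau>_def mult_ac)
        show "2 * \<tau> n \<le> \<theta> n / 2" using elim(12) by (simp add: \<tau>_def \<theta>_def)
        show "?u + 1 \<le> real n" using elim(2) by linarith
        show "1 / (real n * real (p n) * (real N)\<^sup>2) \<le> ?u"
        proof -
          have "1 / ?u \<le> real n * 1" using elim(4) by linarith
          also have "\<dots> \<le> real n * (real (p n) * (real N)\<^sup>2)" using Xpos by (intro mult_left_mono) auto
          finally have "1 / ?u \<le> real n * real (p n) * (real N)\<^sup>2" by (simp add: mult.assoc)
          moreover have "0 < real n * real (p n) * (real N)\<^sup>2" using npos p1 N by simp
          ultimately show ?thesis using u by (simp add: divide_le_eq mult.commute)
        qed
        show "c \<le> 1 / (192 * ?u\<^sup>2)" "c \<le> 1 / (4 * ?u)" by (simp_all add: c_def)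
        show "(2 + 4 * ln (4 * ?u * real m * (real n * real (p n) * (real N)\<^sup>2))) * (4 * (real m)\<^sup>2 * (2 * \<tau> n)\<^sup>2 / ?l\<^sup>2)
            < real n powr - \<delta>"
        proof -
          have um: "0 < 4 * ?u * real m" using u mpos by simp
          have X0: "0 < real n * real (p n) * (real N)\<^sup>2" using npos p1 N by simp
          have "ln (4 * ?u * real m * (real n * real (p n) * (real N)\<^sup>2)) \<le> ln (4 * ?u * real m * real n ^ (2 * K + 2))"
            using mult_left_mono[OF X less_imp_le[OF um]] mult_pos_pos[OF um X0] mult_pos_pos[OF um zero_less_power[OF npos, of "2 * K + 2"]]
            by (simp only: ln_le_cancel_iff)
          also have "\<dots> = ln (4 * ?u * real m) + real (2 * K + 2) * ln (real n)"
            using um npos by (simp only: ln_mult_pos zero_less_power ln_realpow)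
          finally have "2 + 4 * ln (4 * ?u * real m * (real n * real (p n) * (real N)\<^sup>2)) \<le> A + real (8 * K + 8) * ln (real n)"
            by (simp add: A_def algebra_simps)
          then have "(2 + 4 * ln (4 * ?u * real m * (real n * real (p n) * (real N)\<^sup>2))) * (L * real n powr (2 * \<epsilon> - 1))
              \<le> (A + real (8 * K + 8) * ln (real n)) * (L * real n powr (2 * \<epsilon> - 1))"
            using L by (intro mult_right_mono) auto
          also have "\<dots> = ((L * A + L * real (8 * K + 8) * ln (real n)) * real n powr (- (1 - 2 * \<epsilon> - \<delta>))) * real n powr (- \<delta>)"
            by (simp add: mult.assoc powr_add[symmetric]) (simp add: algebra_simps)
          also have "\<dots> < 1 * real n powr (- \<delta>)"
            using elim(14) npos by (intro mult_strict_right_mono) auto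
          finally show ?thesis by (simp add: L_def \<tau>2 power_mult_distrib mult_ac)
        qed
        show "real n powr - \<delta> < (\<theta> n)\<^sup>2 * ?l / (128 * ?u ^ 3 * real m ^ 5)"
        proof -
          have "(\<theta> n)\<^sup>2 = a\<^sup>2 * real n powr (-1/2)"
            by (simp add: \<theta>_def power_mult_distrib power2_eq_square[of "_ powr _"] powr_add[symmetric])
          then show ?thesis using elim(15) by (simp add: mult_ac)
        qed
        show "\<kappa> n = real n powr - \<delta> / real (p n)" unfolding kappa by (simp add: powr_minus_divide mult.commute)
        show "2 * (2 * \<tau> n) / ?l \<le> real n powr (- 1 / 3)" using elim(16) by (simp add: \<tau>_def)
        show "real n powr (- 1 / 3) < \<theta> n / (4 * ?u)" using elim(17) by (simp add: \<theta>_def)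
        show "2 * (2 * \<tau> n) / ?l + 1 / real (p n) < \<theta> n / (4 * ?u)"
        proof -
          have "y / 2 * real n \<le> real (p n)" using elim(6) npos by (simp add: pos_less_divide_eq)
          then have "1 / real (p n) \<le> 1 / (y / 2 * real n)" using npos ratio p1 by (intro divide_left_mono) auto
          also have "\<dots> = (2 / y) * real n powr (-1)" using npos by (simp add: powr_minus_divide)
          finally have "1 / real (p n) < (a / (8 * ?u)) * real n powr (-1/4)" using elim(19) by linarith
          moreover have "2 * (2 * \<tau> n) / ?l < (a / (8 * ?u)) * real n powr (-1/4)" using elim(18) by (simp add: \<tau>_def)
          moreover have "\<theta> n / (4 * ?u) = (a / (8 * ?u)) * real n powr (-1/4) + (a / (8 * ?u)) * real n powr (-1/4)"
            by (simp add: \<theta>_def)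
          ultimately show ?thesis by linarith
        qed
        show "S n \<omega> = emp_cov n (p n) (\<lambda>l. X n l \<omega>)" for \<omega> by (rule S)
        show "Bh n \<in> {B_tot (\<kappa> n), B_corr (\<kappa> n), B_thr n, B_grid m (\<kappa> n)}" by (rule Bh)
      qed
      moreover have "12 * (real (p n))\<^sup>2 * exp (- c * real n * (\<tau> n)\<^sup>2) \<le> 12 * (real n)\<^sup>2 * exp (- c * real n powr (2 * \<epsilon>))"
      proof -
        have e: "- c * real n * (\<tau> n)\<^sup>2 = - c * real n powr (2 * \<epsilon>)" unfolding n\<tau>[symmetric] by (simp add: mult.assoc)
        show ?thesis unfolding e using pn by (intro mult_right_mono mult_left_mono power_mono) auto
      qed
      moreover have "real ((2 * N + 1) ^ p n * (2 * (p n * n * N + 1) + 1)) * (real (p n * n + 2) / real N / sqrt ?l) ^ n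
          \<le> 5 * real n ^ (K + 2) * (1/2) ^ n"
        unfolding N_def
      proof (rule net_union_bound[OF n(1) p1 pn KN l])
        have "18 / sqrt ?l \<le> real n * 1" using elim(3) by linarith
        also have "\<dots> \<le> real n * real n" using n by (intro mult_left_mono) auto
        finally show "18 / sqrt ?l \<le> (real n)\<^sup>2" by (simp add: power2_eq_square)
      qed
      ultimately show ?case unfolding b_def Bhat Bstar by linarith
    qed
  qed
  have upper1: "\<forall>\<^sub>F n in sequentially. measure (M n) {\<omega> \<in> space (M n). Bhat n \<omega> = Bstar n} \<le> 1"
    using eventually_ge_at_top[of 1]
  proof eventually_elim
    case (elim n)
    then show ?case using prob_space.prob_le_1[OF prob[OF elim]] by blast
  qed
  have "(\<lambda>n. 1 - b n) \<longlonglongrightarrow> 1" using tendsto_diff[OF tendsto_const b, of 1] by simp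
  from tendsto_sandwich[OF main upper1 this tendsto_const] show ?thesis .
qed

end
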